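(* Let $\Bbbk$ be a commutative ring, let $a,b\ge 0$ be integers and let $n\in\mathbb Z$. For $\alpha\in P(a,b)$ consider the 2-morphisms of $\dot{\mathcal U}$ $$\sigma_\alpha:=(\pi_\alpha e_a\otimes e_b)\circ S_{a,b}\colon\ \mathcal E^{(a+b)}\mathbf 1_n\{2|\alpha|-ab\}\to\mathcal E^{(a)}\mathcal E^{(b)}\mathbf 1_n,$$ $$\lambda_\alpha:=(-1)^{|\hat\alpha|}\,M_{a,b}\circ(e_a\otimes\pi_{\hat\alpha}e_b)\colon\ \mathcal E^{(a)}\mathcal E^{(b)}\mathbf 1_n\to\mathcal E^{(a+b)}\mathbf 1_n\{2|\alpha|-ab\}.$$ Then $$\sum_{\alpha\in P(a,b)}\sigma_\alpha\colon\bigoplus_{\alpha\in P(a,b)}\mathcal E^{(a+b)}\mathbf 1_n\{2|\alpha|-ab\}\to\mathcal E^{(a)}\mathcal E^{(b)}\mathbf 1_n \quad\text{and}\quad \sum_{\alpha\in P(a,b)}\lambda_\alpha\colon\mathcal E^{(a)}\mathcal E^{(b)}\mathbf 1_n\to\bigoplus_{\alpha\in P(a,b)}\mathcal E^{(a+b)}\mathbf 1_n\{2|\alpha|-ab\}$$ (the maps with components $\sigma_\alpha$, respectively $\lambda_\alpha$) are mutually inverse isomorphisms in $\dot{\mathcal U}$, giving an isomorphism $\mathcal E^{(a)}\mathcal E^{(b)}\mathbf 1_n\cong\bigoplus_{\alpha\in P(a,b)}\mathcal E^{(a+b)}\mathbf 1_n\{2|\alpha|-ab\}$ for all $n\in\mathbb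 Z$.
   Context: **Partitions.** $P(a,b)$ is the set of partitions $\alpha=(\alpha_1\ge\dots\ge\alpha_a\ge0)$ with at most $a$ parts and $\alpha_1\le b$; $|\alpha|=\sum\alpha_i$; $\bar\alpha$ is the conjugate partition; for $\alpha\in P(a,b)$, $\alpha^c=(b-\alpha_a,\dots,b-\alpha_1)$ and $\hat\alpha=\overline{\alpha^c}\in P(b,a)$. $\pi_\alpha$ is the Schur polynomial (in $a$ variables when attached to $\mathcal E^{(a)}$; it is $0$ if $\alpha$ has more than $a$ parts). **The 2-category $\mathcal U$** (over a commutative ring $\Bbbk$). Objects: integers $n$. 1-morphisms $n\to n'$: finite formal direct sums of symbols $W\mathbf 1_n\{t\}$, $t\in\mathbb Z$, $W$ a word in letters $\mathcal E,\mathcal F$ with $n'=n+2(\#\mathcal E-\#\mathcal F)$; so $\mathcal E\mathbf 1_n\colon n\to n+2$, $\mathcal F\mathbf 1_n\colon n\to n-2$; composition is concatenation (rightmost letter first) and shifts add. 2-morphisms: let $\mathcal H$ be the strict $\Bbbk$-linear 2-category with 1-morphisms $W\mathbf 1_n$ and graded 2-hom modules generated, under vertical composition $\circ$ and horizontal composition (juxtaposition; a letter also denotes its identity 2-morphism), for all $n$, by: dots $x\colon\mathcal E\mathbf 1_n\to\mathcal E\mathbf 1_n$, $x_{F}\colon\mathcal F\mathbf 1_n\to\mathcal F\mathbf 1_n$ (degree 2); crossings $\chi\colon\mathcal{EE}\mathbf 1_n\to\mathcal{EE}\mathbf 1_n$, $\chi_F\colon\mathcal{FF}\mathbf 1_n\to\mathcal{FF}\mathbf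 1_n$ (degree $-2$); cups $\eta_n\colon\mathbf 1_n\to\mathcal{FE}\mathbf 1_n$ (degree $1+n$), $\eta'_n\colon\mathbf 1_n\to\mathcal{EF}\mathbf 1_n$ (degree $1-n$); caps $\epsilon_n\colon\mathcal{FE}\mathbf 1_n\to\mathbf 1_n$ (degree $1+n$), $\epsilon'_n\colon\mathcal{EF}\mathbf 1_n\to\mathbf 1_n$ (degree $1-n$), subject to relations (1)-(6) below. $\mathrm{Hom}_{\mathcal U}(W\mathbf 1_n\{t\},W'\mathbf 1_n\{t'\})$ is the degree $t-t'$ part of $\mathcal H(W\mathbf 1_n,W'\mathbf 1_n)$, extended additively. Relations (for all weights; indices of summation are nonnegative integers, empty sums are $0$): (1) $(\epsilon'\mathcal E)\circ(\mathcal E\eta)=\mathcal E=(\mathcal E\epsilon)\circ(\eta'\mathcal E)$, $(\mathcal F\epsilon')\circ(\eta\mathcal F)=\mathcal F=(\epsilon\mathcal F)\circ(\mathcal F\eta')$. (2) $\chi^2=0$; $(\chi\mathcal E)(\mathcal E\chi)(\chi\mathcal E)=(\mathcal E\chi)(\chi\mathcal E)(\mathcal E\chi)$; $\mathcal{EE}=\chi\circ(x\mathcal E)-(\mathcal Ex)\circ\chi=(x\mathcal E)\circ\chi-\chi\circ(\mathcal Ex)$. (3) $x_F=(\mathcal F\epsilon')(\mathcal Fx\mathcal F)(\eta\mathcal F)=(\epsilon\mathcal F)(\mathcal Fx\mathcal F)(\mathcal F\eta')$, and $\chi_F=(\mathcal{FF}\epsilon'^{(2)})(\mathcal{FF}\chi\mathcal{FF})(\eta^{(2)}\mathcal{FF})=(\epsilon^{(2)}\mathcal{FF})(\mathcal{FF}\chi\mathcal{FF})(\mathcal{FF}\eta'^{(2)})$,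 where $\eta^{(a)}\colon\mathbf 1_n\to\mathcal F^a\mathcal E^a\mathbf 1_n$, $\eta'^{(a)}\colon\mathbf 1_n\to\mathcal E^a\mathcal F^a\mathbf 1_n$, $\epsilon^{(a)}\colon\mathcal F^a\mathcal E^a\mathbf 1_n\to\mathbf 1_n$, $\epsilon'^{(a)}\colon\mathcal E^a\mathcal F^a\mathbf 1_n\to\mathbf 1_n$ denote $a$ nested cups/caps. (4) Bubbles. For $r\in\mathbb Z$ put $\circlearrowleft_n(r)=\epsilon_n\circ(\mathcal Fx^{r-n-1})\circ\eta_n$ if $r-n-1\ge0$, and $\circlearrowright_n(r)=\epsilon'_n\circ(x^{r+n-1}\mathcal F)\circ\eta'_n$ if $r+n-1\ge 0$ (both of degree $2r$). These are $0$ if $r<0$ and $1$ if $r=0$. When the number of dots is negative: for $r<0$ the symbol is $0$; for $r\ge0$ the symbols ("fake bubbles") are defined inductively by $\circlearrowleft_n(0)=\circlearrowright_n(0)=1$ and $\sum_{r+s=k}\circlearrowleft_n(r)\circlearrowright_n(s)=\delta_{k,0}$. (5) $(\mathcal E\epsilon'_n)(\chi\mathcal F)(\mathcal E\eta'_n)=-\sum_{f_1+f_2=-n}x^{f_1}\circlearrowright_n(f_2)$ on $\mathcal E\mathbf 1_n$ (bubble to the right); $(\epsilon_n\mathcal E)(\mathcal F\chi)(\eta_n\mathcal E)=\sum_{g_1+g_2=n}\circlearrowleft_n(g_2)\,x^{g_1}$ on $\mathbf 1_n\mathcal E$ (bubble to the left). (6) With $s=(\mathcal{FE}\epsilon')(\mathcal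 F\chi\mathcal F)(\eta\mathcal{EF})\colon\mathcal{EF}\mathbf 1_n\to\mathcal{FE}\mathbf 1_n$ and $s'=(\epsilon\mathcal{EF})(\mathcal F\chi\mathcal F)(\mathcal{FE}\eta')\colon\mathcal{FE}\mathbf 1_n\to\mathcal{EF}\mathbf 1_n$: $\mathcal{EF}\mathbf 1_n=-s's+\sum_{f_1+f_2+f_3=n-1}(x^{f_1}\mathcal F)\eta'_n\circlearrowleft_n(f_2)\,\epsilon'_n(x^{f_3}\mathcal F)$ and $\mathcal{FE}\mathbf 1_n=-ss'+\sum_{g_1+g_2+g_3=-n-1}(\mathcal Fx^{g_1})\eta_n\circlearrowright_n(g_2)\,\epsilon_n(\mathcal Fx^{g_3})$. **$\dot{\mathcal U}$** has the same objects, and $\dot{\mathcal U}(n,m)$ is the Karoubi envelope (idempotent completion) of $\mathcal U(n,m)$: objects are pairs (1-morphism, idempotent), morphisms $(b,e)\to(b',e')$ are $f\colon b\to b'$ with $f=e'fe$. **Divided powers and splitters.** The nilHecke ring $NH_a$ is the ring of endomorphisms of $\mathbb Z[x_1,\dots,x_a]$ generated by multiplications by $x_i$ and divided differences $\partial_i(f)=(f-s_if)/(x_i-x_{i+1})$. It acts on $\mathcal E^a\mathbf 1_n$: $x_i$ is a dot on the $i$-th $\mathcal E$ from the left, $\partial_i$ a crossing of the $i$-th and $(i+1)$-st, and the product is $\circ$. Put $D_a=\partial_{w_0}$ ($w_0\in S_a$ longest), $\delta_a=x_1^{a-1}x_2^{a-2}\cdots x_{a-1}$, $e_a=\delta_aD_a$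 (an idempotent). $\mathcal E^{(a)}\mathbf 1_n:=(\mathcal E^a\mathbf 1_n\{-\tfrac{a(a-1)}2\},e_a)$. For $u\in NH_a$, $v\in NH_b$, $u\otimes v\in NH_{a+b}$ is horizontal juxtaposition ($u$ on the first $a$ strands). $S_{a,b}\colon\mathcal E^{(a+b)}\mathbf 1_n\{-ab\}\to\mathcal E^{(a)}\mathcal E^{(b)}\mathbf 1_n$ is given by $(\delta_a\otimes\delta_b)D_{a+b}$, and $M_{a,b}\colon\mathcal E^{(a)}\mathcal E^{(b)}\mathbf 1_n\{-ab\}\to\mathcal E^{(a+b)}\mathbf 1_n$ is given by $e_{a+b}$. Symmetric polynomials in $x_1,\dots,x_a$ are central in $NH_a$. *)

theory Defs
  imports Main "HOL-Library.Poly_Mapping" "HOL-Combinatorics.Permutations"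
begin

section \<open>The 2-category \<open>\<H>\<close>: diagrams modulo relations\<close>

datatype letter = \<E> | \<F>

type_synonym word = "letter list"

definition wsh :: "word \<Rightarrow> int" where
  "wsh W = 2 * (int (count_list W \<E>) - int (count_list W \<F>))"

text \<open>Formal expressions for 2-morphisms. The integer argument of a generator is the weight \<open>n\<close> of
  its rightmost region. \<open>Cup n\<close>, \<open>Cap n\<close> are \<open>\<eta>\<^sub>n : 1 \<rightarrow> \<F>\<E>\<close> and \<open>\<epsilon>\<^sub>n : \<F>\<E> \<rightarrow> 1\<close>; \<open>Cup' n\<close>, \<open>Cap' n\<close> are
  \<open>\<eta>'\<^sub>n : 1 \<rightarrow> \<E>\<F>\<close> and \<open>\<epsilon>'\<^sub>n : \<E>\<F> \<rightarrow> 1\<close>. Every expression has a definite source and target, so there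
  is one zero for each pair of words and each weight. Scalars have sort
  \<open>{comm_ring, monoid_mult}\<close> below: commutative rings with unit, the zero ring included.\<close>

datatype 'k tm =
    Zero int word word
  | Id int word
  | Dot int
  | DotF int
  | Cross int
  | CrossF int
  | Cup int
  | Cup' int
  | Cap int
  | Cap' int
  | Add "'k tm" "'k tm"
  | Scale 'k "'k tm"
  | VComp "'k tm" "'k tm" (infixr "\<odot>" 70)
  | HComp "'k tm" "'k tm" (infixr "\<star>" 75)

primrec wt :: "'k tm \<Rightarrow> int" where
  "wt (Zero n V W) = n"
| "wt (Id n W) = n"
| "wt (Dot n) = n"
| "wt (DotF n) = n"
| "wt (Cross n) = n"
| "wt (CrossF n) = n"
| "wt (Cup n) = n"
| "wt (Cup' n) = n"
| "wt (Cap n) = n"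
| "wt (Cap' n) = n"
| "wt (Add f g) = wt g"
| "wt (Scale c f) = wt f"
| "wt (f \<odot> g) = wt g"
| "wt (f \<star> g) = wt g"

primrec src :: "'k tm \<Rightarrow> word" where
  "src (Zero n V W) = V"
| "src (Id n W) = W"
| "src (Dot n) = [\<E>]"
| "src (DotF n) = [\<F>]"
| "src (Cross n) = [\<E>, \<E>]"
| "src (CrossF n) = [\<F>, \<F>]"
| "src (Cup n) = []"
| "src (Cup' n) = []"
| "src (Cap n) = [\<F>, \<E>]"
| "src (Cap' n) = [\<E>, \<F>]"
| "src (Add f g) = src g"
| "src (Scale c f) = src f"
| "src (f \<odot> g) = src g"
| "src (f \<star> g) = src f @ src g"

primrec tgt :: "'k tm \<Rightarrow> word" where
  "tgt (Zero n V W) = W"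
| "tgt (Id n W) = W"
| "tgt (Dot n) = [\<E>]"
| "tgt (DotF n) = [\<F>]"
| "tgt (Cross n) = [\<E>, \<E>]"
| "tgt (CrossF n) = [\<F>, \<F>]"
| "tgt (Cup n) = [\<F>, \<E>]"
| "tgt (Cup' n) = [\<E>, \<F>]"
| "tgt (Cap n) = []"
| "tgt (Cap' n) = []"
| "tgt (Add f g) = tgt g"
| "tgt (Scale c f) = tgt f"
| "tgt (f \<odot> g) = tgt f"
| "tgt (f \<star> g) = tgt f @ tgt g"

text \<open>In \<open>f \<star> g\<close> the left factor starts at the weight where the right factor ends. A zero needs
  \<open>wsh V = wsh W\<close>, since 2-morphisms go between 1-morphisms with the same endpoints.\<close>

primrec wf_tm :: "'k tm \<Rightarrow> bool" where
  "wf_tm (Zero n V W) = (wsh V = wsh W)"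
| "wf_tm (Id n W) = True"
| "wf_tm (Dot n) = True"
| "wf_tm (DotF n) = True"
| "wf_tm (Cross n) = True"
| "wf_tm (CrossF n) = True"
| "wf_tm (Cup n) = True"
| "wf_tm (Cup' n) = True"
| "wf_tm (Cap n) = True"
| "wf_tm (Cap' n) = True"
| "wf_tm (Add f g) = (wf_tm f \<and> wf_tm g \<and> wt f = wt g \<and> src f = src g \<and> tgt f = tgt g)"
| "wf_tm (Scale c f) = wf_tm f"
| "wf_tm (f \<odot> g) = (wf_tm f \<and> wf_tm g \<and> wt f = wt g \<and> src f = tgt g)"
| "wf_tm (f \<star> g) = (wf_tm f \<and> wf_tm g \<and> wt f = wt g + wsh (src g))"

definition parallel :: "'k tm \<Rightarrow> 'k tm \<Rightarrow> bool" where
  "parallel f g \<longleftrightarrow> wf_tm f \<and> wf_tm g \<and> wt f = wt g \<and> src f = src g \<and> tgt f = tgt g"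

inductive homog :: "'k tm \<Rightarrow> int \<Rightarrow> bool" where
  "homog (Zero n V W) d"
| "homog (Id n W) 0"
| "homog (Dot n) 2"
| "homog (DotF n) 2"
| "homog (Cross n) (-2)"
| "homog (CrossF n) (-2)"
| "homog (Cup n) (1 + n)"
| "homog (Cup' n) (1 - n)"
| "homog (Cap n) (1 + n)"
| "homog (Cap' n) (1 - n)"
| "homog f d \<Longrightarrow> homog g d \<Longrightarrow> homog (Add f g) d"
| "homog f d \<Longrightarrow> homog (Scale c f) d"
| "homog f d \<Longrightarrow> homog g d' \<Longrightarrow> homog (f \<odot> g) (d + d')"
| "homog f d \<Longrightarrow> homog g d' \<Longrightarrow> homog (f \<star> g) (d + d')"

text \<open>Whiskering by identities; the weight of the identity is determined by the other factor.\<close>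

abbreviation whisker_left :: "word \<Rightarrow> 'k tm \<Rightarrow> 'k tm" (infixr "\<rhd>" 80) where
  "W \<rhd> f \<equiv> Id (wt f + wsh (src f)) W \<star> f"

abbreviation whisker_right :: "'k tm \<Rightarrow> word \<Rightarrow> 'k tm" (infixl "\<lhd>" 85) where
  "f \<lhd> V \<equiv> f \<star> Id (wt f - wsh V) V"

definition tsum :: "int \<Rightarrow> word \<Rightarrow> word \<Rightarrow> 'k tm list \<Rightarrow> 'k tm" where
  "tsum n V W ts = foldr Add ts (Zero n V W)"

text \<open>All ways to write \<open>k\<close> as an ordered sum of two, respectively three, nonnegative integers
  (none if \<open>k < 0\<close>).\<close>

definition splits2 :: "int \<Rightarrow> (nat \<times> nat) list" where
  "splits2 k = [(f1, nat k - f1). f1 \<leftarrow> [0..<nat (k + 1)]]"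

definition splits3 :: "int \<Rightarrow> (nat \<times> nat \<times> nat) list" where
  "splits3 k = [(f1, f2, f3). (f1, r) \<leftarrow> splits2 k, (f2, f3) \<leftarrow> splits2 (int r)]"

definition dots :: "int \<Rightarrow> nat \<Rightarrow> 'k tm" where
  "dots n k = ((\<odot>) (Dot n) ^^ k) (Id n [\<E>])"

definition ccw_real :: "int \<Rightarrow> nat \<Rightarrow> 'k tm" where
  "ccw_real n k = Cap n \<odot> ([\<F>] \<rhd> dots n k) \<odot> Cup n"

definition cw_real :: "int \<Rightarrow> nat \<Rightarrow> 'k tm" where
  "cw_real n k = Cap' n \<odot> (dots (n - 2) k \<lhd> [\<F>]) \<odot> Cup' n"

text \<open>Fake bubbles: the equation \<open>\<Sum>\<^bsub>r+s=k\<^esub> ccw(r) cw(s) = \<delta>\<^bsub>k,0\<^esub>\<close> solved for \<open>ccw(k)\<close>, respectively \<open>cw(k)\<close>.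
  A fake \<open>ccw\<close> of degree \<open>r \<ge> 0\<close> only occurs for \<open>n \<ge> r\<close>, and then every \<open>cw(s)\<close> with \<open>s > 0\<close> is a genuine
  bubble with \<open>s + n - 1 \<ge> 0\<close> dots; symmetrically for a fake \<open>cw\<close>.\<close>

fun ccw_fake :: "int \<Rightarrow> nat \<Rightarrow> 'k::{comm_ring,monoid_mult} tm" where
  "ccw_fake n k = (if k = 0 then Id n [] else
     Scale (- 1) (tsum n [] [] (map (\<lambda>r. ccw_fake n r \<odot> cw_real n (nat (int (k - r) + n - 1))) [0..<k])))"

fun cw_fake :: "int \<Rightarrow> nat \<Rightarrow> 'k::{comm_ring,monoid_mult} tm" where
  "cw_fake n k = (if k = 0 then Id n [] else
     Scale (- 1) (tsum n [] [] (map (\<lambda>s. ccw_real n (nat (int (k - s) - n - 1)) \<odot> cw_fake n s) [0..<k])))"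

declare ccw_fake.simps [simp del] cw_fake.simps [simp del]

definition ccw :: "int \<Rightarrow> int \<Rightarrow> 'k::{comm_ring,monoid_mult} tm" where
  "ccw n r = (if r - n - 1 \<ge> 0 then ccw_real n (nat (r - n - 1))
     else if r < 0 then Zero n [] [] else ccw_fake n (nat r))"

definition cw :: "int \<Rightarrow> int \<Rightarrow> 'k::{comm_ring,monoid_mult} tm" where
  "cw n r = (if r + n - 1 \<ge> 0 then cw_real n (nat (r + n - 1))
     else if r < 0 then Zero n [] [] else cw_fake n (nat r))"

definition Cup2 :: "int \<Rightarrow> 'k tm" where
  "Cup2 n = ([\<F>] \<rhd> Cup (n + 2) \<lhd> [\<E>]) \<odot> Cup n"

definition Cup2' :: "int \<Rightarrow> 'k tm" where
  "Cup2' n = ([\<E>] \<rhd> Cup' (n - 2) \<lhd> [\<F>]) \<odot> Cup' n"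

definition Cap2 :: "int \<Rightarrow> 'k tm" where
  "Cap2 n = Cap n \<odot> ([\<F>] \<rhd> Cap (n + 2) \<lhd> [\<E>])"

definition Cap2' :: "int \<Rightarrow> 'k tm" where
  "Cap2' n = Cap' n \<odot> ([\<E>] \<rhd> Cap' (n - 2) \<lhd> [\<F>])"

text \<open>The sideways crossings \<open>s : \<E>\<F> \<rightarrow> \<F>\<E>\<close> and \<open>s' : \<F>\<E> \<rightarrow> \<E>\<F>\<close>.\<close>

definition side :: "int \<Rightarrow> 'k tm" where
  "side n = ([\<F>, \<E>] \<rhd> Cap' n) \<odot> ([\<F>] \<rhd> Cross (n - 2) \<lhd> [\<F>]) \<odot> (Cup n \<lhd> [\<E>, \<F>])"

definition side' :: "int \<Rightarrow> 'k tm" where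
  "side' n = (Cap n \<lhd> [\<E>, \<F>]) \<odot> ([\<F>] \<rhd> Cross (n - 2) \<lhd> [\<F>]) \<odot> ([\<F>, \<E>] \<rhd> Cup' n)"

inductive sl2_rel :: "'k::{comm_ring,monoid_mult} tm \<Rightarrow> 'k tm \<Rightarrow> bool" where
  zigzag1: "sl2_rel ((Cap' (n + 2) \<lhd> [\<E>]) \<odot> ([\<E>] \<rhd> Cup n)) (Id n [\<E>])"
| zigzag2: "sl2_rel (([\<E>] \<rhd> Cap n) \<odot> (Cup' (n + 2) \<lhd> [\<E>])) (Id n [\<E>])"
| zigzag3: "sl2_rel (([\<F>] \<rhd> Cap' n) \<odot> (Cup (n - 2) \<lhd> [\<F>])) (Id n [\<F>])"
| zigzag4: "sl2_rel ((Cap (n - 2) \<lhd> [\<F>]) \<odot> ([\<F>] \<rhd> Cup' n)) (Id n [\<F>])"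
| nil_square: "sl2_rel (Cross n \<odot> Cross n) (Zero n [\<E>, \<E>] [\<E>, \<E>])"
| nil_braid: "sl2_rel ((Cross (n + 2) \<lhd> [\<E>]) \<odot> ([\<E>] \<rhd> Cross n) \<odot> (Cross (n + 2) \<lhd> [\<E>]))
                      (([\<E>] \<rhd> Cross n) \<odot> (Cross (n + 2) \<lhd> [\<E>]) \<odot> ([\<E>] \<rhd> Cross n))"
| nil_dot1: "sl2_rel (Id n [\<E>, \<E>])
    (Add (Cross n \<odot> (Dot (n + 2) \<lhd> [\<E>])) (Scale (- 1) (([\<E>] \<rhd> Dot n) \<odot> Cross n)))"
| nil_dot2: "sl2_rel (Id n [\<E>, \<E>])
    (Add ((Dot (n + 2) \<lhd> [\<E>]) \<odot> Cross n) (Scale (- 1) (Cross n \<odot> ([\<E>] \<rhd> Dot n))))"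
| dotF1: "sl2_rel (DotF n)
    (([\<F>] \<rhd> Cap' n) \<odot> ([\<F>] \<rhd> Dot (n - 2) \<lhd> [\<F>]) \<odot> (Cup (n - 2) \<lhd> [\<F>]))"
| dotF2: "sl2_rel (DotF n)
    ((Cap (n - 2) \<lhd> [\<F>]) \<odot> ([\<F>] \<rhd> Dot (n - 2) \<lhd> [\<F>]) \<odot> ([\<F>] \<rhd> Cup' n))"
| crossF1: "sl2_rel (CrossF n)
    (([\<F>, \<F>] \<rhd> Cap2' n) \<odot> ([\<F>, \<F>] \<rhd> Cross (n - 4) \<lhd> [\<F>, \<F>]) \<odot> (Cup2 (n - 4) \<lhd> [\<F>, \<F>]))"
| crossF2: "sl2_rel (CrossF n)
    ((Cap2 (n - 4) \<lhd> [\<F>, \<F>]) \<odot> ([\<F>, \<F>] \<rhd> Cross (n - 4) \<lhd> [\<F>, \<F>]) \<odot> ([\<F>, \<F>] \<rhd> Cup2' n))"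
| bubble_ccw_neg: "r < 0 \<Longrightarrow> r - n - 1 \<ge> 0 \<Longrightarrow> sl2_rel (ccw_real n (nat (r - n - 1))) (Zero n [] [])"
| bubble_ccw_zero: "- n - 1 \<ge> 0 \<Longrightarrow> sl2_rel (ccw_real n (nat (- n - 1))) (Id n [])"
| bubble_cw_neg: "r < 0 \<Longrightarrow> r + n - 1 \<ge> 0 \<Longrightarrow> sl2_rel (cw_real n (nat (r + n - 1))) (Zero n [] [])"
| bubble_cw_zero: "n - 1 \<ge> 0 \<Longrightarrow> sl2_rel (cw_real n (nat (n - 1))) (Id n [])"
| curl1: "sl2_rel (([\<E>] \<rhd> Cap' n) \<odot> (Cross (n - 2) \<lhd> [\<F>]) \<odot> ([\<E>] \<rhd> Cup' n))
    (Scale (- 1) (tsum n [\<E>] [\<E>] [dots n f1 \<star> cw n (int f2). (f1, f2) \<leftarrow> splits2 (- n)]))"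
| curl2: "sl2_rel ((Cap n \<lhd> [\<E>]) \<odot> ([\<F>] \<rhd> Cross (n - 2)) \<odot> (Cup n \<lhd> [\<E>]))
    (tsum (n - 2) [\<E>] [\<E>] [ccw n (int g2) \<star> dots (n - 2) g1. (g1, g2) \<leftarrow> splits2 n])"
| mixed1: "sl2_rel (Id n [\<E>, \<F>])
    (Add (Scale (- 1) (side' n \<odot> side n))
      (tsum n [\<E>, \<F>] [\<E>, \<F>]
        [(dots (n - 2) f1 \<lhd> [\<F>]) \<odot> Cup' n \<odot> ccw n (int f2) \<odot> Cap' n \<odot> (dots (n - 2) f3 \<lhd> [\<F>]).
          (f1, f2, f3) \<leftarrow> splits3 (n - 1)]))"
| mixed2: "sl2_rel (Id n [\<F>, \<E>])
    (Add (Scale (- 1) (side n \<odot> side' n))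
      (tsum n [\<F>, \<E>] [\<F>, \<E>]
        [([\<F>] \<rhd> dots n g1) \<odot> Cup n \<odot> cw n (int g2) \<odot> Cap n \<odot> ([\<F>] \<rhd> dots n g3).
          (g1, g2, g3) \<leftarrow> splits3 (- n - 1)]))"

text \<open>The axioms of a strict linear 2-category. No side conditions are needed here because
  they are imposed only between parallel well-formed expressions, see \<open>ax\<close> below.\<close>

inductive two_cat_ax :: "'k::{comm_ring,monoid_mult} tm \<Rightarrow> 'k tm \<Rightarrow> bool" where
  "two_cat_ax (Add f g) (Add g f)"
| "two_cat_ax (Add (Add f g) h) (Add f (Add g h))"
| "two_cat_ax (Add (Zero (wt f) (src f) (tgt f)) f) f"
| "two_cat_ax (Add f (Scale (- 1) f)) (Zero (wt f) (src f) (tgt f))"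
| "two_cat_ax (Scale c (Add f g)) (Add (Scale c f) (Scale c g))"
| "two_cat_ax (Scale (c + d) f) (Add (Scale c f) (Scale d f))"
| "two_cat_ax (Scale (c * d) f) (Scale c (Scale d f))"
| "two_cat_ax (Scale 1 f) f"
| "two_cat_ax (Add f f' \<odot> g) (Add (f \<odot> g) (f' \<odot> g))"
| "two_cat_ax (f \<odot> Add g g') (Add (f \<odot> g) (f \<odot> g'))"
| "two_cat_ax (Scale c f \<odot> g) (Scale c (f \<odot> g))"
| "two_cat_ax (f \<odot> Scale c g) (Scale c (f \<odot> g))"
| "two_cat_ax (Add f f' \<star> g) (Add (f \<star> g) (f' \<star> g))"
| "two_cat_ax (f \<star> Add g g') (Add (f \<star> g) (f \<star> g'))"
| "two_cat_ax (Scale c f \<star> g) (Scale c (f \<star> g))"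
| "two_cat_ax (f \<star> Scale c g) (Scale c (f \<star> g))"
| "two_cat_ax (Id (wt f) (tgt f) \<odot> f) f"
| "two_cat_ax (f \<odot> Id (wt f) (src f)) f"
| "two_cat_ax ((f \<odot> g) \<odot> h) (f \<odot> (g \<odot> h))"
| "two_cat_ax ([] \<rhd> f) f"
| "two_cat_ax (f \<lhd> []) f"
| "two_cat_ax ((f \<star> g) \<star> h) (f \<star> (g \<star> h))"
| "two_cat_ax (Id m W \<star> Id n V) (Id n (W @ V))"
| "two_cat_ax ((f \<star> g) \<odot> (f' \<star> g')) ((f \<odot> f') \<star> (g \<odot> g'))"

inductive tm_eq :: "'k::{comm_ring,monoid_mult} tm \<Rightarrow> 'k tm \<Rightarrow> bool" (infix "\<approx>" 50) where
  ax: "two_cat_ax f g \<Longrightarrow> parallel f g \<Longrightarrow> f \<approx> g"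
| sl2: "sl2_rel f g \<Longrightarrow> parallel f g \<Longrightarrow> f \<approx> g"
| refl: "f \<approx> f"
| sym: "f \<approx> g \<Longrightarrow> g \<approx> f"
| trans: "f \<approx> g \<Longrightarrow> g \<approx> h \<Longrightarrow> f \<approx> h"
| Add: "f \<approx> f' \<Longrightarrow> g \<approx> g' \<Longrightarrow> Add f g \<approx> Add f' g'"
| Scale: "f \<approx> f' \<Longrightarrow> Scale c f \<approx> Scale c f'"
| VComp: "f \<approx> f' \<Longrightarrow> g \<approx> g' \<Longrightarrow> f \<odot> g \<approx> f' \<odot> g'"
| HComp: "f \<approx> f' \<Longrightarrow> g \<approx> g' \<Longrightarrow> f \<star> g \<approx> f' \<star> g'"

text \<open>The condition \<open>parallel\<close> in \<open>sl2\<close> never excludes a relation.\<close>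

lemma wt_tsum [simp]: "wt (tsum n V W ts) = n" "src (tsum n V W ts) = V" "tgt (tsum n V W ts) = W"
proof -
  have "wt (tsum n V W ts) = n \<and> src (tsum n V W ts) = V \<and> tgt (tsum n V W ts) = W" for ts :: "'x tm list"
    by (induction ts) (auto simp: tsum_def)
  then show "wt (tsum n V W ts) = n" "src (tsum n V W ts) = V" "tgt (tsum n V W ts) = W" by blast+
qed

lemma wf_tsum:
  assumes "wsh V = wsh W" "\<And>t. t \<in> set ts \<Longrightarrow> wf_tm t \<and> wt t = n \<and> src t = V \<and> tgt t = W"
  shows "wf_tm (tsum n V W ts)"
  using assms(2)
proof (induction ts)
  case (Cons t ts)
  then show ?case by (auto simp: wt_tsum[unfolded tsum_def] tsum_def)
qed (auto simp: tsum_def assms)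

lemma wf_dots [simp]:
  "wf_tm (dots n k)" "wt (dots n k) = n" "src (dots n k) = [\<E>]" "tgt (dots n k) = [\<E>]"
proof -
  have *: "wf_tm (dots n k :: 'x tm) \<and> tgt (dots n k :: 'x tm) = [\<E>]
      \<and> wt (dots n k :: 'x tm) = n \<and> src (dots n k :: 'x tm) = [\<E>]" for k
    by (induction k) (auto simp: dots_def)
  then show "wf_tm (dots n k)" "wt (dots n k) = n" "src (dots n k) = [\<E>]" "tgt (dots n k) = [\<E>]"
    using * by blast+
qed

lemma wf_bubbles [simp]:
  "wf_tm (ccw_real n k)" "wt (ccw_real n k) = n" "src (ccw_real n k) = []" "tgt (ccw_real n k) = []"
  "wf_tm (cw_real n k)" "wt (cw_real n k) = n" "src (cw_real n k) = []" "tgt (cw_real n k) = []"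
  by (auto simp: ccw_real_def cw_real_def wsh_def)

lemma wf_fake [simp]:
  "wt (ccw_fake n k) = n" "src (ccw_fake n k) = []" "tgt (ccw_fake n k) = []"
  "wt (cw_fake n k) = n" "src (cw_fake n k) = []" "tgt (cw_fake n k) = []"
  by (simp_all add: ccw_fake.simps[of n k] cw_fake.simps[of n k])

lemma wf_fake' [simp]: "wf_tm (ccw_fake n k)"
proof (induction k rule: less_induct)
  case (less k) then show ?case by (subst ccw_fake.simps) (auto intro!: wf_tsum)
qed

lemma wf_fake'' [simp]: "wf_tm (cw_fake n k)"
proof (induction k rule: less_induct)
  case (less k) then show ?case by (subst cw_fake.simps) (auto intro!: wf_tsum)
qed

lemma wf_ccw_cw [simp]:
  "wf_tm (ccw n k)" "wt (ccw n k) = n" "src (ccw n k) = []" "tgt (ccw n k) = []"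
  "wf_tm (cw n k)" "wt (cw n k) = n" "src (cw n k) = []" "tgt (cw n k) = []"
  by (auto simp: ccw_def cw_def)

lemma sl2_rel_parallel: "sl2_rel f g \<Longrightarrow> parallel f g"
  by (induction rule: sl2_rel.induct)
    (auto simp: parallel_def wsh_def Cup2_def Cup2'_def Cap2_def Cap2'_def side_def side'_def
      intro!: wf_tsum)

lemma tm_eq_type:
  "f \<approx> g \<Longrightarrow> wf_tm f = wf_tm g \<and> wt f = wt g \<and> src f = src g \<and> tgt f = tgt g"
  by (induction rule: tm_eq.induct) (auto simp: parallel_def)

quotient_type (overloaded) 'k hmor = "'k::{comm_ring,monoid_mult} tm" / tm_eq
  by (intro equivpI reflpI sympI transpI) (auto intro: tm_eq.refl tm_eq.sym tm_eq.trans)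

lift_definition hadd :: "'k::{comm_ring,monoid_mult} hmor \<Rightarrow> 'k hmor \<Rightarrow> 'k hmor" is Add
  by (rule tm_eq.Add)

lift_definition hscale :: "'k::{comm_ring,monoid_mult} \<Rightarrow> 'k hmor \<Rightarrow> 'k hmor" is Scale
  by (rule tm_eq.Scale)

lift_definition vc :: "'k::{comm_ring,monoid_mult} hmor \<Rightarrow> 'k hmor \<Rightarrow> 'k hmor" (infixr "\<bullet>" 70) is VComp
  by (rule tm_eq.VComp)

lift_definition hc :: "'k::{comm_ring,monoid_mult} hmor \<Rightarrow> 'k hmor \<Rightarrow> 'k hmor" (infixr "\<diamondop>" 75) is HComp
  by (rule tm_eq.HComp)

lift_definition hzero :: "int \<Rightarrow> word \<Rightarrow> word \<Rightarrow> 'k::{comm_ring,monoid_mult} hmor" is Zero .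

lift_definition hid :: "int \<Rightarrow> word \<Rightarrow> 'k::{comm_ring,monoid_mult} hmor" is Id .

lift_definition hdot :: "int \<Rightarrow> 'k::{comm_ring,monoid_mult} hmor" is Dot .

lift_definition hcross :: "int \<Rightarrow> 'k::{comm_ring,monoid_mult} hmor" is Cross .

text \<open>The degree \<open>d\<close> part of \<open>\<H>(V 1\<^sub>n, W 1\<^sub>n)\<close>.\<close>

definition hhom :: "int \<Rightarrow> word \<Rightarrow> word \<Rightarrow> int \<Rightarrow> 'k::{comm_ring,monoid_mult} hmor set" where
  "hhom n V W d = abs_hmor ` {t. wf_tm t \<and> wt t = n \<and> src t = V \<and> tgt t = W \<and> homog t d}"


section \<open>The 2-category \<open>\<U>\<close>\<close>

text \<open>\<open>OneMor n m [(W\<^sub>1,t\<^sub>1), \<dots>, (W\<^sub>k,t\<^sub>k)]\<close> is the formal direct sum of the \<open>W\<^sub>i 1\<^sub>n{t\<^sub>i} : n \<rightarrow> m\<close>.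
  In \<open>TwoMor X Y M\<close> the entry \<open>M ! i ! j\<close> is the component from the \<open>j\<close>th summand of \<open>X\<close> to the \<open>i\<close>th
  summand of \<open>Y\<close>.\<close>

datatype one_mor = OneMor (sw: int) (tw: int) (summands: "(word \<times> int) list")

declare [[typedef_overloaded]]

datatype 'k two_mor = TwoMor (dom2: one_mor) (cod2: one_mor) (entries: "'k hmor list list")

definition is_one_mor :: "one_mor \<Rightarrow> bool" where
  "is_one_mor X \<longleftrightarrow> (\<forall>(W, t) \<in> set (summands X). tw X = sw X + wsh W)"

definition uhom :: "one_mor \<Rightarrow> one_mor \<Rightarrow> 'k::{comm_ring,monoid_mult} two_mor set" where
  "uhom X Y = {f. is_one_mor X \<and> is_one_mor Y \<and> sw X = sw Y \<and> tw X = tw Y \<and> dom2 f = X \<and> cod2 f = Y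
     \<and> length (entries f) = length (summands Y)
     \<and> (\<forall>i < length (summands Y). length (entries f ! i) = length (summands X)
        \<and> (\<forall>j < length (summands X).
             case (summands X ! j, summands Y ! i) of ((V, t), (W, t')) \<Rightarrow>
               entries f ! i ! j \<in> hhom (sw X) V W (t - t')))}"

definition ucomp :: "'k::{comm_ring,monoid_mult} two_mor \<Rightarrow> 'k two_mor \<Rightarrow> 'k two_mor" (infixr "\<bullet>\<^sub>2" 70) where
  "g \<bullet>\<^sub>2 f = TwoMor (dom2 f) (cod2 g)
     [[foldr hadd [entries g ! i ! j \<bullet> entries f ! j ! k. j \<leftarrow> [0..<length (summands (cod2 f))]]
          (hzero (sw (dom2 f)) (fst (summands (dom2 f) ! k)) (fst (summands (cod2 g) ! i))).
        k \<leftarrow> [0..<length (summands (dom2 f))]]. i \<leftarrow> [0..<length (summands (cod2 g))]]"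

definition hcomp1 :: "one_mor \<Rightarrow> one_mor \<Rightarrow> one_mor" (infixr "\<diamondop>\<^sub>1" 75) where
  "X \<diamondop>\<^sub>1 Y = OneMor (sw Y) (tw X) [(V @ W, s + t). (V, s) \<leftarrow> summands X, (W, t) \<leftarrow> summands Y]"

definition hcomp2 :: "'k::{comm_ring,monoid_mult} two_mor \<Rightarrow> 'k two_mor \<Rightarrow> 'k two_mor" (infixr "\<diamondop>\<^sub>2" 75) where
  "f \<diamondop>\<^sub>2 g = TwoMor (dom2 f \<diamondop>\<^sub>1 dom2 g) (cod2 f \<diamondop>\<^sub>1 cod2 g)
     [[x \<diamondop> y. x \<leftarrow> r, y \<leftarrow> s]. r \<leftarrow> entries f, s \<leftarrow> entries g]"

definition shift1 :: "int \<Rightarrow> one_mor \<Rightarrow> one_mor" where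
  "shift1 t X = OneMor (sw X) (tw X) [(W, s + t). (W, s) \<leftarrow> summands X]"

definition shift2 :: "int \<Rightarrow> 'k two_mor \<Rightarrow> 'k two_mor" where
  "shift2 t f = TwoMor (shift1 t (dom2 f)) (shift1 t (cod2 f)) (entries f)"

definition dsum1 :: "int \<Rightarrow> int \<Rightarrow> one_mor list \<Rightarrow> one_mor" where
  "dsum1 n m Xs = OneMor n m (concat (map summands Xs))"

text \<open>Block matrices: the block diagonal matrix, and the maps out of (into) a direct sum with given
  components.\<close>

definition dsum2 :: "int \<Rightarrow> int \<Rightarrow> 'k::{comm_ring,monoid_mult} two_mor list \<Rightarrow> 'k two_mor" where
  "dsum2 n m fs = TwoMor (dsum1 n m (map dom2 fs)) (dsum1 n m (map cod2 fs))
     [concat [if i = j then entries (fs ! i) ! k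
              else [hzero n V (fst (summands (cod2 (fs ! i)) ! k)). (V, s) \<leftarrow> summands (dom2 (fs ! j))].
          j \<leftarrow> [0..<length fs]].
        i \<leftarrow> [0..<length fs], k \<leftarrow> [0..<length (summands (cod2 (fs ! i)))]]"

definition out_of_dsum :: "int \<Rightarrow> int \<Rightarrow> one_mor \<Rightarrow> 'k two_mor list \<Rightarrow> 'k two_mor" where
  "out_of_dsum n m Y fs = TwoMor (dsum1 n m (map dom2 fs)) Y
     [concat [entries f ! i. f \<leftarrow> fs]. i \<leftarrow> [0..<length (summands Y)]]"

definition into_dsum :: "int \<Rightarrow> int \<Rightarrow> one_mor \<Rightarrow> 'k two_mor list \<Rightarrow> 'k two_mor" where
  "into_dsum n m X fs = TwoMor X (dsum1 n m (map cod2 fs)) (concat (map entries fs))"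


section \<open>The Karoubi envelope\<close>

text \<open>A 1-morphism is a pair of a 1-morphism \<open>X\<close> of \<open>\<U>\<close> and an idempotent \<open>e\<close> on it; its identity
  2-morphism is \<open>e\<close>. Vertical and horizontal composition are those of \<open>\<U>\<close>.\<close>

type_synonym 'k kob = "one_mor \<times> 'k two_mor"

definition is_kob :: "'k::{comm_ring,monoid_mult} kob \<Rightarrow> bool" where
  "is_kob A \<longleftrightarrow> snd A \<in> uhom (fst A) (fst A) \<and> snd A \<bullet>\<^sub>2 snd A = snd A"

definition khom :: "'k::{comm_ring,monoid_mult} kob \<Rightarrow> 'k kob \<Rightarrow> 'k two_mor set" where
  "khom A B = {f. is_kob A \<and> is_kob B \<and> f \<in> uhom (fst A) (fst B) \<and> f = snd B \<bullet>\<^sub>2 f \<bullet>\<^sub>2 snd A}"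

definition mutually_inverse :: "'k::{comm_ring,monoid_mult} kob \<Rightarrow> 'k kob \<Rightarrow> 'k two_mor \<Rightarrow> 'k two_mor \<Rightarrow> bool" where
  "mutually_inverse A B f g \<longleftrightarrow> f \<in> khom A B \<and> g \<in> khom B A \<and> g \<bullet>\<^sub>2 f = snd A \<and> f \<bullet>\<^sub>2 g = snd B"

definition kiso :: "'k::{comm_ring,monoid_mult} kob \<Rightarrow> 'k kob \<Rightarrow> bool" (infix "\<cong>\<^sub>K" 50) where
  "A \<cong>\<^sub>K B \<longleftrightarrow> (\<exists>f g. mutually_inverse A B f g)"

definition kcomp :: "'k::{comm_ring,monoid_mult} kob \<Rightarrow> 'k kob \<Rightarrow> 'k kob" (infixr "\<diamondop>\<^sub>K" 75) where
  "A \<diamondop>\<^sub>K B = (fst A \<diamondop>\<^sub>1 fst B, snd A \<diamondop>\<^sub>2 snd B)"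

definition kshift :: "int \<Rightarrow> 'k kob \<Rightarrow> 'k kob" where
  "kshift t A = (shift1 t (fst A), shift2 t (snd A))"

definition kdsum :: "int \<Rightarrow> int \<Rightarrow> 'k::{comm_ring,monoid_mult} kob list \<Rightarrow> 'k kob" where
  "kdsum n m As = (dsum1 n m (map fst As), dsum2 n m (map snd As))"


section \<open>Partitions and Schur polynomials\<close>

text \<open>An element of \<open>P(a,b)\<close> is a list of length exactly \<open>a\<close>, padded with zeros. \<open>conj_part b\<close> is the
  conjugate of a partition with largest part at most \<open>b\<close>, as a list of length \<open>b\<close>.\<close>

definition Parts :: "nat \<Rightarrow> nat \<Rightarrow> nat list set" where
  "Parts a b = {\<alpha>. length \<alpha> = a \<and> sorted_wrt (\<ge>) \<alpha> \<and> (\<forall>x \<in> set \<alpha>. x \<le> b)}"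

definition conj_part :: "nat \<Rightarrow> nat list \<Rightarrow> nat list" where
  "conj_part b \<alpha> = [card {i. i < length \<alpha> \<and> \<alpha> ! i > j}. j \<leftarrow> [0..<b]]"

definition compl_part :: "nat \<Rightarrow> nat list \<Rightarrow> nat list" where
  "compl_part b \<alpha> = map (\<lambda>x. b - x) (rev \<alpha>)"

definition hat_part :: "nat \<Rightarrow> nat list \<Rightarrow> nat list" where
  "hat_part b \<alpha> = conj_part b (compl_part b \<alpha>)"

type_synonym mpoly = "(nat \<Rightarrow>\<^sub>0 nat) \<Rightarrow>\<^sub>0 int"

definition Xvar :: "nat \<Rightarrow> mpoly" where
  "Xvar i = Poly_Mapping.single (Poly_Mapping.single i 1) 1"

definition alternant :: "nat list \<Rightarrow> mpoly" where
  "alternant \<gamma> = (\<Sum>w | w permutes {..<length \<gamma>}. of_int (sign w) * (\<Prod>i<length \<gamma>. Xvar (w i) ^ (\<gamma> ! i)))"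

text \<open>The Schur polynomial of \<open>\<alpha>\<close> in \<open>a = length \<alpha>\<close> variables, as the quotient of alternants
  \<open>a\<^bsub>\<alpha>+\<delta>\<^esub> / a\<^bsub>\<delta>\<^esub>\<close> with \<open>\<delta> = (a - 1, \<dots>, 1, 0)\<close>. Variables are numbered from \<open>0\<close>.\<close>

definition schur :: "nat list \<Rightarrow> mpoly" where
  "schur \<alpha> = (THE p. p * alternant [length \<alpha> - 1 - i. i \<leftarrow> [0..<length \<alpha>]]
     = alternant [\<alpha> ! i + (length \<alpha> - 1 - i). i \<leftarrow> [0..<length \<alpha>]])"


section \<open>The action of the nilHecke ring, divided powers and splitters\<close>

text \<open>In \<open>x_act n a i\<close> and \<open>d_act n a i\<close>, the images of \<open>x\<^bsub>i+1\<^esub>\<close> and \<open>\<partial>\<^bsub>i+1\<^esub>\<close> on \<open>\<E>\<^sup>a 1\<^sub>n\<close>, strands are numbered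
  from \<open>0\<close> at the left.\<close>

abbreviation Ew :: "nat \<Rightarrow> word" where "Ew a \<equiv> replicate a \<E>"

definition x_act :: "int \<Rightarrow> nat \<Rightarrow> nat \<Rightarrow> 'k::{comm_ring,monoid_mult} hmor" where
  "x_act n a i = hid (n + 2 * int (a - i)) (Ew i) \<diamondop> hdot (n + 2 * int (a - 1 - i)) \<diamondop> hid n (Ew (a - 1 - i))"

definition d_act :: "int \<Rightarrow> nat \<Rightarrow> nat \<Rightarrow> 'k::{comm_ring,monoid_mult} hmor" where
  "d_act n a i = hid (n + 2 * int (a - i)) (Ew i) \<diamondop> hcross (n + 2 * int (a - 2 - i)) \<diamondop> hid n (Ew (a - 2 - i))"

definition hprod :: "int \<Rightarrow> nat \<Rightarrow> 'k::{comm_ring,monoid_mult} hmor list \<Rightarrow> 'k hmor" where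
  "hprod n a hs = foldr (\<bullet>) hs (hid n (Ew a))"

definition monom_act :: "int \<Rightarrow> nat \<Rightarrow> (nat \<Rightarrow> nat) \<Rightarrow> 'k::{comm_ring,monoid_mult} hmor" where
  "monom_act n a m = hprod n a (concat [replicate (m i) (x_act n a i). i \<leftarrow> [0..<a]])"

text \<open>The map \<open>of_int\<close>, which is not available for rings that may be zero.\<close>

definition int_scalar :: "int \<Rightarrow> 'k::{comm_ring,monoid_mult}" where
  "int_scalar c = (if c \<ge> 0 then ((+) 1 ^^ nat c) 0 else - ((+) 1 ^^ nat (- c)) 0)"

definition poly_act :: "int \<Rightarrow> nat \<Rightarrow> mpoly \<Rightarrow> 'k::{comm_ring,monoid_mult} hmor" where
  "poly_act n a p = Finite_Set.fold
     (\<lambda>m. hadd (hscale (int_scalar (Poly_Mapping.lookup p m)) (monom_act n a (Poly_Mapping.lookup m))))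
     (hzero n (Ew a) (Ew a)) (Poly_Mapping.keys p)"

text \<open>\<open>\<partial>\<^bsub>w\<^sub>0\<^esub>\<close> as the product along the reduced word
  \<open>(s\<^sub>1 s\<^sub>2 \<cdots> s\<^bsub>a-1\<^esub>) (s\<^sub>1 \<cdots> s\<^bsub>a-2\<^esub>) \<cdots> (s\<^sub>1 s\<^sub>2) s\<^sub>1\<close> of the longest element \<open>w\<^sub>0\<close>.\<close>

definition D_act :: "int \<Rightarrow> nat \<Rightarrow> 'k::{comm_ring,monoid_mult} hmor" where
  "D_act n a = hprod n a (map (d_act n a) (concat [[0..<k]. k \<leftarrow> rev [0..<a]]))"

definition delta_act :: "int \<Rightarrow> nat \<Rightarrow> 'k::{comm_ring,monoid_mult} hmor" where
  "delta_act n a = monom_act n a (\<lambda>i. a - 1 - i)"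

definition e_act :: "int \<Rightarrow> nat \<Rightarrow> 'k::{comm_ring,monoid_mult} hmor" where
  "e_act n a = delta_act n a \<bullet> D_act n a"

text \<open>The divided power \<open>\<E>\<^sup>(\<^sup>a\<^sup>) 1\<^sub>n\<close> and its underlying 1-morphism of \<open>\<U>\<close>.\<close>

definition Ediv1 :: "nat \<Rightarrow> int \<Rightarrow> one_mor" where
  "Ediv1 a n = OneMor n (n + 2 * int a) [(Ew a, - int (a * (a - 1) div 2))]"

definition Ediv :: "nat \<Rightarrow> int \<Rightarrow> 'k::{comm_ring,monoid_mult} kob" where
  "Ediv a n = (Ediv1 a n, TwoMor (Ediv1 a n) (Ediv1 a n) [[e_act n a]])"

text \<open>Shifts do not change the underlying 2-morphism of \<open>\<H>\<close>; source and target shifts are recorded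
  in \<open>sigma_map\<close> and \<open>lambda_map\<close>.\<close>

definition splitter :: "int \<Rightarrow> nat \<Rightarrow> nat \<Rightarrow> 'k::{comm_ring,monoid_mult} hmor" where
  "splitter n a b = (delta_act (n + 2 * int b) a \<diamondop> delta_act n b) \<bullet> D_act n (a + b)"

definition merger :: "int \<Rightarrow> nat \<Rightarrow> nat \<Rightarrow> 'k::{comm_ring,monoid_mult} hmor" where
  "merger n a b = e_act n (a + b)"

definition sigma_map :: "int \<Rightarrow> nat \<Rightarrow> nat \<Rightarrow> nat list \<Rightarrow> 'k::{comm_ring,monoid_mult} two_mor" where
  "sigma_map n a b \<alpha> = TwoMor
     (shift1 (2 * int (sum_list \<alpha>) - int (a * b)) (Ediv1 (a + b) n))
     (Ediv1 a (n + 2 * int b) \<diamondop>\<^sub>1 Ediv1 b n)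
     [[((poly_act (n + 2 * int b) a (schur \<alpha>) \<bullet> e_act (n + 2 * int b) a) \<diamondop> e_act n b) \<bullet> splitter n a b]]"

definition lambda_map :: "int \<Rightarrow> nat \<Rightarrow> nat \<Rightarrow> nat list \<Rightarrow> 'k::{comm_ring,monoid_mult} two_mor" where
  "lambda_map n a b \<alpha> = TwoMor
     (Ediv1 a (n + 2 * int b) \<diamondop>\<^sub>1 Ediv1 b n)
     (shift1 (2 * int (sum_list \<alpha>) - int (a * b)) (Ediv1 (a + b) n))
     [[hscale ((- 1) ^ sum_list (hat_part b \<alpha>))
         (merger n a b \<bullet> (e_act (n + 2 * int b) a \<diamondop> (poly_act n b (schur (hat_part b \<alpha>)) \<bullet> e_act n b)))]]"

end

theory Submission
  imports Defs
begin

text \<open>Let \<open>D\<close> be the divided difference of the longest element on \<open>N = a + b\<close> strands. In the nilHecke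
  relations every element \<open>z\<close> satisfies \<open>z p D = z(p) D\<close> for all polynomials \<open>p\<close>, where \<open>z(p)\<close> is the polynomial
  action, and the two-sided ideal generated by \<open>D\<close> contains the identity. Hence an endomorphism of
  \<open>\<E>\<^sup>N 1\<^sub>n\<close> built from dots and crossings is determined by its polynomial action, and it suffices to
  compare operators on polynomials. There \<open>D f = Alt f / \<Delta>\<close> with \<open>\<Delta>\<close> the Vandermonde determinant. The composite
  \<open>\<lambda>\<^sub>\<beta> \<sigma>\<^sub>\<alpha>\<close> becomes the alternant with exponents \<open>\<alpha> + \<delta>\<close> and \<open>hat_part b \<beta> + \<delta>\<close>, which has a repeated exponent if
  \<open>\<alpha> \<noteq> \<beta>\<close>, and the sum of the \<open>\<sigma>\<^sub>\<alpha> \<lambda>\<^sub>\<alpha>\<close> is computed by the dual Cauchy identity.\<close>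

section \<open>Polynomials\<close>

text \<open>The scalars form an arbitrary commutative ring, possibly zero or of characteristic 2,
  whereas alternants call for division by 2 and by Vandermonde determinants. All division therefore
  happens over the integers, where polynomials form an integral domain, and the Hom spaces of \<H>
  only receive the resulting identities. The transfer runs through the ideal: if the identity is a
  sum of terms p D q, then z is the sum of the terms z(p) D q, so an operator on integer polynomials
  determines z even where several operators belong to the same z.

  The hat and the sign of \<lambda> have a common source. The exponents of \<alpha> + \<delta> in a
  variables and those of the hatted partition plus \<delta> in b variables together exhaust 0, ...,
  a + b - 1. The permutation recording their order has as many inversions as the hatted partition
  has cells, which gives the diagonal values of \<lambda>\<sigma>. The inverses of these
  permutations, one for each \<alpha>, represent the cosets of S_a x S_b in S_(a+b), so that the
  same signs occur in the Laplace expansion behind \<sigma>\<lambda>.\<close>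

abbreviation (input) "lookup \<equiv> Poly_Mapping.lookup"
abbreviation (input) "keys \<equiv> Poly_Mapping.keys"

abbreviation mono :: "(nat \<Rightarrow>\<^sub>0 nat) \<Rightarrow> mpoly" where
  "mono m \<equiv> Poly_Mapping.single m 1"

abbreviation X :: "nat \<Rightarrow> mpoly" where "X \<equiv> Xvar"

lemma mono_prod: "mono m = (\<Prod>i\<in>keys m. X i ^ lookup m i)"
proof -
  have pw: "X i ^ k = Poly_Mapping.single (Poly_Mapping.single i k) 1" for i k
    by (induction k) (simp_all add: Xvar_def mult_single single_add [symmetric])
  have pr: "(\<Prod>i\<in>A. Poly_Mapping.single (h i) 1) = (Poly_Mapping.single (\<Sum>i\<in>A. h i) 1 :: mpoly)"
    for A :: "nat set" and h
    by (induction A rule: infinite_finite_induct) (simp_all add: mult_single)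
  have "m = (\<Sum>i\<in>keys m. Poly_Mapping.single i (lookup m i))"
    by (rule poly_mapping_eqI)
      (simp add: lookup_sum lookup_single when_def in_keys_iff)
  then show ?thesis
    by (simp add: pw pr)
qed

text \<open>An \<open>mpoly\<close> is an element of the free abelian group on exponent vectors, so
  the induction rule for free abelian groups applies; closure under differences takes care of all
  integer coefficients.\<close>

lemma mpoly_mono_induct [case_names zero mono diff]:
  assumes "P 0" "\<And>m. P (mono m)" "\<And>p q. P p \<Longrightarrow> P q \<Longrightarrow> P (p - q)"
  shows "P (p :: mpoly)"
  by (rule frag_induction [where S = UNIV]) (use assms in auto)

lemma mpoly_induct [case_names zero one var diff mult]:
  assumes "P 0" "P 1" "\<And>i. P (X i)" "\<And>p q. P p \<Longrightarrow> P q \<Longrightarrow> P (p - q)" "\<And>p q. P p \<Longrightarrow> P q \<Longrightarrow> P (p * q)"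
  shows "P (p :: mpoly)"
proof (induction p rule: mpoly_mono_induct)
  case (mono m)
  have pw: "P (X i ^ k)" for i k
    by (induction k) (use assms in auto)
  have "P (\<Prod>i\<in>A. X i ^ lookup m i)" for A
    by (induction A rule: infinite_finite_induct) (use assms pw in auto)
  then show ?case by (simp add: mono_prod)
qed (use assms in auto)

text \<open>For additive \<open>F\<close> both sides are biadditive in \<open>p\<close> and
  \<open>q\<close>, so monomials suffice. The target is a ring without unit because the rule serves
  both for \<open>subst\<close> and for the action on powers of \<E>, whose values lie in the ring
  of families of endomorphisms.\<close>

lemma additive_multI:
  fixes F :: "mpoly \<Rightarrow> 'r::ring"
  assumes add: "\<And>p q. F (p + q) = F p + F q"
    and mono: "\<And>m m'. F (mono (m + m')) = F (mono m) * F (mono m')"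
  shows "F (p * q) = F p * F q"
proof -
  have 0: "F 0 = 0" using add [of 0 0] by simp
  have diff: "F (p - q) = F p - F q" for p q
    using add [of "p - q" q] by simp
  show ?thesis
  proof (induction p rule: mpoly_mono_induct)
    case (mono m)
    show ?case
      by (induction q rule: mpoly_mono_induct) (simp_all add: 0 diff assms(2) mult_single right_diff_distrib)
  qed (simp_all add: 0 diff left_diff_distrib)
qed

section \<open>Substitution and the action of permutations of the variables\<close>

definition subst :: "(nat \<Rightarrow> 'c::comm_ring_1) \<Rightarrow> mpoly \<Rightarrow> 'c" where
  "subst g p = (\<Sum>m\<in>keys p. of_int (lookup p m) *
     (\<Prod>i\<in>keys m. g i ^ lookup m i))"

lemma subst_add [simp]: "subst g (p + q) = subst g p + subst g q"
  unfolding subst_def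
  by (rule setsum_keys_plus_distrib) (simp_all add: algebra_simps)

lemma subst_0 [simp]: "subst g 0 = 0"
  by (simp add: subst_def)

lemma subst_diff [simp]: "subst g (p - q) = subst g p - subst g q"
  using subst_add [of g "p - q" q] by simp

lemma subst_minus [simp]: "subst g (- p) = - subst g p"
  using subst_diff [of g 0 p] by simp

lemma subst_mono: "finite A \<Longrightarrow> keys m \<subseteq> A \<Longrightarrow>
    subst g (mono m) = (\<Prod>i\<in>A. g i ^ lookup m i)"
  by (simp add: subst_def) (rule prod.mono_neutral_left, auto simp: in_keys_iff)

lemma subst_mult [simp]: "subst g (p * q) = subst g p * subst g q"
proof (rule additive_multI)
  fix m m' :: "nat \<Rightarrow>\<^sub>0 nat"
  let ?A = "keys m \<union> keys m' \<union> keys (m + m')"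
  show "subst g (mono (m + m'))
      = subst g (mono m) * subst g (mono m')"
    by (simp add: subst_mono [of ?A] lookup_add power_add prod.distrib le_supI1)
qed simp

lemma subst_1 [simp]: "subst g 1 = 1"
  using subst_mono [of "{}" 0 g] by simp

lemma subst_X [simp]: "subst g (X i) = g i"
  using subst_mono [of "{i}" "Poly_Mapping.single i 1" g] by (simp add: Xvar_def)

lemma subst_power [simp]: "subst g (p ^ k) = subst g p ^ k"
  by (induction k) simp_all

lemma subst_sum [simp]: "subst g (\<Sum>x\<in>A. f x) = (\<Sum>x\<in>A. subst g (f x))"
  by (induction A rule: infinite_finite_induct) simp_all

lemma subst_prod [simp]: "subst g (\<Prod>x\<in>A. f x) = (\<Prod>x\<in>A. subst g (f x))"
  by (induction A rule: infinite_finite_induct) simp_all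

lemma subst_of_int [simp]: "subst g (of_int c) = of_int c"
proof -
  have "subst g (of_nat k) = of_nat k" for k
    by (induction k) simp_all
  then show ?thesis by (cases c) (simp_all del: of_nat_Suc)
qed

lemma subst_subst: "subst g (subst h p) = subst (\<lambda>i. subst g (h i)) p"
  by (induction p rule: mpoly_induct) simp_all

lemma subst_id [simp]: "subst X p = p"
  by (induction p rule: mpoly_induct) simp_all

definition act :: "(nat \<Rightarrow> nat) \<Rightarrow> mpoly \<Rightarrow> mpoly" where
  "act w = subst (\<lambda>i. X (w i))"

lemma act_simps [simp]:
  "act w (p + q) = act w p + act w q" "act w (p - q) = act w p - act w q" "act w (- p) = - act w p"
  "act w (p * q) = act w p * act w q" "act w 0 = 0" "act w 1 = 1" "act w (X i) = X (w i)"
  "act w (p ^ k) = act w p ^ k" "act w (of_int c) = of_int c"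
  "act w (\<Sum>x\<in>A. f x) = (\<Sum>x\<in>A. act w (f x))" "act w (\<Prod>x\<in>A. f x) = (\<Prod>x\<in>A. act w (f x))"
  by (simp_all add: act_def)

lemma act_comp: "act w (act v p) = act (w \<circ> v) p"
  by (simp add: act_def subst_subst)

lemma act_id [simp]: "act id p = p"
  by (simp add: act_def)

abbreviation st :: "nat \<Rightarrow> nat \<Rightarrow> nat" where "st i \<equiv> Transposition.transpose i (Suc i)"

lemma act_st_st [simp]: "act (st i) (act (st i) p) = p"
  by (simp add: act_comp)

lemma X_neq: "i \<noteq> j \<Longrightarrow> X i - X j \<noteq> 0"
proof
  assume "i \<noteq> j" "X i - X j = 0"
  then have "subst (\<lambda>k. if k = i then 1 else 0 :: int) (X i - X j) = 0" by (simp only: subst_0)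
  with \<open>i \<noteq> j\<close> show False by simp
qed

section \<open>Divided differences\<close>

definition dd :: "nat \<Rightarrow> mpoly \<Rightarrow> mpoly" where
  "dd i f = (THE g. g * (X i - X (Suc i)) = f - act (st i) f)"

text \<open>Divisibility passes to products by the twisted Leibniz rule, which supplies the quotient
  \<open>g * q + act (st i) p * h\<close>; so it suffices to look at the variables.\<close>

lemma dd_ex: "\<exists>g. g * (X i - X (Suc i)) = f - act (st i) f"
proof (induction f rule: mpoly_induct)
  case (var j)
  have "f - act (st i) f = (if j = i then 1 else if j = Suc i then - 1 else 0) * (X i - X (Suc i))"
    if "f = X j" for f
    using that by (auto simp: Transposition.transpose_def)
  then show ?case by metis
next
  case (diff p q)
  then obtain g h where "g * (X i - X (Suc i)) = p - act (st i) p" "h * (X i - X (Suc i)) = q - act (st i) q"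
    by blast
  then have "(g - h) * (X i - X (Suc i)) = (p - q) - act (st i) (p - q)"
    by (simp only: left_diff_distrib act_simps) simp
  then show ?case by blast
next
  case (mult p q)
  then obtain g h where g: "g * (X i - X (Suc i)) = p - act (st i) p" and h: "h * (X i - X (Suc i)) = q - act (st i) q"
    by blast
  have "(g * q + act (st i) p * h) * (X i - X (Suc i)) = (g * (X i - X (Suc i))) * q + act (st i) p * (h * (X i - X (Suc i)))"
    by (simp add: algebra_simps)
  also have "\<dots> = p * q - act (st i) (p * q)" unfolding g h by (simp add: algebra_simps)
  finally show ?case by blast
qed (auto intro: exI [of _ 0])

lemma dd_unique: "g * (X i - X (Suc i)) = f - act (st i) f \<Longrightarrow> dd i f = g"
  unfolding dd_def using X_neq [of i "Suc i"]
  by (intro the_equality) (assumption, metis mult_right_cancel n_not_Suc_n)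

lemma dd_eq: "dd i f * (X i - X (Suc i)) = f - act (st i) f"
  using dd_ex [of i f] dd_unique by metis

lemma dd_add: "dd i (f + g) = dd i f + dd i g"
  by (rule dd_unique) (simp only: distrib_right dd_eq act_simps, simp)

lemma dd_diff: "dd i (f - g) = dd i f - dd i g"
  by (rule dd_unique) (simp only: left_diff_distrib dd_eq act_simps, simp)

lemma dd_mult: "dd i (f * g) = dd i f * g + act (st i) f * dd i g"
proof (rule dd_unique)
  have "(dd i f * g + act (st i) f * dd i g) * (X i - X (Suc i))
      = (dd i f * (X i - X (Suc i))) * g + act (st i) f * (dd i g * (X i - X (Suc i)))"
    by (simp add: algebra_simps)
  then show "(dd i f * g + act (st i) f * dd i g) * (X i - X (Suc i)) = f * g - act (st i) (f * g)"
    unfolding dd_eq by (simp add: algebra_simps)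
qed

lemma dd_sym [simp]: "act (st i) f = f \<Longrightarrow> dd i f = 0"
  by (rule dd_unique) simp

lemma dd_0 [simp]: "dd i 0 = 0" and dd_1 [simp]: "dd i 1 = 0" and dd_of_int [simp]: "dd i (of_int c) = 0"
  by simp_all

lemma dd_X [simp]: "dd i (X i) = 1" "dd i (X (Suc i)) = - 1" "j \<noteq> i \<Longrightarrow> j \<noteq> Suc i \<Longrightarrow> dd i (X j) = 0"
  by (auto intro!: dd_unique)

lemma dd_sym_mult: "act (st i) f = f \<Longrightarrow> dd i (f * g) = f * dd i g"
  by (simp add: dd_mult)

text \<open>Numerator and denominator of the quotient both change sign under
  \<open>st i\<close>.\<close>

lemma act_dd [simp]: "act (st i) (dd i f) = dd i f"
proof -
  have "act (st i) (dd i f) * (X (Suc i) - X i) = act (st i) f - f"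
    using arg_cong [OF dd_eq [of i f], of "act (st i)"] by (simp add: algebra_simps)
  then have "act (st i) (dd i f) * (X i - X (Suc i)) = f - act (st i) f"
    by (simp add: algebra_simps)
  then show ?thesis by (rule dd_unique [symmetric])
qed

lemma act_dd_conj:
  assumes "w \<circ> st i = st j \<circ> w" "w i = j" "w (Suc i) = Suc j"
  shows "act w (dd i f) = dd j (act w f)"
proof (rule dd_unique [symmetric])
  have "act w (dd i f * (X i - X (Suc i))) = act w f - act w (act (st i) f)"
    unfolding dd_eq by simp
  then show "act w (dd i f) * (X j - X (Suc j)) = act w f - act (st j) (act w f)"
    using assms by (simp add: act_comp)
qed

text \<open>The operator \<open>dd j\<close> commutes with \<open>act (st i)\<close> and with
  multiplication by \<open>X i - X (Suc i)\<close>, so \<open>dd j (dd i f)\<close> solves the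
  equation that characterizes \<open>dd i (dd j f)\<close>.\<close>

lemma dd_commute:
  assumes "Suc i < j"
  shows "dd i (dd j f) = dd j (dd i f)"
proof (rule dd_unique)
  have e: "st j \<circ> st i = st i \<circ> st j" using assms
    by (auto simp: fun_eq_iff Transposition.transpose_def)
  have c: "act (st i) (dd j f) = dd j (act (st i) f)"
    by (rule act_dd_conj) (use assms e in auto)
  have "dd j (dd i f * (X i - X (Suc i))) = dd j (dd i f) * (X i - X (Suc i))"
    using assms by (subst mult.commute, subst dd_sym_mult) (auto simp: mult.commute)
  then show "dd j (dd i f) * (X i - X (Suc i)) = dd j f - act (st i) (dd j f)"
    unfolding c by (simp add: dd_eq dd_diff)
qed

text \<open>Multiplied by the Vandermonde product \<open>W\<close> of the three variables, both
  sides become the antisymmetrization \<open>T\<close> of \<open>f\<close> over S_3. The equality of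
  the two sides is thus the braid relation for permutations, after cancelling
  \<open>W\<close>.\<close>

lemma dd_braid: "dd i (dd (Suc i) (dd i f)) = dd (Suc i) (dd i (dd (Suc i) f))"
proof -
  define s t where "s = act (st i)" and "t = act (st (Suc i))"
  define x y z where "x = X i" and "y = X (Suc i)" and "z = X (Suc (Suc i))"
  have sx: "s x = y" "s y = x" "s z = z" "t x = x" "t y = z" "t z = y"
    by (simp_all add: s_def t_def x_def y_def z_def)
  have hom: "s (p - q) = s p - s q" "s (p * q) = s p * s q" "s (s p) = p"
     "t (p - q) = t p - t q" "t (p * q) = t p * t q" "t (t p) = p" for p q
    by (simp_all add: s_def t_def)
  have br: "s (t (s p)) = t (s (t p))" for p
    unfolding s_def t_def act_comp
    by (rule arg_cong [of _ _ "\<lambda>w. act w p"]) (auto simp: fun_eq_iff Transposition.transpose_def)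
  define u v where "u = dd i" and "v = dd (Suc i)"
  have u: "u p * (x - y) = p - s p" and v: "v p * (y - z) = p - t p" for p
    by (simp_all add: u_def v_def s_def t_def x_def y_def z_def dd_eq)
  have tu: "t (u p) * (x - z) = t p - t (s p)" and sv: "s (v p) * (x - z) = s p - s (t p)" for p
    using arg_cong [OF u [of p], of t] arg_cong [OF v [of p], of s] by (simp_all only: hom sx)
  define T where "T = f - s f - t f + s (t f) + t (s f) - s (t (s f))"
  have vu: "v (u f) * ((x - y) * (y - z) * (x - z)) = (x - z) * (f - s f) - (x - y) * (t f - t (s f))"
  proof -
    have "v (u f) * ((x - y) * (y - z) * (x - z)) = (v (u f) * (y - z)) * ((x - y) * (x - z))"
      by (simp add: algebra_simps)
    also have "\<dots> = (x - z) * (u f * (x - y)) - (x - y) * (t (u f) * (x - z))"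
      unfolding v by (simp add: algebra_simps)
    finally show ?thesis unfolding u tu .
  qed
  have uv: "u (v f) * ((x - y) * (y - z) * (x - z)) = (x - z) * (f - t f) - (y - z) * (s f - s (t f))"
  proof -
    have "u (v f) * ((x - y) * (y - z) * (x - z)) = (u (v f) * (x - y)) * ((y - z) * (x - z))"
      by (simp add: algebra_simps)
    also have "\<dots> = (x - z) * (v f * (y - z)) - (y - z) * (s (v f) * (x - z))"
      unfolding u by (simp add: algebra_simps)
    finally show ?thesis unfolding v sv .
  qed
  define W :: mpoly where "W = (x - y) * (y - z) * (x - z)"
  have sW: "s W = - W" "t W = - W" unfolding W_def hom sx by (simp_all add: algebra_simps)
  \<comment> \<open>With \<open>h = v (u f)\<close>, the antisymmetry of \<open>W\<close> turns
    \<open>(h - s h) * W\<close> into \<open>h * W + s (h * W)\<close>, to which \<open>vu\<close>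
    applies.\<close>
  have "u (v (u f)) * (x - y) * W = v (u f) * W + s (v (u f) * W)"
    unfolding u by (simp add: hom sW algebra_simps)
  also have "\<dots> = (x - y) * T"
    unfolding W_def vu hom sx T_def by (simp add: algebra_simps)
  finally have "(x - y) * (u (v (u f)) * W) = (x - y) * T" by (simp add: algebra_simps)
  then have A: "u (v (u f)) * W = T" using X_neq [of i "Suc i"] by (simp add: x_def y_def)
  have "v (u (v f)) * (y - z) * W = u (v f) * W + t (u (v f) * W)"
    unfolding v by (simp add: hom sW algebra_simps)
  also have "\<dots> = (y - z) * T"
    unfolding W_def uv hom sx T_def br by (simp add: algebra_simps)
  finally have "(y - z) * (v (u (v f)) * W) = (y - z) * T" by (simp add: algebra_simps)
  then have B: "v (u (v f)) * W = T" using X_neq [of "Suc i" "Suc (Suc i)"] by (simp add: y_def z_def)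
  have "W \<noteq> 0"
    using X_neq [of i "Suc i"] X_neq [of "Suc i" "Suc (Suc i)"] X_neq [of i "Suc (Suc i)"]
    by (simp add: W_def x_def y_def z_def)
  with A B show ?thesis unfolding u_def v_def by (metis mult_right_cancel)
qed

lemma st_add: "st (k + i) (k + j) = k + st i j"
  by (simp add: Transposition.transpose_def)

section \<open>Products along the reduced word of the longest element\<close>

definition w0 :: "nat \<Rightarrow> nat list" where
  "w0 N = concat (map (\<lambda>k. [0..<k]) (rev [0..<N]))"

lemma w0_0 [simp]: "w0 0 = []" and w0_Suc: "w0 (Suc N) = [0..<N] @ w0 N"
  by (simp_all add: w0_def)

lemma w0_bound: "i \<in> set (w0 N) \<Longrightarrow> Suc i < N"
  by (auto simp: w0_def)

text \<open>Stated for families of operators, so that it applies both to divided differences and to left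
  multiplications in an algebra.\<close>

lemma w0_kill:
  fixes d :: "nat \<Rightarrow> 'm \<Rightarrow> 'm::zero"
  assumes zero: "\<And>i. Suc i < N \<Longrightarrow> d i 0 = 0"
    and nil: "\<And>i z. Suc i < N \<Longrightarrow> d i (d i z) = 0"
    and com: "\<And>i j z. Suc i < j \<Longrightarrow> Suc j < N \<Longrightarrow> d i (d j z) = d j (d i z)"
    and braid: "\<And>i z. Suc (Suc i) < N \<Longrightarrow> d i (d (Suc i) (d i z)) = d (Suc i) (d i (d (Suc i) z))"
  shows "Suc i < N \<Longrightarrow> d i (foldr d (w0 N) z) = 0"
proof -
  have far: "(\<And>j. j \<in> set js \<Longrightarrow> Suc j < N \<and> (Suc i < j \<or> Suc j < i)) \<Longrightarrow> Suc i < N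
      \<Longrightarrow> d i (foldr d js z) = foldr d js (d i z)" for i js z
  proof (induction js)
    case (Cons j js)
    then have "d i (d j (foldr d js z)) = d j (d i (foldr d js z))"
      using com [of i j] com [of j i] by (metis list.set_intros(1))
    with Cons show ?case by simp
  qed simp
  \<comment> \<open>The Coxeter identity s_(k+1) (s_0 ... s_(M-1)) = (s_0 ... s_(M-1)) s_k. An
    operator entering the top row thus leaves it with its index lowered by one, and induction
    applies to the remaining rows; the operator with index 0 is killed at once by the start of the
    row.\<close>
  have slide: "d (Suc k) (foldr d [0..<M] z) = foldr d [0..<M] (d k z)" if "Suc k < M" "M < N" for k M z
  proof -
    have "[0..<M] = [0..<k] @ [k..<M]" using that upt_add_eq_append [of 0 k "M - k"] by simp
    also have "[k..<M] = k # Suc k # [Suc (Suc k)..<M]" using that by (simp add: upt_conv_Cons)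
    finally have M: "[0..<M] = [0..<k] @ k # Suc k # [Suc (Suc k)..<M]" .
    have a: "d (Suc k) (foldr d [0..<k] z) = foldr d [0..<k] (d (Suc k) z)" for z
      by (rule far) (use that in auto)
    have b: "d k (foldr d [Suc (Suc k)..<M] z) = foldr d [Suc (Suc k)..<M] (d k z)" for z
      by (rule far) (use that in auto)
    show ?thesis
      unfolding M using that by (simp add: a b braid [of k, symmetric])
  qed
  have "d i (foldr d (w0 M) z) = 0" if "Suc i < M" "M \<le> N" for i M
    using that
  proof (induction M arbitrary: i)
    case (Suc M)
    show ?case
    proof (cases i)
      case 0
      then have "[0..<M] = 0 # [Suc 0..<M]" using Suc.prems by (simp add: upt_conv_Cons)
      with Suc.prems 0 nil [of 0] show ?thesis by (simp add: w0_Suc)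
    next
      case (Suc k)
      have z: "foldr d js 0 = 0" if "\<And>j. j \<in> set js \<Longrightarrow> Suc j < N" for js
        using that by (induction js) (auto simp: zero)
      show ?thesis
        using Suc slide [of k M] Suc.IH [of k] Suc.prems by (simp add: w0_Suc) (rule z, simp)
    qed
  qed simp
  then show "Suc i < N \<Longrightarrow> d i (foldr d (w0 N) z) = 0" by blast
qed

text \<open>The longest divided difference in the \<open>N\<close> variables starting at the offset
  \<open>o'\<close>. The offset allows for the blocks of the two divided powers, \<open>0, a\<close>
  and \<open>a, b\<close>, next to the full range \<open>0, a + b\<close>.\<close>

definition Dp :: "nat \<Rightarrow> nat \<Rightarrow> mpoly \<Rightarrow> mpoly" where
  "Dp o' N f = foldr (\<lambda>i. dd (o' + i)) (w0 N) f"

lemma Dp_0 [simp]: "Dp k 0 f = f"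
  by (simp add: Dp_def)

lemma Dp_Suc: "Dp k (Suc N) f = foldr (\<lambda>i. dd (k + i)) [0..<N] (Dp k N f)"
  by (simp add: Dp_def w0_Suc)

lemma dd_Dp: "Suc i < N \<Longrightarrow> dd (k + i) (Dp k N f) = 0"
  unfolding Dp_def by (rule w0_kill [where N = N]) (auto simp: dd_braid intro: dd_commute)

text \<open>By its defining equation, vanishing of \<open>dd i\<close> means invariance under
  \<open>st i\<close>. Conjugating adjacent transpositions by each other gives all transpositions of
  the interval, and these generate.\<close>

lemma act_Dp:
  assumes "w permutes {k..<k + N}"
  shows "act w (Dp k N f) = Dp k N f"
proof -
  let ?p = "Dp k N f"
  have adj: "act (st i) ?p = ?p" if "k \<le> i" "Suc i < k + N" for i
    using dd_Dp [of "i - k" N k f] that dd_eq [of i ?p] by (simp add: algebra_simps)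
  have tr: "act (Transposition.transpose i (i + j)) ?p = ?p" if "k \<le> i" "i + j < k + N" for i j
    using that
  proof (induction j)
    case (Suc j)
    show ?case
    proof (cases "j = 0")
      case True
      then show ?thesis using adj [of i] Suc.prems by simp
    next
      case False
      then have "Transposition.transpose i (i + Suc j)
          = st (i + j) \<circ> Transposition.transpose i (i + j) \<circ> st (i + j)"
        by (auto simp: fun_eq_iff Transposition.transpose_def)
      moreover have "act (st (i + j)) ?p = ?p" "act (Transposition.transpose i (i + j)) ?p = ?p"
        using Suc adj [of "i + j"] by simp_all
      ultimately show ?thesis
        by (simp only: act_comp [symmetric])
    qed
  qed simp
  have tr': "act (Transposition.transpose i j) ?p = ?p" if "i \<in> {k..<k + N}" "j \<in> {k..<k + N}" for i j
  proof (cases "i \<le> j")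
    case True then show ?thesis using tr [of i "j - i"] that by simp
  next
    case False then show ?thesis using tr [of j "i - j"] that by (simp add: transpose_commute)
  qed
  from assms finite_atLeastLessThan show ?thesis
  proof (induction w rule: permutes_induct)
    case (swap a b p)
    then show ?case using tr' [of a b] by (simp only: act_comp [symmetric])
  qed (rule act_id)
qed

lemma foldr_dd_sym_mult:
  assumes "\<And>j. j \<in> set js \<Longrightarrow> act (st (k + j)) f = f"
  shows "foldr (\<lambda>i. dd (k + i)) js (f * g) = f * foldr (\<lambda>i. dd (k + i)) js g"
  using assms by (induction js) (auto simp: dd_sym_mult)

lemma Dp_sym_mult:
  assumes "\<And>i. Suc i < N \<Longrightarrow> act (st (k + i)) f = f"
  shows "Dp k N (f * g) = f * Dp k N g"
  unfolding Dp_def by (rule foldr_dd_sym_mult) (auto dest!: w0_bound assms)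

text \<open>The polynomial is a double Schubert polynomial of the longest element.\<close>

lemma Dp_prod:
  assumes "\<And>i j. Suc i < N \<Longrightarrow> j < N \<Longrightarrow> act (st (k + i)) (Y j) = Y j"
  shows "Dp k N (\<Prod>j<N. \<Prod>i<j. X (k + i) - Y j) = 1"
  using assms
proof (induction N)
  case (Suc N)
  let ?Q = "\<lambda>M. \<Prod>i<M. X (k + i) - Y N"
  have sym: "act (st (k + i)) (?Q N) = ?Q N" if "Suc i < N" for i
  proof -
    have "act (st (k + i)) (?Q N) = (\<Prod>j<N. X (k + st i j) - Y N)"
      using Suc.prems [of i N] that by (simp add: st_add)
    also have "\<dots> = ?Q N"
      by (rule prod.reindex_bij_betw [where h = "st i" and g = "\<lambda>j. X (k + j) - Y N"])
        (use that in \<open>auto intro!: permutes_imp_bij permutes_swap_id\<close>)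
    finally show ?thesis .
  qed
  have "Dp k (Suc N) (\<Prod>j<Suc N. \<Prod>i<j. X (k + i) - Y j) =
      foldr (\<lambda>i. dd (k + i)) [0..<N] (Dp k N (?Q N * (\<Prod>j<N. \<Prod>i<j. X (k + i) - Y j)))"
    by (simp add: Dp_Suc mult.commute)
  also have "\<dots> = foldr (\<lambda>i. dd (k + i)) [0..<N] (?Q N)"
    using Suc by (subst Dp_sym_mult, intro sym) simp_all
  also have "\<dots> = 1"
  proof -
    \<comment> \<open>The innermost operator \<open>dd (k + M)\<close> meets a single factor that is
      not invariant, \<open>X (k + M) - Y N\<close>, and replaces it by 1; each operator of the row
      removes one linear factor in this way.\<close>
    have "foldr (\<lambda>i. dd (k + i)) [0..<M] (?Q M) = 1" if "M \<le> N" for M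
      using that
    proof (induction M)
      case (Suc M)
      have "act (st (k + M)) (?Q M) = ?Q M"
        using Suc.prems \<open>\<And>i j. Suc i < Suc N \<Longrightarrow> j < Suc N \<Longrightarrow> act (st (k + i)) (Y j) = Y j\<close> [of M N]
        by (auto intro!: prod.cong simp: Transposition.transpose_def)
      moreover have "act (st (k + M)) (Y N) = Y N"
        using Suc.prems \<open>\<And>i j. Suc i < Suc N \<Longrightarrow> j < Suc N \<Longrightarrow> act (st (k + i)) (Y j) = Y j\<close> [of M N] by simp
      ultimately have "dd (k + M) (?Q (Suc M)) = ?Q M"
        by (simp add: dd_sym_mult dd_diff)
      with Suc show ?case by simp
    qed simp
    then show ?thesis by blast
  qed
  finally show ?case .
qed simp

section \<open>Alternation\<close>

definition Alt :: "nat set \<Rightarrow> mpoly \<Rightarrow> mpoly" where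
  "Alt S f = (\<Sum>w | w permutes S. of_int (sign w) * act w f)"

lemma Alt_diff: "Alt S (f - g) = Alt S f - Alt S g"
  by (simp add: Alt_def algebra_simps sum_subtractf)

lemma Alt_sym_mult:
  "(\<And>w. w permutes S \<Longrightarrow> act w f = f) \<Longrightarrow> Alt S (f * g) = f * Alt S g"
  by (simp add: Alt_def sum_distrib_left mult_ac)

lemma sign_inverse' : "finite S \<Longrightarrow> w permutes S \<Longrightarrow> sign (inv w) = sign w"
  by (metis permutation_permutes sign_inverse)

lemma sign_compose' : "finite S \<Longrightarrow> w permutes S \<Longrightarrow> v permutes S \<Longrightarrow> sign (w \<circ> v) = sign w * sign v"
  by (metis permutation_permutes sign_compose)

lemma Alt_act:
  assumes "finite S" "v permutes S"
  shows "Alt S (act v f) = of_int (sign v) * Alt S f"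
proof -
  have "Alt S f = (\<Sum>w | w permutes S. of_int (sign (w \<circ> v)) * act (w \<circ> v) f)"
    unfolding Alt_def by (rule sum_permutations_compose_right [OF assms(2)])
  also have "\<dots> = (\<Sum>w | w permutes S. of_int (sign v) * (of_int (sign w) * act w (act v f)))"
    by (rule sum.cong) (use assms in \<open>auto simp: sign_compose' act_comp mult_ac\<close>)
  also have "\<dots> = of_int (sign v) * Alt S (act v f)"
    by (simp add: Alt_def sum_distrib_left)
  finally have "of_int (sign v) * Alt S f = of_int (sign v * sign v) * Alt S (act v f)"
    by (simp only: of_int_mult mult.assoc)
  then show ?thesis by simp
qed

lemma act_Alt:
  assumes "finite S" "v permutes S"
  shows "act v (Alt S f) = of_int (sign v) * Alt S f"
proof -
  have "act v (Alt S f) = (\<Sum>w | w permutes S. of_int (sign v) * (of_int (sign (v \<circ> w)) * act (v \<circ> w) f))"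
    by (simp add: Alt_def act_comp, rule sum.cong)
      (use assms in \<open>auto simp: sign_compose' simp flip: mult.assoc of_int_mult\<close>)
  also have "\<dots> = of_int (sign v) * (\<Sum>w | w permutes S. of_int (sign (v \<circ> w)) * act (v \<circ> w) f)"
    by (simp add: sum_distrib_left)
  also have "(\<Sum>w | w permutes S. of_int (sign (v \<circ> w)) * act (v \<circ> w) f) = Alt S f"
    unfolding Alt_def by (rule setum_permutations_compose_left [OF assms(2), symmetric])
  finally show ?thesis .
qed

lemma mpoly_double_cancel: "2 * p = 2 * q \<Longrightarrow> p = (q :: mpoly)"
  by simp

text \<open>Antisymmetrizing under \<open>st i\<close> turns \<open>X i * dd i g\<close> into
  \<open>(X i - X (Suc i)) * dd i g\<close>, which is \<open>g - act (st i) g\<close>. So under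
  \<open>Alt\<close> one factor \<open>X i\<close> undoes one divided difference. The computation
  yields twice the claim, and 2 can be cancelled over the integers.\<close>

lemma Alt_dd:
  assumes S: "finite S" "i \<in> S" "Suc i \<in> S" and h: "act (st i) h = h"
  shows "Alt S (h * X i * dd i g) = Alt S (h * g)"
proof (rule mpoly_double_cancel)
  have p: "st i permutes S" by (rule permutes_swap_id) (use S in auto)
  have sg: "sign (st i) = - 1" by (simp add: sign_swap_id)
  have "2 * Alt S (h * X i * dd i g) = Alt S (h * X i * dd i g) - Alt S (act (st i) (h * X i * dd i g))"
    by (simp only: Alt_act [OF S(1) p] sg) simp
  also have "\<dots> = Alt S (h * (dd i g * (X i - X (Suc i))))"
    unfolding Alt_diff [symmetric] by (simp add: h algebra_simps)
  also have "\<dots> = Alt S (h * g) - Alt S (act (st i) (h * g))"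
    unfolding Alt_diff [symmetric] dd_eq by (simp add: h algebra_simps)
  also have "\<dots> = 2 * Alt S (h * g)"
    by (simp only: Alt_act [OF S(1) p] sg) simp
  finally show "2 * Alt S (h * X i * dd i g) = 2 * Alt S (h * g)" .
qed

definition delta :: "nat \<Rightarrow> nat \<Rightarrow> mpoly" where
  "delta k N = (\<Prod>i<N. X (k + i) ^ (N - 1 - i))"

text \<open>Alternation absorbs the idempotent of every block contained in \<open>S\<close>. The
  staircase contains exactly one variable factor for each divided difference in the reduced word,
  and \<open>Alt_dd\<close> removes them pairwise, row by row.\<close>

lemma Alt_delta_Dp:
  assumes "finite S"
  shows "{k..<k + N} \<subseteq> S \<Longrightarrow> Alt S (delta k N * Dp k N f) = Alt S f"
proof (induction N)
  case (Suc N)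
  \<comment> \<open>The monomial \<open>M j\<close> interpolates between
    \<open>delta k (Suc N)\<close> at \<open>j = 0\<close> and \<open>delta k N\<close> at
    \<open>j = N\<close>; each step loses the factor \<open>X (k + j)\<close>.\<close>
  define e where "e j i = N - Suc i + (if j \<le> i \<and> i < N then 1 else 0)" for j i
  define M where "M j = (\<Prod>i<Suc N. X (k + i) ^ e j i)" for j
  have step: "Alt S (M j * foldr (\<lambda>i. dd (k + i)) [j..<N] g) = Alt S (M N * g)" if "j \<le> N" for j g
    using that
  proof (induction j rule: inc_induct)
    case (step j)
    have "M j = (\<Prod>i<Suc N. X (k + i) ^ e (Suc j) i * (if i = j then X (k + j) else 1))"
      unfolding M_def by (rule prod.cong) (use step in \<open>auto simp: e_def\<close>)
    then have Mj: "M j = M (Suc j) * X (k + j)"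
      using step by (simp add: prod.distrib M_def)
    \<comment> \<open>At positions \<open>j\<close> and \<open>Suc j\<close> the exponents agree,
      since the extra 1 at \<open>Suc j\<close> makes up for the drop of the staircase. If
      \<open>Suc j = N\<close>, both are 0, the second one by truncated subtraction.\<close>
    have "e (Suc j) (st j i) = e (Suc j) i" for i
      using step by (auto simp: e_def Transposition.transpose_def)
    then have "act (st (k + j)) (M (Suc j)) = (\<Prod>i<Suc N. X (k + st j i) ^ e (Suc j) (st j i))"
      unfolding M_def act_simps st_add by simp
    also have "\<dots> = M (Suc j)"
      unfolding M_def
      by (rule prod.reindex_bij_betw [where h = "st j" and g = "\<lambda>i. X (k + i) ^ e (Suc j) i"])
        (use step in \<open>auto intro!: permutes_imp_bij permutes_swap_id\<close>)
    finally have sym: "act (st (k + j)) (M (Suc j)) = M (Suc j)" .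
    have "[j..<N] = j # [Suc j..<N]" using step by (simp add: upt_conv_Cons)
    then have "Alt S (M j * foldr (\<lambda>i. dd (k + i)) [j..<N] g)
        = Alt S (M (Suc j) * X (k + j) * dd (k + j) (foldr (\<lambda>i. dd (k + i)) [Suc j..<N] g))"
      by (simp add: Mj)
    also have "\<dots> = Alt S (M (Suc j) * foldr (\<lambda>i. dd (k + i)) [Suc j..<N] g)"
      by (rule Alt_dd) (use assms Suc.prems step sym in auto)
    finally show ?case using step by simp
  qed simp
  have e0: "e 0 i = N - i" for i
    by (auto simp: e_def)
  have "delta k (Suc N) = M 0"
    unfolding delta_def M_def by (simp add: e0)
  moreover have "M N = delta k N"
    unfolding delta_def M_def by (simp add: e_def)
  moreover have "{k..<k + N} \<subseteq> S" using Suc.prems by auto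
  ultimately show ?case using Suc.IH step [of 0] by (simp add: Dp_Suc)
qed (simp add: delta_def)

text \<open>Introduced as the alternant of the staircase monomial, the form in which it meets
  \<open>Dp\<close>; the product formula follows in \<open>vdm_prod\<close>.\<close>

definition vdm :: "nat \<Rightarrow> nat \<Rightarrow> mpoly" where
  "vdm k N = Alt {k..<k + N} (delta k N)"

text \<open>The alternation of \<open>delta k N * Dp k N f\<close> is evaluated in two ways: the
  symmetric factor \<open>Dp k N f\<close> can be taken out, or \<open>Alt_delta_Dp\<close> absorbs
  the staircase together with the divided differences.\<close>

lemma vdm_Dp: "vdm k N * Dp k N f = Alt {k..<k + N} f"
proof -
  have "Alt {k..<k + N} (Dp k N f * delta k N) = Dp k N f * vdm k N"
    unfolding vdm_def by (rule Alt_sym_mult) (rule act_Dp)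
  then show ?thesis using Alt_delta_Dp [of "{k..<k + N}" k N f] by (simp add: mult.commute)
qed

lemma prod_lessThan_add: "(\<Prod>j<a + b. f j) = (\<Prod>j<a. f j) * (\<Prod>j<b. f (a + j :: nat) :: 'x::comm_monoid_mult)"
  by (induction b) (simp_all add: mult_ac)

text \<open>The Vandermonde determinant is the alternation of a double Schubert polynomial in \<open>x\<close> and \<open>y\<close>.
  Setting \<open>y = x\<close> kills all summands but that of the identity.\<close>

lemma vdm_prod: "vdm k N = (\<Prod>j<N. \<Prod>i<j. X (k + i) - X (k + j))"
proof -
  let ?S = "{k..<k + N}"
  let ?P = "\<Prod>j<N. \<Prod>i<j. X (k + i) - X (k + N + j)"
  \<comment> \<open>The variables \<open>X (k + N + j)\<close> beyond the block play the part of y,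
    and \<open>t\<close> identifies them with \<open>X (k + j)\<close>.\<close>
  define t where "t i = (if i < k + N then X i else X (i - N))" for i
  have "Dp k N ?P = 1"
    by (rule Dp_prod) (simp add: Transposition.transpose_def)
  then have "vdm k N = Alt ?S ?P" using vdm_Dp [of k N ?P] by simp
  then have "subst t (vdm k N) = subst t (Alt ?S ?P)" by simp
  also have "\<dots> = (\<Sum>w | w permutes ?S. of_int (sign w) * (\<Prod>j<N. \<Prod>i<j. X (w (k + i)) - X (k + j)))"
  proof -
    have "subst t (act w ?P) = (\<Prod>j<N. \<Prod>i<j. X (w (k + i)) - X (k + j))" if "w permutes ?S" for w
    proof -
      have "t (w (k + i)) = X (w (k + i))" if "i < N" for i
        using permutes_in_image [OF \<open>w permutes ?S\<close>, of "k + i"] that by (simp add: t_def)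
      moreover have "w (k + N + j) = k + N + j" for j
        by (rule permutes_not_in [OF that]) simp
      ultimately show ?thesis by (simp add: t_def)
    qed
    then show ?thesis by (simp add: Alt_def)
  qed
  also have "\<dots> = (\<Sum>w\<in>{id}. of_int (sign w) * (\<Prod>j<N. \<Prod>i<j. X (w (k + i)) - X (k + j)))"
  proof (rule sum.mono_neutral_right)
    show "\<forall>w\<in>{w. w permutes ?S} - {id}.
        of_int (sign w) * (\<Prod>j<N. \<Prod>i<j. X (w (k + i)) - X (k + j)) = 0"
    proof
      fix w assume w: "w \<in> {w. w permutes ?S} - {id}"
      \<comment> \<open>A permutation of an interval that raises no index is the identity. A raised
        index \<open>l\<close> makes the factor with \<open>i = l - k\<close> and
        \<open>j = w l - k\<close> vanish.\<close>
      then have "\<not> (\<forall>i\<in>?S. w i \<le> i)"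
        using permutes_natset_le [of w ?S] by blast
      then obtain l where l: "l \<in> ?S" "l < w l" by (meson not_less)
      have "w l \<in> ?S" using w l permutes_in_image [of w ?S l] by blast
      define i j where "i = l - k" and "j = w l - k"
      have ij: "l = k + i" "w l = k + j" "i < j" "j < N"
        using l \<open>w l \<in> ?S\<close> by (auto simp: i_def j_def)
      then have "X (w (k + i)) - X (k + j) = 0" by simp
      with ij have "(\<Prod>i<j. X (w (k + i)) - X (k + j)) = 0"
        by (intro prod_zero) (auto intro!: bexI [of _ i])
      with ij have "(\<Prod>j<N. \<Prod>i<j. X (w (k + i)) - X (k + j)) = 0"
        by (intro prod_zero) auto
      then show "of_int (sign w) * (\<Prod>j<N. \<Prod>i<j. X (w (k + i)) - X (k + j)) = 0" by simp
    qed
  qed (auto simp: finite_permutations permutes_id)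
  also have "subst t (vdm k N) = vdm k N"
  proof -
    have "subst t (act w (delta k N)) = act w (delta k N)" if "w permutes ?S" for w
    proof -
      have "t (w (k + i)) = X (w (k + i))" if "i < N" for i
        using permutes_in_image [OF \<open>w permutes ?S\<close>, of "k + i"] that by (simp add: t_def)
      then show ?thesis by (simp add: delta_def)
    qed
    then show ?thesis by (simp add: vdm_def Alt_def)
  qed
  finally show ?thesis by simp
qed

lemma X_eq_iff: "X i = X j \<longleftrightarrow> i = j"
  using X_neq [of i j] by auto

lemma vdm_neq_0 [simp]: "vdm k N \<noteq> 0"
  unfolding vdm_prod by (auto simp: X_eq_iff)

lemma vdm_cancel: "vdm k N * p = vdm k N * q \<Longrightarrow> p = q"
  by simp

lemma vdm_split: "vdm 0 (a + b) = vdm 0 a * vdm a b * (\<Prod>j<b. \<Prod>i<a. X i - X (a + j))"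
  unfolding vdm_prod by (simp add: prod_lessThan_add prod.distrib mult_ac)

lemma Dp_delta [simp]: "Dp k N (delta k N) = 1"
  by (rule vdm_cancel [of k N]) (simp add: vdm_Dp, simp add: vdm_def)

lemma Dp_eqI: "Alt {k..<k + N} f = vdm k N * g \<Longrightarrow> Dp k N f = g"
  by (rule vdm_cancel [of k N]) (simp add: vdm_Dp)

text \<open>The diagrammatic rule that the idempotent of a sub-block is absorbed by the longest
  crossing on all strands. In terms of \<open>Alt\<close> it is the absorption in
  \<open>Alt_delta_Dp\<close>.\<close>

lemma Dp_delta_Dp: "{k'..<k' + M} \<subseteq> {k..<k + N} \<Longrightarrow> Dp k N (delta k' M * Dp k' M f) = Dp k N f"
  by (rule Dp_eqI) (simp add: Alt_delta_Dp vdm_Dp)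

text \<open>Evaluate \<open>w \<Delta> = sign w \<Delta>\<close> at \<open>x\<^sub>i = - i\<close>.\<close>

lemma sign_inversions:
  fixes w :: "nat \<Rightarrow> nat"
  assumes "w permutes {..<N}"
  shows "sign w = (\<Prod>j<N. \<Prod>i<j. if w i < w j then 1 else - 1)"
proof -
  have w: "w permutes {0..<0 + N}" using assms by (simp add: atLeast0LessThan)
  let ?g = "\<lambda>i. - int i"
  have "subst ?g (act w (vdm 0 N)) = subst ?g (of_int (sign w) * vdm 0 N)"
    using act_Alt [OF _ w, of "delta 0 N"] by (simp add: vdm_def)
  then have "(\<Prod>j<N. \<Prod>i<j. int (w j) - int (w i)) = sign w * (\<Prod>j<N. \<Prod>i<j. int j - int i)"
    by (simp add: vdm_prod)
  then have "sgn (\<Prod>j<N. \<Prod>i<j. int (w j) - int (w i)) = sgn (sign w) * sgn (\<Prod>j<N. \<Prod>i<j. int j - int i)"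
    by (simp add: sgn_mult)
  moreover have "(\<Prod>j<N. \<Prod>i<j. int j - int i) > 0"
    by (intro prod_pos) auto
  moreover have sgn_prod: "sgn (\<Prod>x\<in>A. f x) = (\<Prod>x\<in>A. sgn (f x :: int))" for A :: "nat set" and f
    by (induction A rule: infinite_finite_induct) (simp_all add: sgn_mult)
  moreover have "sgn (sign w) = sign w" by (cases w rule: sign_cases) simp_all
  ultimately have "sign w = (\<Prod>j<N. \<Prod>i<j. sgn (int (w j) - int (w i)))"
    by (simp add: sgn_prod)
  also have "\<dots> = (\<Prod>j<N. \<Prod>i<j. if w i < w j then 1 else - 1)"
  proof (rule prod.cong [OF HOL.refl], rule prod.cong [OF HOL.refl])
    fix j i assume "j \<in> {..<N}" "i \<in> {..<j}"
    then have "w i \<noteq> w j" using inj_onD [OF permutes_inj_on [OF assms, of UNIV], of i j] by auto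
    then show "sgn (int (w j) - int (w i)) = (if w i < w j then 1 else - 1)" by auto
  qed
  finally show ?thesis .
qed

definition mon :: "nat \<Rightarrow> (nat \<Rightarrow> nat) \<Rightarrow> nat \<Rightarrow> mpoly" where
  "mon k e N = (\<Prod>i<N. X (k + i) ^ e i)"

lemma mon_add: "mon k e (a + b) = mon k e a * mon (k + a) (\<lambda>i. e (a + i)) b"
  by (simp add: mon_def prod_lessThan_add add.assoc)

lemma act_mon:
  assumes "w permutes {..<N}"
  shows "act w (mon 0 e N) = mon 0 (\<lambda>i. e (inv w i)) N"
proof -
  have "act w (mon 0 e N) = (\<Prod>i<N. X (w i) ^ e (inv w (w i)))"
    using permutes_inverses(2) [OF assms] by (simp add: mon_def)
  also have "\<dots> = (\<Prod>i<N. X i ^ e (inv w i))"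
    by (rule prod.reindex_bij_betw) (rule permutes_imp_bij [OF assms])
  finally show ?thesis by (simp add: mon_def)
qed

lemma Alt_mon_eq_0:
  assumes "i < N" "j < N" "i \<noteq> j" "e i = e j"
  shows "Alt {..<N} (mon 0 e N) = 0"
proof -
  let ?t = "Transposition.transpose i j"
  have p: "?t permutes {..<N}" by (rule permutes_swap_id) (use assms in auto)
  have "(\<lambda>l. e (inv ?t l)) = e" using assms by (auto simp: Transposition.transpose_def)
  then have "act ?t (mon 0 e N) = mon 0 e N" using act_mon [OF p, of e] by simp
  moreover have "Alt {..<N} (act ?t (mon 0 e N)) = of_int (- 1) * Alt {..<N} (mon 0 e N)"
    using Alt_act [OF _ p, of "mon 0 e N"] assms by (simp add: sign_swap_id)
  ultimately have "2 * Alt {..<N} (mon 0 e N) = 0" by simp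
  then show ?thesis by simp
qed

section \<open>Schur polynomials\<close>

lemma subst_dd:
  assumes "\<And>f. subst g (act (st i) f) = act (st j) (subst g f)" "g i = X j" "g (Suc i) = X (Suc j)"
  shows "subst g (dd i f) = dd j (subst g f)"
proof (rule dd_unique [symmetric])
  have "subst g (dd i f * (X i - X (Suc i))) = subst g f - act (st j) (subst g f)"
    unfolding dd_eq by (simp add: assms)
  then show "subst g (dd i f) * (X j - X (Suc j)) = subst g f - act (st j) (subst g f)"
    by (simp add: assms)
qed

lemma subst_Dp:
  assumes "\<And>i f. Suc i < N \<Longrightarrow> subst g (dd (k + i) f) = dd (k' + i) (subst g f)"
  shows "subst g (Dp k N f) = Dp k' N (subst g f)"
proof -
  have "subst g (foldr (\<lambda>i. dd (k + i)) js f) = foldr (\<lambda>i. dd (k' + i)) js (subst g f)"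
    if "\<And>i. i \<in> set js \<Longrightarrow> Suc i < N" for js
    using that by (induction js) (auto simp: assms)
  then show ?thesis unfolding Dp_def by (auto dest: w0_bound)
qed

abbreviation shift :: "nat \<Rightarrow> mpoly \<Rightarrow> mpoly" where
  "shift k \<equiv> subst (\<lambda>i. X (k + i))"

text \<open>The function \<open>poly_act n a\<close> evaluates the variables \<open>X i\<close> with \<open>i \<ge> a\<close> at the identity.\<close>

abbreviation trunc :: "nat \<Rightarrow> mpoly \<Rightarrow> mpoly" where
  "trunc a \<equiv> subst (\<lambda>i. if i < a then X i else 1)"

lemma shift_Dp: "shift k (Dp 0 N f) = Dp k N (shift k f)"
proof (rule subst_Dp)
  show "shift k (dd (0 + i) f) = dd (k + i) (shift k f)" for i f
    by (rule subst_dd) (simp_all add: act_def subst_subst st_add)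
qed

lemma trunc_Dp: "trunc N (Dp 0 N f) = Dp 0 N (trunc N f)"
proof (rule subst_Dp)
  fix i f assume "Suc i < N"
  then show "trunc N (dd (0 + i) f) = dd (0 + i) (trunc N f)"
    by (intro subst_dd)
      (auto simp: act_def subst_subst Transposition.transpose_def intro!: arg_cong [of _ _ "\<lambda>g. subst g _"])
qed

lemma act_trunc: "trunc a p = p \<Longrightarrow> (\<And>i. i < a \<Longrightarrow> w i = i) \<Longrightarrow> act w p = p"
proof -
  assume p: "trunc a p = p" and w: "\<And>i. i < a \<Longrightarrow> w i = i"
  have "act w (trunc a p) = trunc a p"
    unfolding act_def subst_subst by (rule arg_cong [of _ _ "\<lambda>g. subst g p"]) (auto simp: w)
  with p show ?thesis by simp
qed

definition expo :: "nat list \<Rightarrow> nat \<Rightarrow> nat" where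
  "expo \<alpha> i = \<alpha> ! i + (length \<alpha> - 1 - i)"

text \<open>Dividing an alternant by the Vandermonde determinant is what \<open>Dp\<close> does, by
  \<open>vdm_Dp\<close>. This provides the quotient in the definition of \<open>schur\<close>, and
  cancellation makes it unique.\<close>

lemma schur_eq_Dp:
  assumes "length \<alpha> = a"
  shows "schur \<alpha> = Dp 0 a (mon 0 (expo \<alpha>) a)"
proof -
  have alt: "alternant \<gamma> = Alt {0..<0 + length \<gamma>} (mon 0 ((!) \<gamma>) (length \<gamma>))" for \<gamma>
    by (simp add: alternant_def Alt_def mon_def atLeast0LessThan)
  have d: "alternant [a - 1 - i. i \<leftarrow> [0..<a]] = vdm 0 a"
    by (simp add: alt vdm_def mon_def delta_def)
  have m: "alternant [\<alpha> ! i + (a - 1 - i). i \<leftarrow> [0..<a]] = vdm 0 a * Dp 0 a (mon 0 (expo \<alpha>) a)"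
    by (simp add: alt vdm_Dp mon_def expo_def assms)
  show ?thesis
    unfolding schur_def assms d m by (rule the_equality) (simp_all add: mult.commute)
qed

text \<open>Records that no variables beyond the first \<open>a\<close> occur. The comparison of the
  polynomial actions on \<open>a\<close> and on \<open>a + b\<close> strands depends on it.\<close>

lemma trunc_schur: "length \<alpha> = a \<Longrightarrow> trunc a (schur \<alpha>) = schur \<alpha>"
  by (simp add: schur_eq_Dp trunc_Dp mon_def)

lemma shift_schur: "length \<alpha> = a \<Longrightarrow> shift k (schur \<alpha>) = Dp k a (mon k (expo \<alpha>) a)"
  by (simp add: schur_eq_Dp shift_Dp mon_def)

section \<open>Partitions in a box, their complements, and the associated permutations\<close>

lemma Parts_nth:
  assumes "\<alpha> \<in> Parts a b"
  shows "length \<alpha> = a" "i < a \<Longrightarrow> \<alpha> ! i \<le> b" "i \<le> j \<Longrightarrow> j < a \<Longrightarrow> \<alpha> ! j \<le> \<alpha> ! i"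
  using assms by (auto simp: Parts_def sorted_wrt_iff_nth_less le_less)

lemma PartsI:
  assumes "length \<alpha> = a" "\<And>i. i < a \<Longrightarrow> \<alpha> ! i \<le> b" "\<And>i j. i < j \<Longrightarrow> j < a \<Longrightarrow> \<alpha> ! j \<le> \<alpha> ! i"
  shows "\<alpha> \<in> Parts a b"
  using assms by (auto simp: Parts_def sorted_wrt_iff_nth_less in_set_conv_nth)

text \<open>Complementing reverses the rows, which the bijection
  \<open>i \<mapsto> a - Suc i\<close> undoes. So the entry at \<open>j\<close> counts the rows of
  \<alpha> that do not reach the column with index \<open>b - 1 - j\<close>.\<close>

lemma hat_part_nth:
  assumes \<alpha>: "\<alpha> \<in> Parts a b" and j: "j < b"
  shows "hat_part b \<alpha> ! j = card {i. i < a \<and> \<alpha> ! i + j < b}"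
proof -
  note [simp] = Parts_nth [OF \<alpha>]
  have "bij_betw (\<lambda>i. a - Suc i) {i. i < a \<and> compl_part b \<alpha> ! i > j} {i. i < a \<and> \<alpha> ! i + j < b}"
    by (rule bij_betw_byWitness [where f' = "\<lambda>i. a - Suc i"]) (auto simp: compl_part_def rev_nth)
  then show ?thesis
    using j by (simp add: hat_part_def conj_part_def compl_part_def bij_betw_same_card)
qed

text \<open>As \<alpha> decreases, the rows counted by \<open>hat_part_nth\<close> form a final
  segment of \<open>{..<a}\<close>, and a final segment is determined by its size.\<close>

lemma hat_part_iff:
  assumes \<alpha>: "\<alpha> \<in> Parts a b" and j: "j < b" and i: "i < a"
  shows "\<alpha> ! i + j < b \<longleftrightarrow> a - hat_part b \<alpha> ! j \<le> i"
proof -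
  define U where "U = {i. i < a \<and> \<alpha> ! i + j < b}"
  have "U = {a - card U..<a}"
  proof (cases "U = {}")
    case False
    have fin: "finite U" by (simp add: U_def)
    have "U = {Min U..<a}"
    proof (intro equalityI subsetI)
      fix l assume "l \<in> {Min U..<a}"
      moreover have "Min U \<in> U" using False fin by simp
      ultimately show "l \<in> U"
        using Parts_nth(3) [OF \<alpha>, of "Min U" l] by (auto simp: U_def)
    qed (use fin in \<open>auto simp: U_def intro: Min_le\<close>)
    moreover from this have "card U = a - Min U" by (metis card_atLeastLessThan)
    moreover have "Min U < a" using Min_in [OF fin False] by (simp add: U_def)
    ultimately show ?thesis by simp
  qed simp
  then have "i \<in> U \<longleftrightarrow> i \<in> {a - card U..<a}" by blast
  then show ?thesis
    using i by (simp add: hat_part_nth [OF \<alpha> j] U_def)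
qed

lemma hat_part_Parts:
  assumes \<alpha>: "\<alpha> \<in> Parts a b"
  shows "hat_part b \<alpha> \<in> Parts b a"
proof (rule PartsI)
  show "length (hat_part b \<alpha>) = b" by (simp add: hat_part_def conj_part_def)
  show "hat_part b \<alpha> ! j \<le> a" if "j < b" for j
    unfolding hat_part_nth [OF \<alpha> that] by (rule order_trans [OF card_mono [of "{..<a}"]]) auto
  show "hat_part b \<alpha> ! j \<le> hat_part b \<alpha> ! i" if "i < j" "j < b" for i j
    using that by (simp add: hat_part_nth [OF \<alpha>]) (rule card_mono, auto)
qed

text \<open>The exponents of \<open>x\<^bsup>\<alpha>+\<delta>\<^esup>\<close> followed by those of \<open>x\<^bsup>\<beta>+\<delta>\<^esup>\<close>, where \<open>\<beta> = hat_part b \<alpha>\<close>. They are the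
  numbers \<open>0, \<dots>, a + b - 1\<close> in some order.\<close>

definition gam :: "nat \<Rightarrow> nat \<Rightarrow> nat list \<Rightarrow> nat \<Rightarrow> nat" where
  "gam a b \<alpha> i = (if i < a then expo \<alpha> i else expo (hat_part b \<alpha>) (i - a))"

text \<open>A Grassmannian permutation: it increases on each block because \<open>gam\<close>
  decreases there. The exponent \<open>gam a b \<alpha> i\<close> is the staircase exponent at
  position \<open>rho a b \<alpha> i\<close>, so the inverse of \<open>rho\<close> carries
  \<open>delta 0 (a + b)\<close> to the monomial with exponents \<open>gam\<close>.\<close>

definition rho :: "nat \<Rightarrow> nat \<Rightarrow> nat list \<Rightarrow> nat \<Rightarrow> nat" where
  "rho a b \<alpha> i = (if i < a + b then a + b - 1 - gam a b \<alpha> i else i)"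

context
  fixes a b \<alpha>
  assumes \<alpha>: "\<alpha> \<in> Parts a b"
begin

lemma expo_less:
  assumes "i < j" "j < a"
  shows "expo \<alpha> j < expo \<alpha> i"
proof -
  have "\<alpha> ! j \<le> \<alpha> ! i" using Parts_nth(3) [OF \<alpha>, of i j] assms by simp
  with assms show ?thesis unfolding expo_def Parts_nth(1) [OF \<alpha>] by linarith
qed

lemma gam_bound:
  assumes "i < a + b"
  shows "gam a b \<alpha> i < a + b"
proof (cases "i < a")
  case True
  then show ?thesis
    using Parts_nth(2) [OF \<alpha>, of i] by (simp add: gam_def expo_def Parts_nth(1) [OF \<alpha>])
next
  case False
  then have "i - a < b" using assms by linarith
  moreover from this have "hat_part b \<alpha> ! (i - a) \<le> a"
    by (rule Parts_nth(2) [OF hat_part_Parts [OF \<alpha>]])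
  ultimately show ?thesis
    using False unfolding gam_def expo_def Parts_nth(1) [OF hat_part_Parts [OF \<alpha>]] if_not_P [OF False]
    by linarith
qed

text \<open>By \<open>hat_part_iff\<close>, either \<open>\<alpha> ! i + j < b\<close> and
  \<open>a - i \<le> hat_part b \<alpha> ! j\<close>, or both inequalities fail. In each case the
  two estimates add up to a strict comparison of the exponents, so exponents of different blocks
  never coincide.\<close>

lemma gam_cross:
  assumes "i < a" "j < b"
  shows "gam a b \<alpha> i < gam a b \<alpha> (a + j) \<longleftrightarrow> a - hat_part b \<alpha> ! j \<le> i"
    "gam a b \<alpha> i \<noteq> gam a b \<alpha> (a + j)"
  using assms Parts_nth(1) [OF \<alpha>] Parts_nth(1) [OF hat_part_Parts [OF \<alpha>]]
    Parts_nth(2) [OF \<alpha>, of i] Parts_nth(2) [OF hat_part_Parts [OF \<alpha>], of j] hat_part_iff [OF \<alpha> assms(2,1)]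
  by (auto simp: gam_def expo_def)

end

lemma gam_less:
  assumes \<alpha>: "\<alpha> \<in> Parts a b" and "i < j" "j < a + b" "j < a \<or> a \<le> i"
  shows "gam a b \<alpha> j < gam a b \<alpha> i"
proof (cases "j < a")
  case True
  then show ?thesis using expo_less [OF \<alpha>, of i j] assms by (simp add: gam_def)
next
  case False
  then show ?thesis
    using expo_less [OF hat_part_Parts [OF \<alpha>], of "i - a" "j - a"] assms by (auto simp: gam_def)
qed

lemma gam_inj:
  assumes \<alpha>: "\<alpha> \<in> Parts a b"
  shows "inj_on (gam a b \<alpha>) {..<a + b}"
proof (rule linorder_inj_onI)
  fix i j assume ij: "i < j" "i \<in> {..<a + b}" "j \<in> {..<a + b}"
  show "gam a b \<alpha> i \<noteq> gam a b \<alpha> j"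
  proof (cases "j < a \<or> a \<le> i")
    case True then show ?thesis using gam_less [OF \<alpha>, of i j] ij by auto
  next
    case False
    then have "j - a < b" "a + (j - a) = j" "i < a" using ij by auto
    then show ?thesis using gam_cross(2) [OF \<alpha>, of i "j - a"] by simp
  qed
qed auto

lemma rho_permutes:
  assumes \<alpha>: "\<alpha> \<in> Parts a b"
  shows "rho a b \<alpha> permutes {..<a + b}"
proof (rule bij_imp_permutes)
  have "inj_on (rho a b \<alpha>) {..<a + b}"
  proof (rule inj_onI)
    fix i j assume "i \<in> {..<a + b}" "j \<in> {..<a + b}" "rho a b \<alpha> i = rho a b \<alpha> j"
    moreover from this have "gam a b \<alpha> i = gam a b \<alpha> j"
      using gam_bound [OF \<alpha>, of i] gam_bound [OF \<alpha>, of j] by (simp add: rho_def)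
    ultimately show "i = j" using gam_inj [OF \<alpha>] by (auto dest: inj_onD)
  qed
  moreover have "rho a b \<alpha> ` {..<a + b} \<subseteq> {..<a + b}"
    by (auto simp: rho_def)
  ultimately show "bij_betw (rho a b \<alpha>) {..<a + b} {..<a + b}"
    by (simp add: bij_betw_def endo_inj_surj)
qed (simp add: rho_def)

lemma gam_eq_rho: "\<alpha> \<in> Parts a b \<Longrightarrow> i < a + b \<Longrightarrow> gam a b \<alpha> i = a + b - 1 - rho a b \<alpha> i"
  using gam_bound [of \<alpha> a b i] by (simp add: rho_def)

lemma rho_less_iff:
  assumes "\<alpha> \<in> Parts a b" "i < a + b" "j < a + b"
  shows "rho a b \<alpha> i < rho a b \<alpha> j \<longleftrightarrow> gam a b \<alpha> j < gam a b \<alpha> i"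
  using gam_bound [OF assms(1,2)] gam_bound [OF assms(1,3)] assms by (auto simp: rho_def)

text \<open>Inversions of \<open>rho\<close> occur only between the blocks. By
  \<open>gam_cross\<close>, position \<open>a + j\<close> is inverted precisely with the last
  \<open>hat_part b \<alpha> ! j\<close> positions of the first block.\<close>

lemma sign_rho:
  assumes \<alpha>: "\<alpha> \<in> Parts a b"
  shows "sign (rho a b \<alpha>) = (- 1) ^ sum_list (hat_part b \<alpha>)"
proof -
  let ?h = "hat_part b \<alpha>" and ?f = "\<lambda>i j. if rho a b \<alpha> i < rho a b \<alpha> j then 1 else (- 1 :: int)"
  have f: "?f i j = (if gam a b \<alpha> j < gam a b \<alpha> i then 1 else - 1)" if "i < j" "j < a + b" for i j
    using rho_less_iff [OF \<alpha>, of i j] that by simp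
  have 1: "(\<Prod>j<a. \<Prod>i<j. ?f i j) = 1"
    using gam_less [OF \<alpha>] by (intro prod.neutral ballI) (simp add: f)
  have 2: "(\<Prod>i<a + j. ?f i (a + j)) = (- 1) ^ (?h ! j)" if j: "j < b" for j
  proof -
    have le: "?h ! j \<le> a" using Parts_nth(2) [OF hat_part_Parts [OF \<alpha>] j] .
    have "(\<Prod>i<a. ?f i (a + j)) = (\<Prod>i<a. if a - ?h ! j \<le> i then - 1 else 1)"
    proof (rule prod.cong [OF HOL.refl])
      fix i assume "i \<in> {..<a}"
      then show "?f i (a + j) = (if a - ?h ! j \<le> i then - 1 else 1)"
        using gam_cross [OF \<alpha>, of i j] j by (subst f) auto
    qed
    also have "\<dots> = (\<Prod>i<(a - ?h ! j) + ?h ! j. if a - ?h ! j \<le> i then - 1 else 1)"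
      using le by simp
    also have "\<dots> = (- 1) ^ (?h ! j)"
      unfolding prod_lessThan_add by simp
    finally have "(\<Prod>i<a. ?f i (a + j)) = (- 1) ^ (?h ! j)" .
    moreover have "(\<Prod>i<j. ?f (a + i) (a + j)) = 1"
      using gam_less [OF \<alpha>] j by (intro prod.neutral ballI) (subst f, auto)
    ultimately show ?thesis unfolding prod_lessThan_add by simp
  qed
  have "sign (rho a b \<alpha>) = (\<Prod>j<a + b. \<Prod>i<j. ?f i j)"
    by (rule sign_inversions [OF rho_permutes [OF \<alpha>]])
  also have "\<dots> = (\<Prod>j<b. (- 1) ^ (?h ! j))"
    unfolding prod_lessThan_add [of _ a b] 1 using 2 by simp
  also have "\<dots> = (- 1) ^ (\<Sum>j<b. ?h ! j)" by (simp add: power_sum)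
  also have "(\<Sum>j<b. ?h ! j) = sum_list ?h"
    using Parts_nth(1) [OF hat_part_Parts [OF \<alpha>]] by (simp add: sum_list_sum_nth atLeast0LessThan)
  finally show ?thesis .
qed

lemma decreasing_inj_on:
  fixes f :: "nat \<Rightarrow> nat"
  assumes "\<And>i j. i < j \<Longrightarrow> j < a \<Longrightarrow> f j < f i"
  shows "inj_on f {..<a}"
proof (rule inj_onI)
  fix i j assume "i \<in> {..<a}" "j \<in> {..<a}" "f i = f j"
  then show "i = j" using assms [of i j] assms [of j i] by (cases i j rule: linorder_cases) auto
qed

text \<open>The value at \<open>i\<close> is exceeded by exactly \<open>i\<close> others.\<close>

lemma decreasing_unique:
  fixes f g :: "nat \<Rightarrow> nat"
  assumes f: "\<And>i j. i < j \<Longrightarrow> j < a \<Longrightarrow> f j < f i" and g: "\<And>i j. i < j \<Longrightarrow> j < a \<Longrightarrow> g j < g i"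
    and eq: "f ` {..<a} = g ` {..<a}" and i: "i < a"
  shows "f i = g i"
proof -
  have count: "card {y \<in> h ` {..<a}. h i < y} = i"
    if h: "\<And>i j. i < j \<Longrightarrow> j < a \<Longrightarrow> h j < h i" and "i < a" for h :: "nat \<Rightarrow> nat" and i
  proof -
    have "{y \<in> h ` {..<a}. h i < y} = h ` {..<i}"
    proof (intro equalityI subsetI)
      fix y assume "y \<in> {y \<in> h ` {..<a}. h i < y}"
      then obtain l where l: "l < a" "y = h l" "h i < h l" by auto
      then have "l < i" using h [of i l] by (metis less_asym' linorder_neqE_nat)
      with l show "y \<in> h ` {..<i}" by simp
    qed (use that in auto)
    moreover have "inj_on h {..<i}"
      by (rule decreasing_inj_on) (use h \<open>i < a\<close> in simp)
    ultimately show ?thesis by (simp add: card_image)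
  qed
  have "f i \<in> g ` {..<a}" unfolding eq [symmetric] using i by simp
  then obtain j where j: "j < a" "f i = g j" by auto
  have "i = card {y \<in> f ` {..<a}. f i < y}" by (rule count [OF f i, symmetric])
  also have "\<dots> = card {y \<in> g ` {..<a}. g j < y}" by (simp add: eq j)
  also have "\<dots> = j" by (rule count [OF g j(1)])
  finally show ?thesis using j by simp
qed

lemma expo_unique:
  assumes \<alpha>: "\<alpha> \<in> Parts a b" and \<beta>: "\<beta> \<in> Parts a b" and eq: "expo \<alpha> ` {..<a} = expo \<beta> ` {..<a}"
  shows "\<alpha> = \<beta>"
proof (rule nth_equalityI)
  fix i assume i: "i < length \<alpha>"
  then have "expo \<alpha> i = expo \<beta> i"
    using decreasing_unique [of a "expo \<alpha>" "expo \<beta>" i] expo_less [OF \<alpha>] expo_less [OF \<beta>] eq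
      Parts_nth [OF \<alpha>] by simp
  then show "\<alpha> ! i = \<beta> ! i" using Parts_nth(1) [OF \<alpha>] Parts_nth(1) [OF \<beta>] by (simp add: expo_def)
qed (use Parts_nth(1) [OF \<alpha>] Parts_nth(1) [OF \<beta>] in simp)

text \<open>The exponents of \<beta> and of its hatted partition fill \<open>{..<a + b}\<close>. If
  those of \<alpha> avoided the latter, they would lie among those of \<beta>, and by cardinality
  coincide with them, forcing \<open>\<alpha> = \<beta>\<close>.\<close>

lemma expo_collision:
  assumes \<alpha>: "\<alpha> \<in> Parts a b" and \<beta>: "\<beta> \<in> Parts a b" and neq: "\<alpha> \<noteq> \<beta>"
  obtains i j where "i < a" "j < b" "expo \<alpha> i = expo (hat_part b \<beta>) j"
proof (rule ccontr)
  assume no: "\<not> thesis"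
  let ?g = "gam a b \<beta>"
  have img: "?g ` {..<a + b} = {..<a + b}"
    using gam_inj [OF \<beta>] gam_bound [OF \<beta>] by (intro endo_inj_surj) auto
  have "expo \<alpha> ` {..<a} \<subseteq> expo \<beta> ` {..<a}"
  proof
    fix y assume "y \<in> expo \<alpha> ` {..<a}"
    then obtain i where i: "i < a" "y = expo \<alpha> i" by auto
    then have "y = gam a b \<alpha> i" by (simp add: gam_def)
    then have "y \<in> {..<a + b}" using gam_bound [OF \<alpha>, of i] i by simp
    then have "y \<in> ?g ` {..<a + b}" by (simp only: img)
    then obtain l where l: "l < a + b" "y = ?g l" by auto
    show "y \<in> expo \<beta> ` {..<a}"
    proof (cases "l < a")
      case True with l show ?thesis by (simp add: gam_def)
    next
      case False
      then have "l - a < b" using l by linarith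
      moreover have "expo \<alpha> i = expo (hat_part b \<beta>) (l - a)" using False l i by (simp add: gam_def)
      ultimately show ?thesis using that i(1) no by blast
    qed
  qed
  moreover have "inj_on (expo \<gamma>) {..<a}" if "\<gamma> \<in> Parts a b" for \<gamma>
    by (rule decreasing_inj_on) (rule expo_less [OF that])
  ultimately have "expo \<alpha> ` {..<a} = expo \<beta> ` {..<a}"
    using \<alpha> \<beta> by (intro card_subset_eq) (simp_all add: card_image)
  with expo_unique [OF \<alpha> \<beta>] neq show False by blast
qed

text \<open>The inverse of the familiar correspondence between partitions in an \<open>a\<close> by
  \<open>b\<close> box and \<open>a\<close>-element subsets of \<open>{..<a + b}\<close>.\<close>

lemma rho_surj:
  assumes T: "T \<subseteq> {..<a + b}" "card T = a"
  obtains \<alpha> where "\<alpha> \<in> Parts a b" "rho a b \<alpha> ` {..<a} = T"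
proof -
  have fin: "finite T" using T(1) finite_subset by blast
  define xs where "xs = sorted_list_of_set T"
  have len: "length xs = a" and set: "set xs = T" and srt: "sorted_wrt (<) xs"
    using T(2) fin by (simp_all add: xs_def)
  have gap: "xs ! i + k \<le> xs ! (i + k)" if "i + k < a" for i k
    using that
  proof (induction k)
    case (Suc k)
    moreover have "xs ! (i + k) < xs ! (i + Suc k)"
      using srt Suc.prems len by (simp add: sorted_wrt_iff_nth_less)
    ultimately show ?case by simp
  qed simp
  have low: "i \<le> xs ! i" if "i < a" for i using gap [of 0 i] that by simp
  have up: "xs ! i \<le> b + i" if "i < a" for i
  proof -
    have "xs ! (a - 1) \<in> T" using that len set by (metis diff_less nth_mem zero_less_one gr_implies_not0 neq0_conv)
    then show ?thesis using gap [of i "a - 1 - i"] that T(1) by fastforce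
  qed
  \<comment> \<open>This solves \<open>rho a b \<alpha> i = xs ! i\<close>, since
    \<open>rho a b \<alpha> i\<close> equals \<open>b + i - \<alpha> ! i\<close>. The bounds
    \<open>low\<close> and \<open>up\<close> keep the entries between 0 and
    \<open>b\<close>.\<close>
  define \<alpha> where "\<alpha> = map (\<lambda>i. b + i - xs ! i) [0..<a]"
  have nth: "\<alpha> ! i = b + i - xs ! i" if "i < a" for i using that by (simp add: \<alpha>_def)
  have \<alpha>: "\<alpha> \<in> Parts a b"
  proof (rule PartsI)
    show "\<alpha> ! i \<le> b" if "i < a" for i using low [OF that] by (simp add: nth that)
    show "\<alpha> ! j \<le> \<alpha> ! i" if "i < j" "j < a" for i j
      using gap [of i "j - i"] that up [of i] by (simp add: nth)
  qed (simp add: \<alpha>_def)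
  have "rho a b \<alpha> i = xs ! i" if "i < a" for i
    using low [OF that] up [OF that] that by (simp add: rho_def gam_def expo_def nth Parts_nth(1) [OF \<alpha>])
  then have "rho a b \<alpha> ` {..<a} = T"
    unfolding set [symmetric] set_conv_nth len by (auto simp: image_def)
  with \<alpha> that show ?thesis by blast
qed

section \<open>The block subgroup, the Laplace expansion and the dual Cauchy identity\<close>

lemma vdm_Dp0: "vdm 0 N * Dp 0 N f = Alt {..<N} f"
  using vdm_Dp [of 0 N f] by (simp add: atLeast0LessThan)

lemma subst_trunc:
  assumes p: "trunc a p = p" and h: "\<And>i. i < a \<Longrightarrow> h i = X i"
  shows "subst h p = p"
proof -
  have "subst h (trunc a p) = trunc a p"
    unfolding subst_subst by (rule arg_cong [of _ _ "\<lambda>g. subst g p"]) (auto simp: h)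
  with p show ?thesis by simp
qed

lemma act_shift: "(\<And>i. a \<le> i \<Longrightarrow> w i = i) \<Longrightarrow> act w (shift a p) = shift a p"
  by (simp add: act_def subst_subst)

text \<open>The Young subgroup S_a x S_b, described as the stabilizer of the first block, which is
  how membership is tested in the coset arguments. The product decomposition is
  \<open>block_perms_bij\<close>.\<close>

definition block_perms :: "nat \<Rightarrow> nat \<Rightarrow> (nat \<Rightarrow> nat) set" where
  "block_perms a b = {w. w permutes {..<a + b} \<and> w ` {..<a} = {..<a}}"

lemma block_perms_image:
  assumes "w \<in> block_perms a b"
  shows "w ` {a..<a + b} = {a..<a + b}"
proof -
  have w: "w permutes {..<a + b}" "w ` {..<a} = {..<a}" using assms by (auto simp: block_perms_def)
  have "{a..<a + b} = {..<a + b} - {..<a}" by auto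
  then show ?thesis
    using image_set_diff [OF permutes_inj [OF w(1)], of "{..<a + b}" "{..<a}"] w permutes_image [OF w(1)]
    by simp
qed

lemma block_perms_bij:
  "bij_betw (\<lambda>(v, v'). v \<circ> v') ({v. v permutes {..<a}} \<times> {v. v permutes {a..<a + b}}) (block_perms a b)"
  (is "bij_betw ?comp ?P _")
proof -
  let ?split = "\<lambda>w :: nat \<Rightarrow> nat. (\<lambda>i. if i < a then w i else i, \<lambda>i. if a \<le> i then w i else i)"
  show ?thesis
  proof (rule bij_betw_byWitness [where f' = ?split])
    have low: "v' i = i" if "v' permutes {a..<a + b}" "i < a" for v' :: "nat \<Rightarrow> nat" and i
      using permutes_not_in [OF that(1), of i] that by simp
    have hi: "a \<le> v' i" if "v' permutes {a..<a + b}" "a \<le> i" for v' :: "nat \<Rightarrow> nat" and i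
      using permutes_in_image [OF that(1), of i] permutes_not_in [OF that(1), of i] that
      by (cases "i < a + b") auto
    have out: "v i = i" if "v permutes {..<a}" "a \<le> i" for v :: "nat \<Rightarrow> nat" and i
      using permutes_not_in [OF that(1), of i] that by simp
    show "\<forall>x\<in>?P. ?split (?comp x) = x"
    proof
      fix x assume "x \<in> ?P"
      moreover define v v' where "v = fst x" and "v' = snd x"
      ultimately have x: "x = (v, v')" and v: "v permutes {..<a}" "v' permutes {a..<a + b}" by auto
      have "(\<lambda>i. if i < a then v (v' i) else i) = v"
        using low [OF v(2)] out [OF v(1)] by (auto simp: fun_eq_iff)
      moreover have "(\<lambda>i. if a \<le> i then v (v' i) else i) = v'"
        using low [OF v(2)] out [OF v(1)] hi [OF v(2)] by (auto simp: fun_eq_iff not_le)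
      ultimately show "?split (?comp x) = x"
        by (simp add: x cong: if_cong)
    qed
    show "\<forall>w\<in>block_perms a b. ?comp (?split w) = w"
    proof
      fix w assume w: "w \<in> block_perms a b"
      have hiw: "a \<le> w i" if "a \<le> i" for i
      proof (cases "i < a + b")
        case True
        then have "w i \<in> {a..<a + b}" using block_perms_image [OF w] that by auto
        then show ?thesis by simp
      next
        case False
        then have "w i = i" using w by (auto simp: block_perms_def intro: permutes_not_in)
        then show ?thesis using that by simp
      qed
      have "(if (if a \<le> i then w i else i) < a then w (if a \<le> i then w i else i) else if a \<le> i then w i else i) = w i" for i
        using hiw [of i] by (cases "a \<le> i") simp_all
      then show "?comp (?split w) = w"
        by (simp add: comp_def)
    qed
    show "?comp ` ?P \<subseteq> block_perms a b"
    proof (rule image_subsetI)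
      fix x assume "x \<in> ?P"
      moreover define v v' where "v = fst x" and "v' = snd x"
      ultimately have x: "x = (v, v')" and v: "v permutes {..<a}" "v' permutes {a..<a + b}" by auto
      have "(v \<circ> v') ` {..<a} = v ` {..<a}"
        by (rule image_cong) (simp_all add: low [OF v(2)])
      moreover have "v \<circ> v' permutes {..<a + b}"
        by (rule permutes_compose) (use v in \<open>auto intro: permutes_subset\<close>)
      ultimately show "?comp x \<in> block_perms a b"
        using permutes_image [OF v(1)] by (simp add: block_perms_def x)
    qed
    show "?split ` block_perms a b \<subseteq> ?P"
    proof (rule image_subsetI)
      fix w assume w: "w \<in> block_perms a b"
      then have inj: "inj_on w A" for A by (auto simp: block_perms_def intro: permutes_inj_on)
      have out: "w i = i" if "a + b \<le> i" for i using w that by (auto simp: block_perms_def intro: permutes_not_in)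
      have "bij_betw (\<lambda>i. if i < a then w i else i) {..<a} {..<a} \<longleftrightarrow> bij_betw w {..<a} {..<a}"
        by (rule bij_betw_cong) simp
      then have 1: "(\<lambda>i. if i < a then w i else i) permutes {..<a}"
        using w inj by (intro bij_imp_permutes) (auto simp: bij_betw_def block_perms_def)
      have "bij_betw (\<lambda>i. if a \<le> i then w i else i) {a..<a + b} {a..<a + b} \<longleftrightarrow> bij_betw w {a..<a + b} {a..<a + b}"
        by (rule bij_betw_cong) simp
      then have 2: "(\<lambda>i. if a \<le> i then w i else i) permutes {a..<a + b}"
        using block_perms_image [OF w] inj out by (intro bij_imp_permutes) (auto simp: bij_betw_def)
      from 1 2 show "(\<lambda>i. if i < a then w i else i, \<lambda>i. if a \<le> i then w i else i)
          \<in> ?P" by simp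
    qed
  qed
qed

lemma sum_block_perms: "(\<Sum>w\<in>block_perms a b. of_int (sign w) * act w f) = Alt {..<a} (Alt {a..<a + b} f)"
proof -
  let ?P = "{v. v permutes {..<a}}" and ?Q = "{v. v permutes {a..<a + b}}"
  have "(\<Sum>w\<in>block_perms a b. of_int (sign w) * act w f)
      = (\<Sum>(v, v')\<in>?P \<times> ?Q. of_int (sign (v \<circ> v')) * act (v \<circ> v') f)"
    using sum.reindex_bij_betw [OF block_perms_bij, of "\<lambda>w. of_int (sign w) * act w f" a b]
    by (simp add: case_prod_unfold)
  also have "\<dots> = (\<Sum>(v, v')\<in>?P \<times> ?Q. of_int (sign v) * act v (of_int (sign v') * act v' f))"
  proof (rule sum.cong [OF HOL.refl], clarify)
    fix v v' assume "v permutes {..<a}" "v' permutes {a..<a + b}"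
    then have "v permutes {..<a + b}" "v' permutes {..<a + b}"
      by (auto intro: permutes_subset)
    then show "of_int (sign (v \<circ> v')) * act (v \<circ> v') f = of_int (sign v) * act v (of_int (sign v') * act v' f)"
      using sign_compose' [of "{..<a + b}" v v'] by (simp add: act_comp mult.assoc)
  qed
  also have "\<dots> = Alt {..<a} (Alt {a..<a + b} f)"
    by (simp add: Alt_def sum.cartesian_product [symmetric] sum_distrib_left)
  finally show ?thesis .
qed

lemma act_vdm_high: "(\<And>i. a \<le> i \<Longrightarrow> w i = i) \<Longrightarrow> act w (vdm a b) = vdm a b"
  by (simp add: vdm_prod)

lemma Alt_Alt: "Alt {..<a} (Alt {a..<a + b} f) = vdm 0 a * vdm a b * Dp 0 a (Dp a b f)"
proof -
  have "Alt {..<a} (Alt {a..<a + b} f) = vdm a b * Alt {..<a} (Dp a b f)"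
    unfolding vdm_Dp [symmetric]
    by (rule Alt_sym_mult, rule act_vdm_high) (simp add: permutes_not_in)
  then show ?thesis by (simp add: vdm_Dp0 [symmetric] mult_ac)
qed

abbreviation sgn_hat :: "nat \<Rightarrow> nat list \<Rightarrow> int" where
  "sgn_hat b \<alpha> \<equiv> (- 1) ^ sum_list (hat_part b \<alpha>)"

abbreviation schur_hat :: "nat \<Rightarrow> nat \<Rightarrow> nat list \<Rightarrow> mpoly" where
  "schur_hat a b \<alpha> \<equiv> shift a (schur (hat_part b \<alpha>))"

lemma mon_gam: "\<alpha> \<in> Parts a b \<Longrightarrow> mon 0 (gam a b \<alpha>) (a + b) = mon 0 (expo \<alpha>) a * mon a (expo (hat_part b \<alpha>)) b"
  by (simp add: mon_add) (simp add: mon_def gam_def)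

text \<open>The monomial splits into one factor for each block, and each longest divided difference
  treats the factor of the other block as a constant.\<close>

lemma Dp_mon_gam:
  assumes \<alpha>: "\<alpha> \<in> Parts a b"
  shows "Dp 0 a (Dp a b (mon 0 (gam a b \<alpha>) (a + b))) = schur \<alpha> * schur_hat a b \<alpha>"
proof -
  have "act (st (a + i)) (mon 0 e a) = mon 0 e a" for e i
    by (simp add: mon_def Transposition.transpose_def)
  then have "Dp a b (mon 0 (gam a b \<alpha>) (a + b)) = mon 0 (expo \<alpha>) a * schur_hat a b \<alpha>"
    using Parts_nth(1) [OF hat_part_Parts [OF \<alpha>]]
    by (simp add: mon_gam [OF \<alpha>] Dp_sym_mult shift_schur)
  then have "Dp 0 a (Dp a b (mon 0 (gam a b \<alpha>) (a + b))) = Dp 0 a (schur_hat a b \<alpha> * mon 0 (expo \<alpha>) a)"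
    by (simp add: mult.commute)
  also have "\<dots> = schur_hat a b \<alpha> * Dp 0 a (mon 0 (expo \<alpha>) a)"
    by (rule Dp_sym_mult, rule act_shift) (simp add: Transposition.transpose_def)
  finally show ?thesis using Parts_nth(1) [OF \<alpha>] by (simp add: schur_eq_Dp [of \<alpha> a] mult.commute)
qed

lemma delta_mon: "delta k N = mon k (\<lambda>i. N - 1 - i) N"
  by (simp add: delta_def mon_def)

lemma act_inv_rho_delta:
  assumes \<alpha>: "\<alpha> \<in> Parts a b"
  shows "act (inv (rho a b \<alpha>)) (delta 0 (a + b)) = mon 0 (gam a b \<alpha>) (a + b)"
proof -
  note r = rho_permutes [OF \<alpha>]
  have "act (inv (rho a b \<alpha>)) (delta 0 (a + b)) = mon 0 (\<lambda>i. a + b - 1 - rho a b \<alpha> i) (a + b)"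
    by (simp add: delta_mon act_mon [OF permutes_inv [OF r]] permutes_inv_inv [OF r])
  then show ?thesis by (simp add: mon_def gam_eq_rho [OF \<alpha>])
qed

lemma rho_block_perms_bij:
  "bij_betw (\<lambda>(\<alpha>, v). v \<circ> inv (rho a b \<alpha>)) (Parts a b \<times> block_perms a b) {w. w permutes {..<a + b}}"
proof (rule bij_betw_imageI)
  have img: "inv (v \<circ> inv (rho a b \<alpha>)) ` {..<a} = rho a b \<alpha> ` {..<a}"
    if "\<alpha> \<in> Parts a b" "v \<in> block_perms a b" for \<alpha> v
  proof -
    have v: "v permutes {..<a + b}" "v ` {..<a} = {..<a}" using that by (auto simp: block_perms_def)
    note r = rho_permutes [OF that(1)]
    have "inv (v \<circ> inv (rho a b \<alpha>)) = rho a b \<alpha> \<circ> inv v"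
      using o_inv_distrib [OF permutes_bij [OF v(1)] permutes_bij [OF permutes_inv [OF r]]]
      by (simp add: permutes_inv_inv [OF r])
    moreover have "inv v ` {..<a} = {..<a}"
      using v by (metis image_inv_f_f permutes_inj)
    ultimately show ?thesis by (simp only: image_comp [symmetric])
  qed
  show "inj_on (\<lambda>(\<alpha>, v). v \<circ> inv (rho a b \<alpha>)) (Parts a b \<times> block_perms a b)"
  proof (rule inj_onI, clarify)
    fix \<alpha> v \<beta> u
    assume \<alpha>: "\<alpha> \<in> Parts a b" and v: "v \<in> block_perms a b" and \<beta>: "\<beta> \<in> Parts a b" and u: "u \<in> block_perms a b"
      and eq: "v \<circ> inv (rho a b \<alpha>) = u \<circ> inv (rho a b \<beta>)"
    have "rho a b \<alpha> ` {..<a} = rho a b \<beta> ` {..<a}"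
      using img [OF \<alpha> v] img [OF \<beta> u] eq by simp
    then have "(\<lambda>i. a + b - 1 - i) ` rho a b \<alpha> ` {..<a} = (\<lambda>i. a + b - 1 - i) ` rho a b \<beta> ` {..<a}"
      by (rule arg_cong)
    moreover have "(\<lambda>i. a + b - 1 - i) ` rho a b \<gamma> ` {..<a} = expo \<gamma> ` {..<a}" if "\<gamma> \<in> Parts a b" for \<gamma>
      unfolding image_image
    proof (rule image_cong [OF HOL.refl])
      fix i assume "i \<in> {..<a}"
      then show "a + b - 1 - rho a b \<gamma> i = expo \<gamma> i"
        using gam_eq_rho [OF that, of i] by (simp add: gam_def)
    qed
    ultimately have "\<alpha> = \<beta>"
      using expo_unique [OF \<alpha> \<beta>] \<alpha> \<beta> by simp
    moreover from this have "v = u"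
      using eq permutes_inv_o(2) [OF rho_permutes [OF \<beta>]] by (metis comp_assoc comp_id)
    ultimately show "\<alpha> = \<beta> \<and> v = u" by simp
  qed
  show "(\<lambda>(\<alpha>, v). v \<circ> inv (rho a b \<alpha>)) ` (Parts a b \<times> block_perms a b) = {w. w permutes {..<a + b}}"
  proof (intro equalityI subsetI)
    fix w assume "w \<in> {w. w permutes {..<a + b}}"
    then have w: "w permutes {..<a + b}" by simp
    have "inv w ` {..<a} \<subseteq> {..<a + b}"
      using permutes_image [OF permutes_inv [OF w]] by auto
    moreover have "card (inv w ` {..<a}) = a"
      using permutes_inj_on [OF permutes_inv [OF w]] by (simp add: card_image)
    ultimately obtain \<alpha> where \<alpha>: "\<alpha> \<in> Parts a b" "rho a b \<alpha> ` {..<a} = inv w ` {..<a}"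
      by (rule rho_surj)
    have "(w \<circ> rho a b \<alpha>) ` {..<a} = {..<a}"
      unfolding image_comp [symmetric] \<alpha>(2) by (rule image_f_inv_f [OF permutes_surj [OF w]])
    then have "w \<circ> rho a b \<alpha> \<in> block_perms a b"
      using permutes_compose [OF rho_permutes [OF \<alpha>(1)] w] by (simp add: block_perms_def)
    moreover have "w = (w \<circ> rho a b \<alpha>) \<circ> inv (rho a b \<alpha>)"
      using permutes_inv_o(1) [OF rho_permutes [OF \<alpha>(1)]] by (simp add: comp_assoc)
    ultimately show "w \<in> (\<lambda>(\<alpha>, v). v \<circ> inv (rho a b \<alpha>)) ` (Parts a b \<times> block_perms a b)"
      using \<alpha>(1) by (intro image_eqI [where x = "(\<alpha>, w \<circ> rho a b \<alpha>)"]) simp_all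
  next
    fix w assume "w \<in> (\<lambda>(\<alpha>, v). v \<circ> inv (rho a b \<alpha>)) ` (Parts a b \<times> block_perms a b)"
    then show "w \<in> {w. w permutes {..<a + b}}"
      by (auto simp: block_perms_def intro!: permutes_compose permutes_inv rho_permutes)
  qed
qed

text \<open>This is the Laplace expansion of the Vandermonde determinant along its first \<open>a\<close> rows.\<close>

lemma dual_cauchy:
  "(\<Sum>\<alpha>\<in>Parts a b. of_int (sgn_hat b \<alpha>) * schur \<alpha> * schur_hat a b \<alpha>) = (\<Prod>j<b. \<Prod>i<a. X i - X (a + j))"
proof -
  let ?F = "\<lambda>w. of_int (sign w) * act w (delta 0 (a + b))"
  have "vdm 0 (a + b) = (\<Sum>w | w permutes {..<a + b}. ?F w)"
    by (simp add: vdm_def Alt_def atLeast0LessThan)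
  also have "\<dots> = (\<Sum>(\<alpha>, v)\<in>Parts a b \<times> block_perms a b. ?F (v \<circ> inv (rho a b \<alpha>)))"
    using sum.reindex_bij_betw [OF rho_block_perms_bij, of ?F a b] by (simp add: case_prod_unfold)
  also have "\<dots> = (\<Sum>(\<alpha>, v)\<in>Parts a b \<times> block_perms a b. of_int (sgn_hat b \<alpha>) *
      (of_int (sign v) * act v (mon 0 (gam a b \<alpha>) (a + b))))"
  proof (rule sum.cong [OF HOL.refl], clarify)
    fix \<alpha> v assume \<alpha>: "\<alpha> \<in> Parts a b" and v: "v \<in> block_perms a b"
    have "sign (v \<circ> inv (rho a b \<alpha>)) = sign v * sgn_hat b \<alpha>"
      using v rho_permutes [OF \<alpha>] permutes_inv [OF rho_permutes [OF \<alpha>]]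
      by (simp add: block_perms_def sign_compose' [of "{..<a + b}"] sign_inverse' [of "{..<a + b}"] sign_rho [OF \<alpha>])
    then show "?F (v \<circ> inv (rho a b \<alpha>)) = of_int (sgn_hat b \<alpha>) *
      (of_int (sign v) * act v (mon 0 (gam a b \<alpha>) (a + b)))"
      by (simp add: act_comp [symmetric] act_inv_rho_delta [OF \<alpha>] mult_ac)
  qed
  also have "\<dots> = (\<Sum>\<alpha>\<in>Parts a b. of_int (sgn_hat b \<alpha>) *
      (\<Sum>v\<in>block_perms a b. of_int (sign v) * act v (mon 0 (gam a b \<alpha>) (a + b))))"
    by (simp add: sum.cartesian_product [symmetric] sum_distrib_left)
  also have "\<dots> = (vdm 0 a * vdm a b) * (\<Sum>\<alpha>\<in>Parts a b. of_int (sgn_hat b \<alpha>) * schur \<alpha> * schur_hat a b \<alpha>)"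
    by (simp add: sum_block_perms Alt_Alt Dp_mon_gam sum_distrib_left mult_ac)
  finally show ?thesis unfolding vdm_split by simp
qed

text \<open>Applying \<open>w\<close> to the second block of variables in the dual Cauchy identity gives a product that vanishes
  unless \<open>w\<close> preserves the blocks.\<close>

lemma sum_schur_Dp:
  "(\<Sum>\<alpha>\<in>Parts a b. of_int (sgn_hat b \<alpha>) * schur \<alpha> * Dp 0 (a + b) (schur_hat a b \<alpha> * f)) = Dp 0 a (Dp a b f)"
proof (rule vdm_cancel [of 0 "a + b"])
  let ?S = "{w. w permutes {..<a + b}}"
  let ?P = "\<lambda>w. \<Prod>j<b. \<Prod>i<a. X i - X (w (a + j))"
  have cauchy: "(\<Sum>\<alpha>\<in>Parts a b. of_int (sgn_hat b \<alpha>) * schur \<alpha> * act w (schur_hat a b \<alpha>)) = ?P w" for w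
  proof -
    \<comment> \<open>The substitution moves only the variables of the second block, so it fixes the
      \<open>schur\<close> factor and acts as \<open>w\<close> on the shifted one.\<close>
    define h where "h i = (if i < a then X i else X (w i))" for i
    have "subst h (schur \<alpha>) = schur \<alpha>" if "\<alpha> \<in> Parts a b" for \<alpha>
      by (rule subst_trunc [OF trunc_schur [OF Parts_nth(1) [OF that]]]) (simp add: h_def)
    moreover have "subst h (shift a p) = act w (shift a p)" for p
      by (simp add: act_def subst_subst h_def)
    ultimately have "subst h (\<Sum>\<alpha>\<in>Parts a b. of_int (sgn_hat b \<alpha>) * schur \<alpha> * schur_hat a b \<alpha>)
        = (\<Sum>\<alpha>\<in>Parts a b. of_int (sgn_hat b \<alpha>) * schur \<alpha> * act w (schur_hat a b \<alpha>))"
      unfolding subst_sum by (intro sum.cong) (simp_all only: subst_mult subst_of_int HOL.refl)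
    then show ?thesis unfolding dual_cauchy by (simp add: h_def)
  qed
  have "vdm 0 (a + b) * (\<Sum>\<alpha>\<in>Parts a b. of_int (sgn_hat b \<alpha>) * schur \<alpha> * Dp 0 (a + b) (schur_hat a b \<alpha> * f))
     = (\<Sum>\<alpha>\<in>Parts a b. of_int (sgn_hat b \<alpha>) * schur \<alpha> * Alt {..<a + b} (schur_hat a b \<alpha> * f))"
    by (simp add: sum_distrib_left vdm_Dp0 [symmetric] mult_ac)
  also have "\<dots> = (\<Sum>w\<in>?S. (\<Sum>\<alpha>\<in>Parts a b. of_int (sgn_hat b \<alpha>) * schur \<alpha> * act w (schur_hat a b \<alpha>))
      * (of_int (sign w) * act w f))"
    unfolding Alt_def sum_distrib_left sum_distrib_right
    by (subst sum.swap) (simp add: mult_ac)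
  also have "\<dots> = (\<Sum>w\<in>?S. ?P w * (of_int (sign w) * act w f))"
    unfolding cauchy ..
  also have "\<dots> = (\<Sum>w\<in>block_perms a b. ?P w * (of_int (sign w) * act w f))"
  proof (rule sum.mono_neutral_right)
    show "\<forall>w\<in>?S - block_perms a b. ?P w * (of_int (sign w) * act w f) = 0"
    proof
      fix w assume w: "w \<in> ?S - block_perms a b"
      then have wp: "w permutes {..<a + b}" by simp
      \<comment> \<open>Outside the block subgroup some index of the second block is sent into the
        first; the factor with \<open>i = w (a + j)\<close> is then zero.\<close>
      have "\<exists>j<b. w (a + j) < a"
      proof (rule ccontr)
        assume no: "\<not> (\<exists>j<b. w (a + j) < a)"
        have "w i \<in> {a..<a + b}" if "i \<in> {a..<a + b}" for i
        proof -
          from that have "i - a < b" "a + (i - a) = i" by auto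
          then have "a \<le> w i" using no by (metis not_less)
          moreover have "w i \<in> {..<a + b}" using permutes_in_image [OF wp, of i] that by simp
          ultimately show ?thesis by simp
        qed
        then have "w ` {a..<a + b} = {a..<a + b}"
          by (intro endo_inj_surj permutes_inj_on [OF wp]) auto
        moreover have "{..<a} = {..<a + b} - {a..<a + b}" by auto
        ultimately have "w ` {..<a} = {..<a}"
          using image_set_diff [OF permutes_inj [OF wp], of "{..<a + b}" "{a..<a + b}"] permutes_image [OF wp]
          by simp
        with w wp show False by (simp add: block_perms_def)
      qed
      then obtain j where j: "j < b" "w (a + j) < a" by blast
      then have "(\<Prod>i<a. X i - X (w (a + j))) = 0" by (intro prod_zero) (auto intro!: bexI [of _ "w (a + j)"])
      with j have "\<exists>j\<in>{..<b}. (\<Prod>i<a. X i - X (w (a + j))) = 0" by blast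
      then have "?P w = 0" by (rule prod_zero [OF finite_lessThan])
      then show "?P w * (of_int (sign w) * act w f) = 0" by simp
    qed
  qed (auto simp: finite_permutations block_perms_def)
  \<comment> \<open>A block permutation merely permutes the factors attached to the second
    block.\<close>
  also have "\<dots> = (\<Sum>w\<in>block_perms a b. ?P id * (of_int (sign w) * act w f))"
  proof (rule sum.cong [OF HOL.refl])
    fix w assume w: "w \<in> block_perms a b"
    have re: "(\<Prod>j<b. F (a + j)) = prod F {a..<a + b}" for F :: "nat \<Rightarrow> mpoly"
      by (rule prod.reindex_bij_witness [of _ "\<lambda>i. i - a" "\<lambda>i. a + i"]) auto
    have "inj_on w {a..<a + b}" using w by (auto simp: block_perms_def intro: permutes_inj_on)
    then have "(\<Prod>l\<in>{a..<a + b}. \<Prod>i<a. X i - X (w l)) = (\<Prod>l\<in>w ` {a..<a + b}. \<Prod>i<a. X i - X l)"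
      by (simp add: prod.reindex)
    then have "?P w = ?P id"
      using re [of "\<lambda>l. \<Prod>i<a. X i - X (w l)"] re [of "\<lambda>l. \<Prod>i<a. X i - X l"]
      by (simp add: block_perms_image [OF w])
    then show "?P w * (of_int (sign w) * act w f) = ?P id * (of_int (sign w) * act w f)" by simp
  qed
  also have "\<dots> = vdm 0 (a + b) * Dp 0 a (Dp a b f)"
    unfolding sum_distrib_left [symmetric] sum_block_perms Alt_Alt vdm_split by (simp add: mult_ac)
  finally show "vdm 0 (a + b) * (\<Sum>\<alpha>\<in>Parts a b. of_int (sgn_hat b \<alpha>) * schur \<alpha> * Dp 0 (a + b) (schur_hat a b \<alpha> * f))
      = vdm 0 (a + b) * Dp 0 a (Dp a b f)" .
qed

section \<open>Operator identities behind splitters and mergers\<close>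

definition Eop :: "nat \<Rightarrow> nat \<Rightarrow> mpoly \<Rightarrow> mpoly" where
  "Eop k N f = delta k N * Dp k N f"

lemma act_schur_high:
  assumes "\<alpha> \<in> Parts a b"
  shows "(\<And>i. i < a \<Longrightarrow> w i = i) \<Longrightarrow> act w (schur \<alpha>) = schur \<alpha>"
  by (rule act_trunc [OF trunc_schur [OF Parts_nth(1) [OF assms]]])

lemma act_schur:
  assumes "\<alpha> \<in> Parts a b" "w permutes {..<a}"
  shows "act w (schur \<alpha>) = schur \<alpha>"
  using act_Dp [of w 0 a] assms(2) by (simp add: schur_eq_Dp [OF Parts_nth(1) [OF assms(1)]] atLeast0LessThan)

lemma act_schur_hat:
  assumes "\<alpha> \<in> Parts a b" "w permutes {a..<a + b}"
  shows "act w (schur_hat a b \<alpha>) = schur_hat a b \<alpha>"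
  using act_Dp [OF assms(2)] by (simp add: shift_schur [OF Parts_nth(1) [OF hat_part_Parts [OF assms(1)]]])

lemma st_permutes: "Suc i < N \<Longrightarrow> st (k + i) permutes {k..<k + N}"
  by (rule permutes_swap_id) auto

lemma Eop_sym_mult:
  assumes "\<And>w. w permutes {k..<k + N} \<Longrightarrow> act w f = f"
  shows "Eop k N (f * g) = f * Eop k N g"
  unfolding Eop_def by (subst Dp_sym_mult) (auto simp: mult_ac intro: assms st_permutes)

lemma Eop_delta [simp]: "Eop k N (delta k N) = delta k N"
  by (simp add: Eop_def)

lemma Eop_sym_mult_0:
  assumes "\<And>w. w permutes {..<N} \<Longrightarrow> act w f = f"
  shows "Eop 0 N (f * g) = f * Eop 0 N g"
  by (rule Eop_sym_mult) (use assms in \<open>simp add: atLeast0LessThan\<close>)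

context
  fixes a b :: nat
begin

abbreviation (input) "E1 \<equiv> Eop 0 a"
abbreviation (input) "E2 \<equiv> Eop a b"

lemma act_sub:
  assumes "\<And>w. w permutes {..<a + b} \<Longrightarrow> act w g = g"
  shows "w permutes {..<a} \<Longrightarrow> act w g = g" "w permutes {a..<a + b} \<Longrightarrow> act w g = g"
  by (rule assms, erule permutes_subset, auto)+

lemma act_low:
  assumes "w permutes {..<a}"
  shows "act w (delta a b) = delta a b" "act w (shift a p) = shift a p"
  using permutes_not_in [OF assms] by (simp_all add: delta_def act_shift)

lemma act_high:
  assumes "w permutes {a..<a + b}"
  shows "act w (delta 0 a) = delta 0 a" "\<alpha> \<in> Parts a b \<Longrightarrow> act w (schur \<alpha>) = schur \<alpha>"
    "act w (mon 0 e a) = mon 0 e a"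
  using permutes_not_in [OF assms] by (simp_all add: delta_def mon_def act_schur_high)

text \<open>Each block operator fixes its own staircase and lets everything symmetric in its block
  pass. This describes the image of the tensor product of the two idempotents on
  polynomials.\<close>

lemma E1E2_delta:
  assumes g: "\<And>w. w permutes {..<a} \<Longrightarrow> act w g = g" "\<And>w. w permutes {a..<a + b} \<Longrightarrow> act w g = g"
  shows "E1 (E2 (delta 0 a * delta a b * g)) = delta 0 a * delta a b * g"
proof -
  have "E2 (delta 0 a * delta a b * g) = E2 ((delta 0 a * g) * delta a b)" by (simp add: mult_ac)
  also have "\<dots> = (delta 0 a * g) * E2 (delta a b)"
    by (rule Eop_sym_mult) (simp only: act_simps act_high g)
  finally have "E1 (E2 (delta 0 a * delta a b * g)) = E1 ((delta a b * g) * delta 0 a)" by (simp add: mult_ac)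
  also have "\<dots> = (delta a b * g) * E1 (delta 0 a)"
    by (rule Eop_sym_mult_0) (simp only: act_simps act_low g)
  finally show ?thesis by (simp add: mult_ac)
qed

text \<open>In each block, \<open>Alt_delta_Dp\<close> absorbs the staircase together with the
  \<open>Dp\<close> inside the Schur polynomial, leaving the bare monomial. For
  \<open>\<alpha> = \<beta>\<close> that monomial is a permuted staircase and \<open>Alt\<close>
  contributes the sign of \<open>rho\<close>; otherwise \<open>expo_collision\<close>
  applies.\<close>

lemma Dp_schur_schur_hat:
  assumes \<alpha>: "\<alpha> \<in> Parts a b" and \<beta>: "\<beta> \<in> Parts a b"
  shows "Dp 0 (a + b) (delta 0 a * schur \<alpha> * (delta a b * schur_hat a b \<beta>))
    = (if \<alpha> = \<beta> then of_int (sgn_hat b \<beta>) else 0)"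
proof (rule Dp_eqI)
  let ?m = "mon 0 (expo \<alpha>) a" and ?m' = "mon a (expo (hat_part b \<beta>)) b"
  let ?A = "Alt {..<a + b}"
  have hat: "schur_hat a b \<beta> = Dp a b ?m'"
    by (rule shift_schur [OF Parts_nth(1) [OF hat_part_Parts [OF \<beta>]]])
  have sch: "schur \<alpha> = Dp 0 a ?m" by (rule schur_eq_Dp [OF Parts_nth(1) [OF \<alpha>]])
  have "?A (delta 0 a * schur \<alpha> * (delta a b * schur_hat a b \<beta>))
      = ?A (delta 0 a * Dp 0 a ((delta a b * schur_hat a b \<beta>) * ?m))"
  proof (subst Dp_sym_mult)
    fix i assume "Suc i < a"
    then have "st (0 + i) permutes {..<a}" using st_permutes [of i a 0] by (simp add: atLeast0LessThan)
    then show "act (st (0 + i)) (delta a b * schur_hat a b \<beta>) = delta a b * schur_hat a b \<beta>"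
      by (simp only: act_simps act_low)
  qed (simp add: sch mult_ac)
  also have "\<dots> = ?A ((delta a b * schur_hat a b \<beta>) * ?m)"
    by (rule Alt_delta_Dp) auto
  also have "\<dots> = ?A (delta a b * Dp a b (?m * ?m'))"
    by (subst Dp_sym_mult) (simp_all add: act_high(3) [OF st_permutes] hat mult_ac)
  also have "\<dots> = ?A (?m * ?m')"
    by (rule Alt_delta_Dp) auto
  also have "\<dots> = vdm 0 (a + b) * (if \<alpha> = \<beta> then of_int (sgn_hat b \<beta>) else 0)"
  proof (cases "\<alpha> = \<beta>")
    case True
    have "?A (?m * ?m') = ?A (act (inv (rho a b \<beta>)) (delta 0 (a + b)))"
      by (simp add: True act_inv_rho_delta [OF \<beta>] mon_gam [OF \<beta>])
    also have "\<dots> = of_int (sgn_hat b \<beta>) * ?A (delta 0 (a + b))"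
      using Alt_act [OF _ permutes_inv [OF rho_permutes [OF \<beta>]], of "delta 0 (a + b)"]
        sign_inverse' [OF _ rho_permutes [OF \<beta>]] sign_rho [OF \<beta>] by simp
    finally show ?thesis using True by (simp add: vdm_def atLeast0LessThan mult.commute)
  next
    case False
    obtain i j where ij: "i < a" "j < b" "expo \<alpha> i = expo (hat_part b \<beta>) j"
      using expo_collision [OF \<alpha> \<beta> False] .
    let ?e = "\<lambda>i. if i < a then expo \<alpha> i else expo (hat_part b \<beta>) (i - a)"
    have "?m * ?m' = mon 0 ?e (a + b)"
      by (simp add: mon_add) (simp add: mon_def)
    moreover have "?A (mon 0 ?e (a + b)) = 0"
      by (rule Alt_mon_eq_0 [of i _ "a + j"]) (use ij in auto)
    ultimately show ?thesis using False by simp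
  qed
  finally show "Alt {0..<0 + (a + b)} (delta 0 a * schur \<alpha> * (delta a b * schur_hat a b \<beta>))
      = vdm 0 (a + b) * (if \<alpha> = \<beta> then of_int (sgn_hat b \<beta>) else 0)"
    by (simp add: atLeast0LessThan)
qed

lemma act_Dp_top: "w permutes {..<a + b} \<Longrightarrow> act w (Dp 0 (a + b) f) = Dp 0 (a + b) f"
  by (rule act_Dp) (simp add: atLeast0LessThan)

text \<open>The polynomial \<open>g\<close> produced by the splitter is symmetric in all variables,
  so it passes every operator and leaves a single value given by
  \<open>Dp_schur_schur_hat\<close>.\<close>

lemma lambda_sigma_op:
  assumes \<alpha>: "\<alpha> \<in> Parts a b" and \<beta>: "\<beta> \<in> Parts a b"
  shows "Eop 0 (a + b) (E1 (schur_hat a b \<beta> * E2 (schur \<alpha> * E1 (E2 (delta 0 a * (delta a b * Dp 0 (a + b) f))))))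
    = (if \<alpha> = \<beta> then of_int (sgn_hat b \<beta>) else 0) * Eop 0 (a + b) f"
proof -
  define g where "g = Dp 0 (a + b) f"
  have g: "act w g = g" if "w permutes {..<a + b}" for w
    unfolding g_def by (rule act_Dp_top [OF that])
  have "E2 (schur \<alpha> * E1 (E2 (delta 0 a * (delta a b * g)))) = E2 ((schur \<alpha> * delta 0 a * g) * delta a b)"
    using E1E2_delta [OF act_sub [OF g]] by (simp add: mult_ac)
  also have "\<dots> = (schur \<alpha> * delta 0 a * g) * E2 (delta a b)"
    by (rule Eop_sym_mult) (simp only: act_simps act_high(1) act_high(2) [OF _ \<alpha>] act_sub(2) [OF g])
  finally have "E1 (schur_hat a b \<beta> * E2 (schur \<alpha> * E1 (E2 (delta 0 a * (delta a b * g)))))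
      = E1 ((schur_hat a b \<beta> * schur \<alpha> * g * delta a b) * delta 0 a)"
    by (simp add: mult_ac)
  also have "\<dots> = (schur_hat a b \<beta> * schur \<alpha> * g * delta a b) * E1 (delta 0 a)"
    by (rule Eop_sym_mult_0) (simp only: act_simps act_low act_schur [OF \<alpha>] act_sub(1) [OF g])
  finally have "Eop 0 (a + b) (E1 (schur_hat a b \<beta> * E2 (schur \<alpha> * E1 (E2 (delta 0 a * (delta a b * g))))))
      = Eop 0 (a + b) (g * (delta 0 a * schur \<alpha> * (delta a b * schur_hat a b \<beta>)))"
    by (simp add: mult_ac)
  also have "\<dots> = g * Eop 0 (a + b) (delta 0 a * schur \<alpha> * (delta a b * schur_hat a b \<beta>))"
    by (rule Eop_sym_mult_0) (rule g)
  finally show ?thesis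
    unfolding Eop_def [of 0 "a + b"] Dp_schur_schur_hat [OF \<alpha> \<beta>] g_def by (simp add: mult_ac)
qed

text \<open>The full divided difference absorbs the idempotents to its right, so the summand for
  \<alpha> reduces to the staircases times
  \<open>schur \<alpha> * Dp 0 (a + b) (schur_hat a b \<alpha> * f)\<close>. The signed sum of these
  is evaluated by \<open>sum_schur_Dp\<close>.\<close>

lemma sigma_lambda_op:
  "(\<Sum>\<alpha>\<in>Parts a b. of_int (sgn_hat b \<alpha>) * (schur \<alpha> * E1 (E2 (delta 0 a * (delta a b *
      Dp 0 (a + b) (Eop 0 (a + b) (E1 (schur_hat a b \<alpha> * E2 f))))))))
    = E1 (E2 f)"
proof -
  have *: "schur \<alpha> * E1 (E2 (delta 0 a * (delta a b *
      Dp 0 (a + b) (Eop 0 (a + b) (E1 (schur_hat a b \<alpha> * E2 f))))))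
    = delta 0 a * delta a b * (schur \<alpha> * Dp 0 (a + b) (schur_hat a b \<alpha> * f))" if \<alpha>: "\<alpha> \<in> Parts a b" for \<alpha>
  proof -
    have "Dp 0 (a + b) (Eop 0 (a + b) (E1 (schur_hat a b \<alpha> * E2 f))) = Dp 0 (a + b) (schur_hat a b \<alpha> * E2 f)"
      unfolding Eop_def [of 0] by (simp add: Dp_delta_Dp)
    also have "\<dots> = Dp 0 (a + b) (E2 (schur_hat a b \<alpha> * f))"
      by (subst Eop_sym_mult) (auto simp: act_schur_hat [OF \<alpha>])
    also have "\<dots> = Dp 0 (a + b) (schur_hat a b \<alpha> * f)"
      unfolding Eop_def by (simp add: Dp_delta_Dp)
    finally show ?thesis
      using E1E2_delta [OF act_sub [OF act_Dp_top], of "schur_hat a b \<alpha> * f"] by (simp add: mult_ac)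
  qed
  have "E1 (E2 f) = delta 0 a * Dp 0 a (delta a b * Dp a b f)" by (simp add: Eop_def)
  also have "Dp 0 a (delta a b * Dp a b f) = delta a b * Dp 0 a (Dp a b f)"
    by (rule Dp_sym_mult) (use st_permutes [of _ a 0] in \<open>simp add: act_low atLeast0LessThan\<close>)
  finally have "E1 (E2 f) = delta 0 a * delta a b * (\<Sum>\<alpha>\<in>Parts a b.
      of_int (sgn_hat b \<alpha>) * schur \<alpha> * Dp 0 (a + b) (schur_hat a b \<alpha> * f))"
    by (simp only: sum_schur_Dp) (simp add: mult.assoc)
  moreover have "(\<Sum>\<alpha>\<in>Parts a b. of_int (sgn_hat b \<alpha>) * (schur \<alpha> * E1 (E2 (delta 0 a * (delta a b *
      Dp 0 (a + b) (Eop 0 (a + b) (E1 (schur_hat a b \<alpha> * E2 f))))))))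
    = (\<Sum>\<alpha>\<in>Parts a b. of_int (sgn_hat b \<alpha>) *
        (delta 0 a * delta a b * (schur \<alpha> * Dp 0 (a + b) (schur_hat a b \<alpha> * f))))"
    by (rule sum.cong [OF HOL.refl]) (simp only: *)
  ultimately show ?thesis
    by (simp add: sum_distrib_left mult_ac)
qed

lemma Dp_Eop_top: "Dp 0 (a + b) (Eop 0 (a + b) f) = Dp 0 (a + b) f"
  "Dp 0 (a + b) (E1 f) = Dp 0 (a + b) f" "Dp 0 (a + b) (E2 f) = Dp 0 (a + b) f"
  by (simp_all add: Eop_def Dp_delta_Dp)

lemma E1E2_sigma_op:
  assumes \<alpha>: "\<alpha> \<in> Parts a b"
  shows "E1 (E2 (schur \<alpha> * E1 (E2 (delta 0 a * (delta a b * Dp 0 (a + b) f)))))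
    = schur \<alpha> * E1 (E2 (delta 0 a * (delta a b * Dp 0 (a + b) f)))"
proof -
  let ?g = "Dp 0 (a + b) f"
  have "E1 (E2 (delta 0 a * (delta a b * ?g))) = delta 0 a * delta a b * ?g"
    using E1E2_delta [OF act_sub [OF act_Dp_top], of f] by (simp add: mult_ac)
  moreover have "E1 (E2 (delta 0 a * delta a b * (schur \<alpha> * ?g))) = delta 0 a * delta a b * (schur \<alpha> * ?g)"
    by (rule E1E2_delta)
      (simp_all only: act_simps act_schur [OF \<alpha>] act_high(2) [OF _ \<alpha>] act_sub [OF act_Dp_top])
  ultimately show ?thesis by (simp add: mult_ac)
qed

lemma lambda_op_E1E2:
  assumes \<alpha>: "\<alpha> \<in> Parts a b"
  shows "Eop 0 (a + b) (E1 (schur_hat a b \<alpha> * E2 (E1 (E2 f)))) = Eop 0 (a + b) (E1 (schur_hat a b \<alpha> * E2 f))"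
proof -
  have "E2 (schur_hat a b \<alpha> * h) = schur_hat a b \<alpha> * E2 h" for h
    by (rule Eop_sym_mult) (rule act_schur_hat [OF \<alpha>])
  moreover have "E1 (schur_hat a b \<alpha> * h) = schur_hat a b \<alpha> * E1 h" for h
    by (rule Eop_sym_mult_0) (rule act_low)
  ultimately show ?thesis
    unfolding Eop_def [of 0 "a + b"] by (metis Dp_Eop_top(2,3))
qed

lemma Eop_Eop: "Eop k N (Eop k N f) = Eop k N f"
  by (simp add: Eop_def Dp_delta_Dp)

text \<open>The nested \<open>Dp 0 a (Dp a b f)\<close> shows its symmetry in the first block only.
  The expansion from \<open>sum_schur_Dp\<close> makes symmetry in the second block visible as well,
  and \<open>E1E2_delta\<close> applies.\<close>

lemma E1E2_idem: "E1 (E2 (E1 (E2 f))) = E1 (E2 f)"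
proof -
  have E1E2: "E1 (E2 f) = delta 0 a * delta a b * Dp 0 a (Dp a b f)" for f
  proof -
    have "Dp 0 a (delta a b * Dp a b f) = delta a b * Dp 0 a (Dp a b f)"
      by (rule Dp_sym_mult) (use st_permutes [of _ a 0] in \<open>simp add: act_low atLeast0LessThan\<close>)
    then show ?thesis by (simp add: Eop_def)
  qed
  have "Dp 0 a (Dp a b f) = (\<Sum>\<alpha>\<in>Parts a b.
      of_int (sgn_hat b \<alpha>) * schur \<alpha> * Dp 0 (a + b) (schur_hat a b \<alpha> * f))" (is "_ = ?g")
    by (simp only: sum_schur_Dp)
  moreover have "E1 (E2 (delta 0 a * delta a b * ?g)) = delta 0 a * delta a b * ?g"
    by (rule E1E2_delta) (simp_all add: act_schur act_high(2) act_sub [OF act_Dp_top])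
  ultimately show ?thesis by (simp only: E1E2)
qed

end

section \<open>The nilHecke algebra\<close>

text \<open>The unit is a parameter, so that the algebra may be a corner of a larger ring.\<close>

locale nilhecke =
  fixes N :: nat and u :: "'r::ring" and P :: "mpoly \<Rightarrow> 'r" and d :: "nat \<Rightarrow> 'r"
  assumes P_add: "P (p + q) = P p + P q"
    and P_mult: "P (p * q) = P p * P q"
    and P_1: "P 1 = u"
    and d_u: "Suc i < N \<Longrightarrow> d i * u = d i"
    and u_d: "Suc i < N \<Longrightarrow> u * d i = d i"
    and d_nil: "Suc i < N \<Longrightarrow> d i * d i = 0"
    and d_com: "Suc i < j \<Longrightarrow> Suc j < N \<Longrightarrow> d i * d j = d j * d i"
    and d_braid: "Suc (Suc i) < N \<Longrightarrow> d i * (d (Suc i) * d i) = d (Suc i) * (d i * d (Suc i))"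
    and d_X: "Suc i < N \<Longrightarrow> d i * P (X i) = P (X (Suc i)) * d i + u"
    and d_X': "Suc i < N \<Longrightarrow> d i * P (X (Suc i)) = P (X i) * d i - u"
    and d_X_other: "Suc i < N \<Longrightarrow> j \<noteq> i \<Longrightarrow> j \<noteq> Suc i \<Longrightarrow> d i * P (X j) = P (X j) * d i"
begin

lemma P_0 [simp]: "P 0 = 0"
  using P_add [of 0 0] by simp

lemma P_diff: "P (p - q) = P p - P q"
  using P_add [of "p - q" q] by simp

lemma P_minus: "P (- p) = - P p"
  using P_diff [of 0 p] by simp

lemma u_P [simp]: "u * P p = P p" and P_u [simp]: "P p * u = P p"
  using P_mult [of 1 p] P_mult [of p 1] by (simp_all add: P_1)

lemma u_u [simp]: "u * u = u"
  using u_P [of 1] by (simp add: P_1)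

text \<open>The relations for the variables extend to all polynomials, since both sides obey the
  same twisted Leibniz rule.\<close>

lemma d_P: "Suc i < N \<Longrightarrow> d i * P f = P (act (st i) f) * d i + P (dd i f)"
proof (induction f rule: mpoly_induct)
  case (var j)
  then show ?case
    by (cases "j = i \<or> j = Suc i") (auto simp: d_X d_X' d_X_other P_1 P_minus)
next
  case (mult p q)
  have "d i * P (p * q) = (d i * P p) * P q" by (simp add: P_mult mult.assoc)
  also have "\<dots> = P (act (st i) p) * (d i * P q) + P (dd i p) * P q"
    using mult by (simp add: distrib_right mult.assoc)
  also have "\<dots> = P (act (st i) (p * q)) * d i + P (dd i (p * q))"
    using mult by (simp add: distrib_left mult.assoc [symmetric] P_mult P_add dd_mult)
  finally show ?case .
qed (auto simp: P_1 d_u u_d P_diff dd_diff algebra_simps)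

definition dprod :: "nat list \<Rightarrow> 'r" where
  "dprod js = foldr (\<lambda>i z. d i * z) js u"

lemma dprod_simps [simp]: "dprod [] = u" "dprod (i # js) = d i * dprod js"
  by (simp_all add: dprod_def)

lemma u_dprod: "(\<And>i. i \<in> set js \<Longrightarrow> Suc i < N) \<Longrightarrow> u * dprod js = dprod js"
  by (cases js) (simp_all add: mult.assoc [symmetric] u_d)

lemma dprod_u: "(\<And>i. i \<in> set js \<Longrightarrow> Suc i < N) \<Longrightarrow> dprod js * u = dprod js"
  by (induction js) (simp_all add: mult.assoc)

lemma dprod_append: "(\<And>i. i \<in> set ks \<Longrightarrow> Suc i < N) \<Longrightarrow> dprod (js @ ks) = dprod js * dprod ks"
  by (induction js) (simp_all add: u_dprod mult.assoc)

abbreviation "DN M \<equiv> dprod (w0 M)"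

lemma d_DN: "Suc i < M \<Longrightarrow> M \<le> N \<Longrightarrow> d i * DN M = 0"
  unfolding dprod_def
proof (rule w0_kill [where N = M])
  assume M: "M \<le> N"
  show "d i * (d j * z) = d j * (d i * z)" if "Suc i < j" "Suc j < M" for i j z
    unfolding mult.assoc [symmetric] using d_com [of i j] that M by simp
  show "d i * (d (Suc i) * (d i * z)) = d (Suc i) * (d i * (d (Suc i) * z))" if "Suc (Suc i) < M" for i z
    using arg_cong [OF d_braid [of i], of "\<lambda>y. y * z"] that M by (simp add: mult.assoc)
qed (simp_all add: mult.assoc [symmetric] d_nil)

text \<open>The elements \<open>P f * DN N\<close> stand in for the polynomial representation. Over
  scalars of positive characteristic one \<open>z\<close> can admit several \<open>\<phi>\<close>;
  the relevant direction is that \<open>\<phi>\<close> determines \<open>z\<close>, and the clause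
  \<open>z * u = z\<close> confines \<open>z\<close> to the corner in which this holds.\<close>

definition rep :: "'r \<Rightarrow> (mpoly \<Rightarrow> mpoly) \<Rightarrow> bool" where
  "rep z \<phi> \<longleftrightarrow> z * u = z \<and> (\<forall>f. z * (P f * DN N) = P (\<phi> f) * DN N)"

lemma rep_mult: "rep z \<phi> \<Longrightarrow> rep z' \<psi> \<Longrightarrow> rep (z * z') (\<lambda>f. \<phi> (\<psi> f))"
  by (simp add: rep_def mult.assoc)

lemma rep_add: "rep z \<phi> \<Longrightarrow> rep z' \<psi> \<Longrightarrow> rep (z + z') (\<lambda>f. \<phi> f + \<psi> f)"
  by (simp add: rep_def distrib_right P_add)

lemma rep_0: "rep 0 (\<lambda>f. 0)"
  by (simp add: rep_def)

lemma rep_P: "rep (P p) (\<lambda>f. p * f)"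
  by (simp add: rep_def P_mult mult.assoc)

lemma rep_u: "rep u (\<lambda>f. f)"
  by (simp add: rep_def mult.assoc [symmetric])

text \<open>As \<open>d i\<close> kills \<open>DN N\<close>, only the derivative term of
  \<open>d_P\<close> survives.\<close>

lemma rep_d:
  assumes "Suc i < N"
  shows "rep (d i) (dd i)"
proof -
  have "d i * (P f * DN N) = P (act (st i) f) * (d i * DN N) + P (dd i f) * DN N" for f
    using assms by (simp add: mult.assoc [symmetric] d_P distrib_right)
  then show ?thesis using assms by (simp add: rep_def d_u d_DN)
qed

lemma rep_dprod:
  "(\<And>i. i \<in> set js \<Longrightarrow> Suc (k + i) < N) \<Longrightarrow> rep (dprod (map ((+) k) js)) (\<lambda>f. foldr (\<lambda>i. dd (k + i)) js f)"
  by (induction js) (simp_all add: rep_u [folded id_def] rep_mult [folded comp_def] rep_d)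

lemma rep_Dp: "k + M \<le> N \<Longrightarrow> rep (dprod (map ((+) k) (w0 M))) (Dp k M)"
  unfolding Dp_def by (rule rep_dprod) (auto dest!: w0_bound)

inductive D_ideal :: "'r \<Rightarrow> bool" where
  gen: "D_ideal (P f * DN N * q)"
| add: "D_ideal z \<Longrightarrow> D_ideal z' \<Longrightarrow> D_ideal (z + z')"

lemma D_ideal_P: "D_ideal z \<Longrightarrow> D_ideal (P f * z)"
proof (induction rule: D_ideal.induct)
  case (gen g q)
  have "P f * (P g * DN N * q) = P (f * g) * DN N * q" by (simp add: P_mult mult.assoc)
  then show ?case by (simp only: D_ideal.gen)
qed (simp add: distrib_left D_ideal.add)

lemma D_ideal_right: "D_ideal z \<Longrightarrow> D_ideal (z * q)"
proof (induction rule: D_ideal.induct)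
  case (gen g r)
  show ?case using D_ideal.gen [of g "r * q"] by (simp add: mult.assoc)
qed (simp add: distrib_right D_ideal.add)

lemma D_ideal_diff:
  assumes "D_ideal z" "D_ideal z'"
  shows "D_ideal (z - z')"
proof -
  have "u * z' = z'" using assms(2)
    by (induction rule: D_ideal.induct) (simp_all add: distrib_left mult.assoc [symmetric])
  then have "P (- 1) * z' = - z'" by (simp add: P_minus P_1)
  with D_ideal.add [OF assms(1) D_ideal_P [OF assms(2), of "- 1"]] show ?thesis by simp
qed

text \<open>For \<open>w k = d\<^sub>k \<cdots> d\<^bsub>M-1\<^esub> D\<^sub>M\<close> one has \<open>x\<^sub>k w k - w k x\<^sub>M = w (k + 1)\<close>.\<close>

lemma D_ideal_DN_Suc:
  assumes M: "Suc M \<le> N" and ideal: "D_ideal (DN (Suc M))"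
  shows "D_ideal (DN M)"
proof -
  define w where "w k = dprod [k..<M] * DN M" for k
  have uD: "u * DN M = DN M" by (rule u_dprod) (use M in \<open>auto dest: w0_bound\<close>)
  have wM: "w M = DN M" by (simp add: w_def uD)
  have step: "w k = d k * w (Suc k)" if "k < M" for k
    using that by (simp add: w_def upt_conv_Cons mult.assoc)
  \<comment> \<open>All indices in the remaining product exceed \<open>Suc k\<close>, so
    \<open>d k\<close> passes through and kills \<open>DN M\<close>. This removes the surplus term
    that the induction hypothesis contributes in \<open>main\<close>.\<close>
  have kill: "d k * w (Suc (Suc k)) = 0" if "Suc k < M" for k
  proof -
    have "d k * (dprod js * DN M) = dprod js * (d k * DN M)"
      if "\<And>j. j \<in> set js \<Longrightarrow> Suc k < j \<and> Suc j < N" for js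
      using that
    proof (induction js)
      case (Cons j js)
      have "d k * (dprod (j # js) * DN M) = (d k * d j) * (dprod js * DN M)" by (simp add: mult.assoc)
      also have "\<dots> = d j * (d k * (dprod js * DN M))" using Cons.prems [of j] by (simp add: d_com mult.assoc)
      finally show ?case using Cons by (simp add: mult.assoc)
    next
      case Nil
      show ?case using \<open>Suc k < M\<close> M by (simp add: mult.assoc [symmetric] u_d d_u)
    qed
    from this [of "[Suc (Suc k)..<M]"] show ?thesis
      using that M d_DN [of k M] by (simp add: w_def)
  qed
  have com: "P (X M) * dprod js = dprod js * P (X M)" if "\<And>i. i \<in> set js \<Longrightarrow> Suc i < M" for js
    using that
  proof (induction js)
    case (Cons i js)
    have "P (X M) * dprod (i # js) = (P (X M) * d i) * dprod js" by (simp add: mult.assoc)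
    also have "\<dots> = d i * (P (X M) * dprod js)"
      using Cons.prems [of i] M by (simp add: d_X_other [symmetric] mult.assoc)
    finally show ?case using Cons by (simp add: mult.assoc)
  qed simp
  have main: "P (X k) * w k = w k * P (X M) + (if k < M then w (Suc k) else 0)" if "k \<le> M" for k
    using that
  proof (induction k rule: inc_induct)
    case base
    show ?case unfolding wM by (simp add: com w0_bound)
  next
    case (step k)
    have uw: "u * w (Suc k) = w (Suc k)"
      unfolding w_def by (subst mult.assoc [symmetric], subst u_dprod) (use M in auto)
    have "P (X k) * w k = (P (X k) * d k) * w (Suc k)"
      using step by (simp add: \<open>\<And>k. k < M \<Longrightarrow> w k = d k * w (Suc k)\<close> mult.assoc)
    also have "P (X k) * d k = d k * P (X (Suc k)) + u"
      using d_X' [of k] step M by simp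
    also have "(d k * P (X (Suc k)) + u) * w (Suc k) = d k * (P (X (Suc k)) * w (Suc k)) + w (Suc k)"
      by (simp add: distrib_right mult.assoc uw)
    also have "\<dots> = d k * (w (Suc k) * P (X M)) + d k * (if Suc k < M then w (Suc (Suc k)) else 0) + w (Suc k)"
      unfolding step.IH by (simp add: distrib_left)
    also have "d k * (if Suc k < M then w (Suc (Suc k)) else 0) = 0"
      using kill [of k] by simp
    finally show ?case
      using step \<open>\<And>k. k < M \<Longrightarrow> w k = d k * w (Suc k)\<close> [of k] by (simp add: mult.assoc)
  qed
  have "D_ideal (w k)" if "k \<le> M" for k
    using that
  proof (induction k)
    case 0
    have "w 0 = DN (Suc M)" unfolding w_def w0_Suc
      by (rule dprod_append [symmetric]) (use M in \<open>auto dest: w0_bound\<close>)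
    with ideal show ?case by simp
  next
    case (Suc k)
    then have "w (Suc k) = P (X k) * w k - w k * P (X M)" using main [of k] by simp
    with Suc show ?case by (simp add: D_ideal_diff D_ideal_P D_ideal_right)
  qed
  from this [of M] show ?thesis by (simp add: wM)
qed

text \<open>Descent from \<open>DN N\<close> to \<open>DN 0\<close>, which is the empty product
  \<open>u\<close>.\<close>

lemma D_ideal_u: "D_ideal u"
proof -
  have "D_ideal (DN N)"
  proof -
    have "P 1 * DN N * u = DN N"
      by (simp add: P_1 u_dprod dprod_u w0_bound)
    then show ?thesis using D_ideal.gen [of 1 u] by simp
  qed
  moreover have "D_ideal (DN N) \<Longrightarrow> k \<le> N \<Longrightarrow> D_ideal (DN k)" for k
    by (rule inc_induct [of k N "\<lambda>k. D_ideal (DN k)"]) (auto intro: D_ideal_DN_Suc)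
  ultimately have "D_ideal (DN 0)" by blast
  then show ?thesis by simp
qed

text \<open>Faithfulness of the polynomial representation: \<open>u = \<Sum> p\<^sub>i D q\<^sub>i\<close>, and \<open>z p D = \<phi>(p) D\<close>.\<close>

lemma rep_unique:
  assumes "rep z \<phi>" "rep z' \<phi>"
  shows "z = z'"
proof -
  have "z * y = z' * y" if "D_ideal y" for y
    using that
  proof (induction rule: D_ideal.induct)
    case (gen f q)
    have "z * (P f * DN N) * q = z' * (P f * DN N) * q" using assms by (simp add: rep_def)
    then show ?case by (simp add: mult.assoc)
  qed (simp add: distrib_left)
  from this [OF D_ideal_u] show ?thesis using assms by (simp add: rep_def)
qed

end

section \<open>Morphism spaces of \<open>\<H>\<close>\<close>

lift_definition hwf :: "'k::{comm_ring,monoid_mult} hmor \<Rightarrow> bool" is wf_tm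
  by (simp add: tm_eq_type)

lift_definition hwt :: "'k::{comm_ring,monoid_mult} hmor \<Rightarrow> int" is wt
  by (simp add: tm_eq_type)

lift_definition hsrc :: "'k::{comm_ring,monoid_mult} hmor \<Rightarrow> word" is src
  by (simp add: tm_eq_type)

lift_definition htgt :: "'k::{comm_ring,monoid_mult} hmor \<Rightarrow> word" is tgt
  by (simp add: tm_eq_type)

text \<open>The type \<open>hmor\<close> contains classes of ill-formed expressions and of
  expressions with all sources and targets, so every algebraic law is stated relative to these
  sets.\<close>

definition Hom :: "int \<Rightarrow> word \<Rightarrow> word \<Rightarrow> 'k::{comm_ring,monoid_mult} hmor set" where
  "Hom n V W = {f. hwf f \<and> hwt f = n \<and> hsrc f = V \<and> htgt f = W}"

lemma
  shows hzero_Hom: "wsh V = wsh W \<Longrightarrow> hzero n V W \<in> Hom n V W"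
    and hid_Hom: "hid n W \<in> Hom n W W"
    and hdot_Hom: "hdot n \<in> Hom n [\<E>] [\<E>]"
    and hcross_Hom: "hcross n \<in> Hom n [\<E>, \<E>] [\<E>, \<E>]"
    and hadd_Hom: "f \<in> Hom n V W \<Longrightarrow> g \<in> Hom n V W \<Longrightarrow> hadd f g \<in> Hom n V W"
    and hscale_Hom: "f \<in> Hom n V W \<Longrightarrow> hscale c f \<in> Hom n V W"
    and vc_Hom: "f \<in> Hom n V' W \<Longrightarrow> g \<in> Hom n V V' \<Longrightarrow> f \<bullet> g \<in> Hom n V W"
    and hc_Hom: "f \<in> Hom (n + wsh V') V W \<Longrightarrow> g \<in> Hom n V' W' \<Longrightarrow> f \<diamondop> g \<in> Hom n (V @ V') (W @ W')"
  unfolding Hom_def by (simp_all, (transfer, simp)+)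

lemma
  shows hadd_commute: "f \<in> Hom n V W \<Longrightarrow> g \<in> Hom n V W \<Longrightarrow> hadd f g = hadd g f"
    and hadd_assoc: "f \<in> Hom n V W \<Longrightarrow> g \<in> Hom n V W \<Longrightarrow> h \<in> Hom n V W \<Longrightarrow>
      hadd (hadd f g) h = hadd f (hadd g h)"
    and hadd_zero: "wsh V = wsh W \<Longrightarrow> f \<in> Hom n V W \<Longrightarrow> hadd (hzero n V W) f = f"
    and hadd_minus: "wsh V = wsh W \<Longrightarrow> f \<in> Hom n V W \<Longrightarrow> hadd f (hscale (- 1) f) = hzero n V W"
    and hscale_add: "f \<in> Hom n V W \<Longrightarrow> g \<in> Hom n V W \<Longrightarrow> hscale c (hadd f g) = hadd (hscale c f) (hscale c g)"
    and hscale_plus: "f \<in> Hom n V W \<Longrightarrow> hscale (c + d) f = hadd (hscale c f) (hscale d f)"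
    and hscale_mult: "f \<in> Hom n V W \<Longrightarrow> hscale (c * d) f = hscale c (hscale d f)"
    and hscale_1: "f \<in> Hom n V W \<Longrightarrow> hscale 1 f = f"
    and vc_add_left: "f \<in> Hom n V' W \<Longrightarrow> f' \<in> Hom n V' W \<Longrightarrow> g \<in> Hom n V V' \<Longrightarrow>
      hadd f f' \<bullet> g = hadd (f \<bullet> g) (f' \<bullet> g)"
    and vc_add_right: "f \<in> Hom n V' W \<Longrightarrow> g \<in> Hom n V V' \<Longrightarrow> g' \<in> Hom n V V' \<Longrightarrow>
      f \<bullet> hadd g g' = hadd (f \<bullet> g) (f \<bullet> g')"
    and vc_assoc: "f \<in> Hom n V' W \<Longrightarrow> g \<in> Hom n U V' \<Longrightarrow> h \<in> Hom n V U \<Longrightarrow> (f \<bullet> g) \<bullet> h = f \<bullet> g \<bullet> h"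
    and vc_id_left: "f \<in> Hom n V W \<Longrightarrow> hid n W \<bullet> f = f"
    and vc_id_right: "f \<in> Hom n V W \<Longrightarrow> f \<bullet> hid n V = f"
    and hc_add_left: "f \<in> Hom (n + wsh V') V W \<Longrightarrow> f' \<in> Hom (n + wsh V') V W \<Longrightarrow> g \<in> Hom n V' W' \<Longrightarrow>
      hadd f f' \<diamondop> g = hadd (f \<diamondop> g) (f' \<diamondop> g)"
    and hc_add_right: "f \<in> Hom (n + wsh V') V W \<Longrightarrow> g \<in> Hom n V' W' \<Longrightarrow> g' \<in> Hom n V' W' \<Longrightarrow>
      f \<diamondop> hadd g g' = hadd (f \<diamondop> g) (f \<diamondop> g')"
    and hc_scale_left: "f \<in> Hom (n + wsh V') V W \<Longrightarrow> g \<in> Hom n V' W' \<Longrightarrow> hscale c f \<diamondop> g = hscale c (f \<diamondop> g)"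
    and hc_scale_right: "f \<in> Hom (n + wsh V') V W \<Longrightarrow> g \<in> Hom n V' W' \<Longrightarrow> f \<diamondop> hscale c g = hscale c (f \<diamondop> g)"
  unfolding Hom_def
  by (simp_all, (transfer, auto intro!: tm_eq.ax two_cat_ax.intros simp: parallel_def)+)

lemma hc_nil_left: "f \<in> Hom n V W \<Longrightarrow> m = n + wsh V \<Longrightarrow> hid m [] \<diamondop> f = f"
  unfolding Hom_def
  by (simp, transfer) (auto intro!: tm_eq.ax two_cat_ax.intros simp: parallel_def)

lemma wsh_append: "wsh (V @ W) = wsh V + wsh W"
  by (simp add: wsh_def)

lemma hc_assoc: "f \<in> Hom (n + wsh V'' + wsh V') V W \<Longrightarrow> g \<in> Hom (n + wsh V'') V' W' \<Longrightarrow> h \<in> Hom n V'' W'' \<Longrightarrow>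
    (f \<diamondop> g) \<diamondop> h = f \<diamondop> g \<diamondop> h"
  unfolding Hom_def
  by (simp, transfer) (auto intro!: tm_eq.ax two_cat_ax.intros simp: parallel_def wsh_append)

lemma hc_id: "m = n + wsh V \<Longrightarrow> hid m W \<diamondop> hid n V = hid n (W @ V)"
  by transfer (auto intro!: tm_eq.ax two_cat_ax.intros simp: parallel_def)

lemma interchange:
  "f \<in> Hom (n + wsh U') V W \<Longrightarrow> f' \<in> Hom (n + wsh U') U V \<Longrightarrow> g \<in> Hom n V' W' \<Longrightarrow> g' \<in> Hom n U' V' \<Longrightarrow>
    wsh U' = wsh V' \<Longrightarrow> (f \<diamondop> g) \<bullet> (f' \<diamondop> g') = (f \<bullet> f') \<diamondop> (g \<bullet> g')"
  unfolding Hom_def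
  by (simp, transfer) (auto intro!: tm_eq.ax two_cat_ax.intros simp: parallel_def)

lemma wsh_Ew [simp]: "wsh (Ew k) = 2 * int k"
proof -
  have "count_list (Ew k) \<E> = k" "count_list (Ew k) \<F> = 0"
    by (induction k) simp_all
  then show ?thesis by (simp add: wsh_def)
qed

lemma cross_cross: "hcross n \<bullet> hcross n = hzero n [\<E>, \<E>] [\<E>, \<E>]"
  by transfer (rule tm_eq.sl2 [OF sl2_rel.nil_square sl2_rel_parallel [OF sl2_rel.nil_square]])

lemma cross_braid:
  "(hcross (n + 2) \<diamondop> hid n [\<E>]) \<bullet> (hid (n + 4) [\<E>] \<diamondop> hcross n) \<bullet> (hcross (n + 2) \<diamondop> hid n [\<E>])
    = (hid (n + 4) [\<E>] \<diamondop> hcross n) \<bullet> (hcross (n + 2) \<diamondop> hid n [\<E>]) \<bullet> (hid (n + 4) [\<E>] \<diamondop> hcross n)"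
  by transfer
    (use tm_eq.sl2 [OF sl2_rel.nil_braid sl2_rel_parallel [OF sl2_rel.nil_braid]] in \<open>simp add: wsh_def\<close>)

lemma cross_dot:
  "hid n [\<E>, \<E>] = hadd (hcross n \<bullet> (hdot (n + 2) \<diamondop> hid n [\<E>]))
    (hscale (- 1) ((hid (n + 2) [\<E>] \<diamondop> hdot n) \<bullet> hcross n))"
  by transfer
    (use tm_eq.sl2 [OF sl2_rel.nil_dot1 sl2_rel_parallel [OF sl2_rel.nil_dot1]] in \<open>simp add: wsh_def\<close>)

lemma cross_dot':
  "hid n [\<E>, \<E>] = hadd ((hdot (n + 2) \<diamondop> hid n [\<E>]) \<bullet> hcross n)
    (hscale (- 1) (hcross n \<bullet> (hid (n + 2) [\<E>] \<diamondop> hdot n)))"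
  by transfer
    (use tm_eq.sl2 [OF sl2_rel.nil_dot2 sl2_rel_parallel [OF sl2_rel.nil_dot2]] in \<open>simp add: wsh_def\<close>)

section \<open>Endomorphisms of powers of \<open>\<E>\<close>\<close>

abbreviation EndE :: "int \<Rightarrow> nat \<Rightarrow> 'k::{comm_ring,monoid_mult} hmor set" where
  "EndE n N \<equiv> Hom n (Ew N) (Ew N)"

text \<open>The diagram \<open>z\<close> on \<open>L\<close> strands, with \<open>i\<close> strands
  to its left and \<open>r\<close> to its right. Dots and crossings take this common form, so
  commutation at a distance is proved once for both.\<close>

definition place :: "int \<Rightarrow> nat \<Rightarrow> nat \<Rightarrow> nat \<Rightarrow> 'k::{comm_ring,monoid_mult} hmor \<Rightarrow> 'k hmor" where
  "place n i L r z = hid (n + 2 * int (L + r)) (Ew i) \<diamondop> z \<diamondop> hid n (Ew r)"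

lemma EndE_hc: "z \<in> EndE (n + 2 * int b) a \<Longrightarrow> z' \<in> EndE n b \<Longrightarrow> z \<diamondop> z' \<in> EndE n (a + b)"
  using hc_Hom [of z n "Ew b" "Ew a" "Ew a" z' "Ew b"] by (simp add: replicate_add)

lemma EndE_place: "z \<in> EndE (n + 2 * int r) L \<Longrightarrow> place n i L r z \<in> EndE n (i + L + r)"
  unfolding place_def using EndE_hc [OF hid_Hom EndE_hc [OF _ hid_Hom]] by (simp add: add.assoc)

lemma place_mult:
  assumes "z \<in> EndE (n + 2 * int r) L" "z' \<in> EndE (n + 2 * int r) L"
  shows "place n i L r z \<bullet> place n i L r z' = place n i L r (z \<bullet> z')"
proof -
  note h = EndE_hc [OF _ hid_Hom]
  have "place n i L r z \<bullet> place n i L r z' = (hid (n + 2 * int (L + r)) (Ew i) \<bullet> hid (n + 2 * int (L + r)) (Ew i))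
      \<diamondop> ((z \<diamondop> hid n (Ew r)) \<bullet> (z' \<diamondop> hid n (Ew r)))"
    unfolding place_def
    by (rule interchange [of _ _ "Ew (L + r)" "Ew i" "Ew i" _ "Ew i" _ "Ew (L + r)" "Ew (L + r)"])
      (use assms in \<open>auto intro: hid_Hom h\<close>)
  also have "(z \<diamondop> hid n (Ew r)) \<bullet> (z' \<diamondop> hid n (Ew r)) = (z \<bullet> z') \<diamondop> (hid n (Ew r) \<bullet> hid n (Ew r))"
    by (rule interchange [of _ _ "Ew r" "Ew L" "Ew L" _ "Ew L" _ "Ew r" "Ew r"])
      (use assms in \<open>auto intro: hid_Hom\<close>)
  finally show ?thesis by (simp add: place_def vc_id_left [OF hid_Hom])
qed

lemma place_add:
  assumes "z \<in> EndE (n + 2 * int r) L" "z' \<in> EndE (n + 2 * int r) L"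
  shows "place n i L r (hadd z z') = hadd (place n i L r z) (place n i L r z')"
  unfolding place_def
  using assms hc_add_left [of z n "Ew r" "Ew L" "Ew L" z' "hid n (Ew r)" "Ew r"]
    hc_add_right [of "hid (n + 2 * int (L + r)) (Ew i)" n "Ew (L + r)" "Ew i" "Ew i"
      "z \<diamondop> hid n (Ew r)" "Ew (L + r)" "z' \<diamondop> hid n (Ew r)"]
  by (simp add: hid_Hom EndE_hc)

lemma place_scale:
  assumes "z \<in> EndE (n + 2 * int r) L"
  shows "place n i L r (hscale c z) = hscale c (place n i L r z)"
  unfolding place_def
  using assms hc_scale_left [of z n "Ew r" "Ew L" "Ew L" "hid n (Ew r)" "Ew r" c]
    hc_scale_right [of "hid (n + 2 * int (L + r)) (Ew i)" n "Ew (L + r)" "Ew i" "Ew i"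
      "z \<diamondop> hid n (Ew r)" "Ew (L + r)" c]
  by (simp add: hid_Hom EndE_hc)

lemma hid_Ew: "m = n + 2 * int b \<Longrightarrow> hid m (Ew a) \<diamondop> hid n (Ew b) = hid n (Ew (a + b))"
  by (simp add: hc_id replicate_add)

lemma place_id: "place n i L r (hid (n + 2 * int r) (Ew L)) = hid n (Ew (i + L + r))"
  by (simp add: place_def hid_Ew add.assoc)

lemma hc_assoc_E:
  assumes "f \<in> EndE (n + 2 * int (b + c)) a" "g \<in> EndE (n + 2 * int c) b" "h \<in> EndE n c"
  shows "(f \<diamondop> g) \<diamondop> h = f \<diamondop> g \<diamondop> h"
  by (rule hc_assoc) (use assms in \<open>auto simp: algebra_simps\<close>)

text \<open>Together with \<open>place_nest_right\<close> this widens the window around a dot or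
  crossing to the two or three strands on which the defining relations are stated.\<close>

lemma place_nest_left:
  assumes "z \<in> EndE (n + 2 * int r) l" "m = n + 2 * int (l + r)"
  shows "place n i (j + l) r (hid m (Ew j) \<diamondop> z) = place n (i + j) l r z"
proof -
  have "(hid m (Ew j) \<diamondop> z) \<diamondop> hid n (Ew r) = hid m (Ew j) \<diamondop> z \<diamondop> hid n (Ew r)"
    by (rule hc_assoc_E) (use assms in \<open>auto intro: hid_Hom\<close>)
  moreover have "hid (n + 2 * int (j + l + r)) (Ew i) \<diamondop> hid m (Ew j) \<diamondop> z \<diamondop> hid n (Ew r)
      = (hid (n + 2 * int (j + l + r)) (Ew i) \<diamondop> hid m (Ew j)) \<diamondop> z \<diamondop> hid n (Ew r)"
    by (rule hc_assoc_E [symmetric, where c = "l + r"])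
      (use assms in \<open>auto intro!: hid_Hom EndE_hc simp: algebra_simps\<close>)
  ultimately show ?thesis using assms by (simp add: place_def hid_Ew algebra_simps)
qed

lemma place_nest_right:
  assumes "z \<in> EndE (n + 2 * int (k + r)) l" "m = n + 2 * int r"
  shows "place n i (l + k) r (z \<diamondop> hid m (Ew k)) = place n i l (k + r) z"
proof -
  have "(z \<diamondop> hid m (Ew k)) \<diamondop> hid n (Ew r) = z \<diamondop> hid m (Ew k) \<diamondop> hid n (Ew r)"
    by (rule hc_assoc_E) (use assms in \<open>auto intro: hid_Hom\<close>)
  then show ?thesis using assms by (simp add: place_def hid_Ew algebra_simps)
qed

lemma hc_commute:
  assumes "f \<in> EndE (n + 2 * int b) a" "g \<in> EndE n b"
  shows "(f \<diamondop> hid n (Ew b)) \<bullet> (hid (n + 2 * int b) (Ew a) \<diamondop> g) = f \<diamondop> g"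
    "(hid (n + 2 * int b) (Ew a) \<diamondop> g) \<bullet> (f \<diamondop> hid n (Ew b)) = f \<diamondop> g"
  using interchange [of f n "Ew b" "Ew a" "Ew a" "hid (n + 2 * int b) (Ew a)" "Ew a" "hid n (Ew b)" "Ew b" "Ew b" g]
    interchange [of "hid (n + 2 * int b) (Ew a)" n "Ew b" "Ew a" "Ew a" f "Ew a" g "Ew b" "Ew b" "hid n (Ew b)"] assms
  by (simp_all add: hid_Hom vc_id_left [OF assms(1)] vc_id_right [OF assms(1)] vc_id_left [OF assms(2)] vc_id_right [OF assms(2)])

text \<open>Cutting between the two windows puts the diagrams into different horizontal factors, and
  the interchange law makes both vertical orders equal to the same horizontal composite.\<close>

lemma place_far:
  assumes z: "z \<in> EndE (n + 2 * int (g + L' + r')) L" and z': "z' \<in> EndE (n + 2 * int r') L'"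
  shows "place n i L (g + L' + r') z \<bullet> place n (i + L + g) L' r' z' = place n (i + L + g) L' r' z' \<bullet> place n i L (g + L' + r') z"
proof -
  let ?b = "g + L' + r'" and ?a = "i + L"
  have 1: "place n i L ?b z = place n 0 ?a ?b (hid (n + 2 * int (L + ?b)) (Ew i) \<diamondop> z)"
    using place_nest_left [OF z HOL.refl, of 0 i] by simp
  have 2: "place n (?a + g) L' r' z' = hid (n + 2 * int ?b) (Ew ?a) \<diamondop> place n g L' r' z'"
  proof -
    have "hid (n + 2 * int ?b) (Ew ?a) \<diamondop> place n g L' r' z'
        = (hid (n + 2 * int ?b) (Ew ?a) \<diamondop> hid (n + 2 * int (L' + r')) (Ew g)) \<diamondop> z' \<diamondop> hid n (Ew r')"
      unfolding place_def
      by (rule hc_assoc_E [symmetric, where c = "L' + r'"])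
        (use z' in \<open>auto intro!: hid_Hom EndE_hc simp: algebra_simps\<close>)
    then show ?thesis by (simp add: place_def hid_Ew algebra_simps)
  qed
  have iz: "hid (n + 2 * int (L + ?b)) (Ew i) \<diamondop> z \<in> EndE (n + 2 * int ?b) ?a"
    by (rule EndE_hc) (use z in \<open>auto intro!: hid_Hom simp: algebra_simps\<close>)
  have 3: "place n 0 ?a ?b (hid (n + 2 * int (L + ?b)) (Ew i) \<diamondop> z)
      = (hid (n + 2 * int (L + ?b)) (Ew i) \<diamondop> z) \<diamondop> hid n (Ew ?b)"
    unfolding place_def using hc_nil_left [OF EndE_hc [OF iz hid_Hom]] by simp
  have "place n g L' r' z' \<in> EndE n ?b" by (rule EndE_place [OF z'])
  then show ?thesis unfolding 1 2 3 by (simp only: hc_commute [OF iz])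
qed

lemma x_act_place: "i < N \<Longrightarrow> x_act n N i = place n i 1 (N - 1 - i) (hdot (n + 2 * int (N - 1 - i)))"
  by (simp add: x_act_def place_def)

lemma d_act_place: "Suc i < N \<Longrightarrow> d_act n N i = place n i 2 (N - 2 - i) (hcross (n + 2 * int (N - 2 - i)))"
  by (simp add: d_act_def place_def)

lemma hdot_EndE: "hdot n \<in> EndE n 1"
  using hdot_Hom by simp

lemma hcross_EndE: "hcross n \<in> EndE n 2"
  using hcross_Hom by (simp add: numeral_2_eq_2)

lemma x_act_Hom:
  assumes "i < N"
  shows "x_act n N i \<in> EndE n N"
proof -
  have "i + 1 + (N - 1 - i) = N" using assms by simp
  then show ?thesis
    using EndE_place [where i = i and r = "N - 1 - i", OF hdot_EndE] by (simp only: x_act_place [OF assms])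
qed

lemma d_act_Hom:
  assumes "Suc i < N"
  shows "d_act n N i \<in> EndE n N"
proof -
  have "i + 2 + (N - 2 - i) = N" using assms by simp
  then show ?thesis
    using EndE_place [where i = i and r = "N - 2 - i", OF hcross_EndE] by (simp only: d_act_place [OF assms])
qed

lemma place_far':
  assumes "z \<in> EndE (n + 2 * int r) L" "z' \<in> EndE (n + 2 * int r') L'"
    and "i + L \<le> i'" "i + L + r = i' + L' + r'"
  shows "place n i L r z \<bullet> place n i' L' r' z' = place n i' L' r' z' \<bullet> place n i L r z"
proof -
  define g where "g = i' - i - L"
  have "r = g + L' + r'" "i' = i + L + g" using assms by (auto simp: g_def)
  with assms show ?thesis using place_far [of z n g L' r' L z' i] by simp
qed

lemma x_x: "i < N \<Longrightarrow> j < N \<Longrightarrow> x_act n N i \<bullet> x_act n N j = x_act n N j \<bullet> x_act n N i"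
proof (induction i j rule: linorder_wlog)
  case (le i j)
  show ?case
  proof (cases "i = j")
    case False
    with le show ?thesis
      unfolding x_act_place [OF le(2)] x_act_place [OF le(3)]
      by (intro place_far' hdot_EndE) auto
  qed simp
qed simp

lemma d_x_other:
  assumes "Suc i < N" "j < N" "j \<noteq> i" "j \<noteq> Suc i"
  shows "d_act n N i \<bullet> x_act n N j = x_act n N j \<bullet> d_act n N i"
proof (cases "j < i")
  case True
  then show ?thesis unfolding x_act_place [OF assms(2)] d_act_place [OF assms(1)]
    by (intro place_far' [symmetric] hdot_EndE hcross_EndE) (use assms in auto)
next
  case False
  then show ?thesis unfolding x_act_place [OF assms(2)] d_act_place [OF assms(1)]
    by (intro place_far' hdot_EndE hcross_EndE) (use assms in auto)
qed

lemma d_d_far: "Suc i < j \<Longrightarrow> Suc j < N \<Longrightarrow> d_act n N i \<bullet> d_act n N j = d_act n N j \<bullet> d_act n N i"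
  by (subst (1 2) d_act_place, simp, subst (1 2) d_act_place, simp, intro place_far' hcross_EndE) auto

text \<open>Both composites \<open>h\<close> satisfy \<open>hadd h h = h\<close>, by additivity, and
  cancellation in the Hom group leaves only zero.\<close>

lemma hzero_vc: "f \<in> Hom n V V' \<Longrightarrow> wsh V' = wsh W \<Longrightarrow> wsh V = wsh W \<Longrightarrow> hzero n V' W \<bullet> f = hzero n V W"
  and hscale_hzero: "wsh V = wsh W \<Longrightarrow> hscale c (hzero n V W) = hzero n V W"
proof -
  have canc: "h = hzero n V W" if "h \<in> Hom n V W" "hadd h h = h" "wsh V = wsh W" for h V W
  proof -
    have "hzero n V W = hadd (hadd h h) (hscale (- 1) h)" using hadd_minus [OF that(3,1)] that(2) by simp
    also have "\<dots> = hadd h (hzero n V W)"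
      by (simp only: hadd_assoc [OF that(1,1) hscale_Hom [OF that(1)]] hadd_minus [OF that(3,1)])
    also have "\<dots> = h"
      using hadd_commute [OF that(1) hzero_Hom [OF that(3)]] hadd_zero [OF that(3,1)] by simp
    finally show ?thesis by simp
  qed
  have z: "hadd (hzero n V W) (hzero n V W) = hzero n V W" if "wsh V = wsh W" for V W
    by (rule hadd_zero [OF that hzero_Hom [OF that]])
  show "hzero n V' W \<bullet> f = hzero n V W" if f: "f \<in> Hom n V V'" and w: "wsh V' = wsh W" "wsh V = wsh W"
  proof (rule canc [OF vc_Hom [OF hzero_Hom [OF w(1)] f] _ w(2)])
    show "hadd (hzero n V' W \<bullet> f) (hzero n V' W \<bullet> f) = hzero n V' W \<bullet> f"
      by (simp only: vc_add_left [OF hzero_Hom [OF w(1)] hzero_Hom [OF w(1)] f, symmetric] z [OF w(1)])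
  qed
  show "hscale c (hzero n V W) = hzero n V W" if w: "wsh V = wsh W"
  proof (rule canc [OF hscale_Hom [OF hzero_Hom [OF w]] _ w])
    show "hadd (hscale c (hzero n V W)) (hscale c (hzero n V W)) = hscale c (hzero n V W)"
      by (simp only: hscale_add [OF hzero_Hom [OF w] hzero_Hom [OF w], symmetric] z [OF w])
  qed
qed

lemma place_zero:
  "place n i L r (hzero (n + 2 * int r) (Ew L) (Ew L) :: 'k::{comm_ring,monoid_mult} hmor)
    = hzero n (Ew (i + L + r)) (Ew (i + L + r))"
proof -
  let ?z = "hid (n + 2 * int r) (Ew L) :: 'k hmor"
  have assms: "?z \<in> EndE (n + 2 * int r) L" by (rule hid_Hom)
  have "hadd ?z (hscale (- 1) ?z) = hzero (n + 2 * int r) (Ew L) (Ew L)"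
    by (rule hadd_minus) (use assms in auto)
  then have "place n i L r (hzero (n + 2 * int r) (Ew L) (Ew L))
      = hadd (place n i L r ?z) (hscale (- 1) (place n i L r ?z))"
    using place_add [OF assms hscale_Hom [OF assms]] place_scale [OF assms] by metis
  also have "\<dots> = hzero n (Ew (i + L + r)) (Ew (i + L + r))"
    by (rule hadd_minus) (use EndE_place [OF assms] in auto)
  finally show ?thesis .
qed

lemma d_d:
  assumes "Suc i < N"
  shows "d_act n N i \<bullet> d_act n N i = hzero n (Ew N) (Ew N)"
proof -
  define r where "r = N - 2 - i"
  have N: "i + 2 + r = N" using assms by (simp add: r_def)
  have EE: "[\<E>, \<E>] = Ew 2" by (simp add: numeral_2_eq_2)
  show ?thesis
    unfolding d_act_place [OF assms] r_def [symmetric]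
    using place_zero [of n i 2 r]
    by (simp only: place_mult [OF hcross_EndE hcross_EndE] cross_cross EE N)
qed

lemma d_braid:
  assumes "Suc (Suc i) < N"
  shows "d_act n N i \<bullet> d_act n N (Suc i) \<bullet> d_act n N i = d_act n N (Suc i) \<bullet> d_act n N i \<bullet> d_act n N (Suc i)"
proof -
  define r where "r = N - 3 - i"
  \<comment> \<open>The weight to the right of the three-strand window that starts at strand
    \<open>i\<close>; the local braid relation is applied at this weight.\<close>
  define m where "m = n + 2 * int r"
  have r: "N - 2 - i = 1 + r" "N - 2 - Suc i = r" using assms by (auto simp: r_def)
  have m2: "n + 2 * int (1 + r) = m + 2" and m4: "m + 4 = n + 2 * int (2 + r)" by (simp_all add: m_def)
  have E1: "[\<E>] = Ew 1" and n3: "2 + 1 = (3 :: nat)" "1 + 2 = (3 :: nat)" by simp_all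
  let ?c = "hcross (m + 2) \<diamondop> hid m [\<E>] :: 'a hmor" and ?c' = "hid (m + 4) [\<E>] \<diamondop> hcross m :: 'a hmor"
  have c: "?c \<in> EndE m 3" and c': "?c' \<in> EndE m 3"
    using EndE_hc [OF hcross_EndE hid_Hom, of m 1] EndE_hc [OF hid_Hom hcross_EndE, of m 1]
    by (simp_all add: numeral_3_eq_3 numeral_2_eq_2)
  have 1: "d_act n N i = place n i 3 r ?c"
    unfolding d_act_place [OF Suc_lessD [OF assms]] r m2 E1
    using place_nest_right [OF hcross_EndE m_def, where i = i and k = 1] unfolding m2 n3 ..
  have 2: "d_act n N (Suc i) = place n i 3 r ?c'"
    unfolding d_act_place [OF assms] r E1
    using place_nest_left [OF hcross_EndE [where 'a = 'a] m4, where i = i and j = 1] unfolding m_def n3 by simp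
  note c = c [unfolded m_def] and c' = c' [unfolded m_def]
  show ?thesis
    unfolding 1 2 m_def
    by (simp only: place_mult c c' vc_Hom [OF c' c] vc_Hom [OF c c'] cross_braid)
qed

lemma
  assumes "Suc i < N"
  shows d_x: "(hid n (Ew N) :: 'a::{comm_ring,monoid_mult} hmor) = hadd (d_act n N i \<bullet> x_act n N i) (hscale (- 1) (x_act n N (Suc i) \<bullet> d_act n N i))"
    and d_x': "(hid n (Ew N) :: 'a hmor) = hadd (x_act n N i \<bullet> d_act n N i) (hscale (- 1) (d_act n N i \<bullet> x_act n N (Suc i)))"
proof -
  define r where "r = N - 2 - i"
  define m where "m = n + 2 * int r"
  have r: "N - 1 - i = 1 + r" "N - 1 - Suc i = r" and N: "i + 2 + r = N" using assms by (auto simp: r_def)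
  have m2: "n + 2 * int (1 + r) = m + 2" and m2': "m + 2 = n + 2 * int (1 + r)" by (simp_all add: m_def)
  have E1: "[\<E>] = Ew 1" and n2: "1 + 1 = (2 :: nat)" by simp_all
  let ?x = "hdot (m + 2) \<diamondop> hid m [\<E>] :: 'a hmor" and ?x' = "hid (m + 2) [\<E>] \<diamondop> hdot m :: 'a hmor"
    and ?c = "hcross m :: 'a hmor"
  have x: "?x \<in> EndE m 2" and x': "?x' \<in> EndE m 2"
    using EndE_hc [OF hdot_EndE hid_Hom, of m 1] EndE_hc [OF hid_Hom hdot_EndE, of m 1]
    by (simp_all add: numeral_2_eq_2)
  have 0: "d_act n N i = place n i 2 r ?c" using d_act_place [OF assms] by (simp add: r_def m_def)
  have 1: "x_act n N i = place n i 2 r ?x"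
    unfolding x_act_place [OF Suc_lessD [OF assms]] r m2 E1
    using place_nest_right [OF hdot_EndE m_def, where i = i and k = 1] unfolding m2 n2 ..
  have 2: "x_act n N (Suc i) = place n i 2 r ?x'"
    unfolding x_act_place [OF assms] r E1
    using place_nest_left [OF hdot_EndE [where 'a = 'a] m2', where i = i and j = 1] unfolding m_def n2 by simp
  have EE: "[\<E>, \<E>] = Ew 2" by (simp add: numeral_2_eq_2)
  have I: "hid n (Ew N) = place n i 2 r (hid m [\<E>, \<E>])"
    unfolding EE m_def place_id N ..
  note x = x [unfolded m_def] and x' = x' [unfolded m_def] and c = hcross_EndE [of "n + 2 * int r"]
  note h = place_mult c x x' vc_Hom [OF c x] vc_Hom [OF c x'] vc_Hom [OF x c] vc_Hom [OF x' c] place_add place_scale hscale_Hom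
  show "(hid n (Ew N) :: 'a hmor) = hadd (d_act n N i \<bullet> x_act n N i) (hscale (- 1) (x_act n N (Suc i) \<bullet> d_act n N i))"
    unfolding I cross_dot unfolding 0 1 2 m_def by (simp only: h)
  show "(hid n (Ew N) :: 'a hmor) = hadd (x_act n N i \<bullet> d_act n N i) (hscale (- 1) (d_act n N i \<bullet> x_act n N (Suc i)))"
    unfolding I cross_dot' unfolding 0 1 2 m_def by (simp only: h)
qed

text \<open>Families of endomorphisms of all words at all weights form a ring; the endomorphisms of a single
  word are embedded as a corner.\<close>

typedef (overloaded) 'k fam = "{f :: int \<Rightarrow> word \<Rightarrow> 'k::{comm_ring,monoid_mult} hmor. \<forall>n W. f n W \<in> Hom n W W}"
  morphisms fam_at Fam
  by (rule exI [of _ "\<lambda>n W. hid n W"]) (simp add: hid_Hom)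

lemma fam_at_Hom: "fam_at x n W \<in> Hom n W W"
  using fam_at [of x] by simp

lemma fam_eqI: "(\<And>n W. fam_at x n W = fam_at y n W) \<Longrightarrow> x = y"
  by (metis fam_at_inject ext)

instantiation fam :: ("{comm_ring,monoid_mult}") ring
begin

definition "0 = Fam (\<lambda>n W. hzero n W W)"
definition "x + y = Fam (\<lambda>n W. hadd (fam_at x n W) (fam_at y n W))"
definition "- x = Fam (\<lambda>n W. hscale (- 1) (fam_at x n W))"
definition "x - y = x + - (y :: 'a fam)"
definition "x * y = Fam (\<lambda>n W. fam_at x n W \<bullet> fam_at y n W)"

lemma fam_at_0: "fam_at (0 :: 'a fam) n W = hzero n W W"
  and fam_at_add: "fam_at (x + y :: 'a fam) n W = hadd (fam_at x n W) (fam_at y n W)"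
  and fam_at_minus: "fam_at (- x :: 'a fam) n W = hscale (- 1) (fam_at x n W)"
  and fam_at_mult: "fam_at (x * y :: 'a fam) n W = fam_at x n W \<bullet> fam_at y n W"
  by (simp_all add: zero_fam_def plus_fam_def uminus_fam_def times_fam_def Fam_inverse
      hzero_Hom hadd_Hom hscale_Hom vc_Hom [OF fam_at_Hom] fam_at_Hom)

instance
proof
  note H = fam_at_Hom
  fix x y z :: "'a fam"
  show "x + y + z = x + (y + z)"
    by (rule fam_eqI) (simp add: fam_at_add hadd_assoc [OF H H H])
  show comm: "x + y = y + x"
    by (rule fam_eqI) (simp only: fam_at_add hadd_commute [OF H H])
  show "0 + x = x"
    by (rule fam_eqI) (simp add: fam_at_add fam_at_0 hadd_zero [OF HOL.refl H])
  have "x + - x = 0"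
    by (rule fam_eqI) (simp add: fam_at_add fam_at_0 fam_at_minus hadd_minus [OF HOL.refl H])
  moreover have "- x + x = x + - x"
    by (rule fam_eqI) (simp only: fam_at_add hadd_commute [OF H H])
  ultimately show "- x + x = 0" by simp
  show "x - y = x + - y" by (simp add: minus_fam_def)
  show "x * y * z = x * (y * z)"
    by (rule fam_eqI) (simp add: fam_at_mult vc_assoc [OF H H H])
  show "(x + y) * z = x * z + y * z"
    by (rule fam_eqI) (simp add: fam_at_mult fam_at_add vc_add_left [OF H H H])
  show "x * (y + z) = x * y + x * z"
    by (rule fam_eqI) (simp add: fam_at_mult fam_at_add vc_add_right [OF H H H])
qed

end

definition embed :: "int \<Rightarrow> word \<Rightarrow> 'k::{comm_ring,monoid_mult} hmor \<Rightarrow> 'k fam" where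
  "embed n W z = Fam (\<lambda>m V. if m = n \<and> V = W \<and> z \<in> Hom n W W then z else hzero m V V)"

lemma embed_at: "z \<in> Hom n W W \<Longrightarrow> fam_at (embed n W z) m V = (if m = n \<and> V = W then z else hzero m V V)"
  unfolding embed_def by (subst Fam_inverse) (auto simp: hzero_Hom)

lemma embed_inj: "z \<in> Hom n W W \<Longrightarrow> z' \<in> Hom n W W \<Longrightarrow> embed n W z = embed n W z' \<Longrightarrow> z = z'"
  by (metis embed_at)

lemma embed_add:
  assumes "z \<in> Hom n W W" "z' \<in> Hom n W W"
  shows "embed n W (hadd z z') = embed n W z + embed n W z'"
  by (rule fam_eqI)
    (simp add: fam_at_add embed_at assms hadd_Hom [OF assms] hadd_zero [OF HOL.refl hzero_Hom])

lemma embed_mult: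
  assumes "z \<in> Hom n W W" "z' \<in> Hom n W W"
  shows "embed n W (z \<bullet> z') = embed n W z * embed n W z'"
  by (rule fam_eqI)
    (simp add: fam_at_mult embed_at assms vc_Hom [OF assms] hzero_vc [OF hzero_Hom])

lemma embed_0: "embed n W (hzero n W W) = 0"
  by (rule fam_eqI) (simp add: fam_at_0 embed_at hzero_Hom)

lemma embed_minus:
  assumes "z \<in> Hom n W W"
  shows "embed n W (hscale (- 1) z) = - embed n W z"
  by (rule fam_eqI) (simp add: fam_at_minus embed_at assms hscale_Hom [OF assms] hscale_hzero)

section \<open>The action of polynomials\<close>

text \<open>Differences of natural multiples of 1 replace the case distinction in
  \<open>int_scalar\<close>, which makes additivity a matter of rearrangement.\<close>

lemma int_scalar_diff:
  "int_scalar (int j - int k) = ((+) 1 ^^ j) 0 - (((+) 1 ^^ k) 0 :: 'k::{comm_ring,monoid_mult})"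
proof -
  define nt where "nt k = (((+) 1 ^^ k) 0 :: 'k)" for k
  have nt: "nt (i + j) = nt i + nt j" for i j
    by (induction i) (simp_all add: nt_def add.assoc)
  show ?thesis
    unfolding int_scalar_def nt_def [symmetric]
    using nt [of "j - k" k] nt [of "k - j" j] by (auto simp: nat_diff_distrib')
qed

lemma int_scalar_add: "int_scalar (c + d) = int_scalar c + (int_scalar d :: 'k::{comm_ring,monoid_mult})"
proof -
  obtain i j k l where [simp]: "c = int i - int j" "d = int k - int l"
    by (metis int_diff_cases)
  have "c + d = int (i + k) - int (j + l)" by simp
  then have *: "int_scalar (c + d) = ((+) 1 ^^ (i + k)) 0 - (((+) 1 ^^ (j + l)) 0 :: 'k)"
    by (simp only: int_scalar_diff)
  have nt: "((+) 1 ^^ (i + j)) 0 = ((+) 1 ^^ i) 0 + (((+) 1 ^^ j) 0 :: 'k)" for i j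
    by (induction i) (simp_all add: add.assoc)
  show ?thesis unfolding * by (simp add: int_scalar_diff nt)
qed

lemma int_scalar_1: "int_scalar 1 = (1 :: 'k::{comm_ring,monoid_mult})"
  by (simp add: int_scalar_def)

lemma hprod_Hom: "set zs \<subseteq> EndE n N \<Longrightarrow> hprod n N zs \<in> EndE n N"
  by (induction zs) (auto simp: hprod_def hid_Hom intro: vc_Hom)

lemma monom_act_Hom: "monom_act n N m \<in> EndE n N"
  unfolding monom_act_def by (rule hprod_Hom) (auto simp: x_act_Hom split: if_splits)

locale E_power =
  fixes n :: int and N :: nat and k_type :: "'k::{comm_ring,monoid_mult} itself"
begin

abbreviation emb :: "'k hmor \<Rightarrow> 'k fam" where "emb \<equiv> embed n (Ew N)"
abbreviation u :: "'k fam" where "u \<equiv> emb (hid n (Ew N))"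

lemma emb_u:
  assumes "z \<in> EndE n N"
  shows "u * emb z = emb z" "emb z * u = emb z"
  by (simp_all add: embed_mult [symmetric] assms hid_Hom vc_id_left [OF assms] vc_id_right [OF assms])

definition fprod :: "'k fam list \<Rightarrow> 'k fam" where "fprod zs = foldr (*) zs u"

lemma fprod_simps [simp]: "fprod [] = u" "fprod (z # zs) = z * fprod zs"
  by (simp_all add: fprod_def)

lemma emb_hprod: "set zs \<subseteq> EndE n N \<Longrightarrow> emb (hprod n N zs) = fprod (map emb zs)"
proof (induction zs)
  case (Cons z zs)
  then show ?case using hprod_Hom [of zs n N] by (simp add: hprod_def embed_mult)
qed (simp add: hprod_def)

lemma u_u: "u * u = u"
  by (rule emb_u) (rule hid_Hom)

lemma u_fprod: "(\<And>z. z \<in> set zs \<Longrightarrow> u * z = z) \<Longrightarrow> u * fprod zs = fprod zs"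
  by (cases zs) (simp_all add: u_u mult.assoc [symmetric])

lemma fprod_append: "(\<And>z. z \<in> set ws \<Longrightarrow> u * z = z) \<Longrightarrow> fprod (zs @ ws) = fprod zs * fprod ws"
  by (induction zs) (simp_all add: u_fprod mult.assoc)

lemma fprod_commute:
  "z * u = z \<Longrightarrow> u * z = z \<Longrightarrow> (\<And>w. w \<in> set zs \<Longrightarrow> z * w = w * z) \<Longrightarrow> z * fprod zs = fprod zs * z"
proof (induction zs)
  case (Cons w zs)
  have "z * fprod (w # zs) = (z * w) * fprod zs" by (simp add: mult.assoc)
  also have "\<dots> = w * (z * fprod zs)" using Cons.prems by (simp add: mult.assoc)
  finally show ?case using Cons by (simp add: mult.assoc)
qed simp

abbreviation xs :: "nat \<Rightarrow> 'k fam" where "xs i \<equiv> emb (x_act n N i)"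

definition xpow :: "nat \<Rightarrow> nat \<Rightarrow> 'k fam" where "xpow i k = fprod (replicate k (xs i))"

text \<open>The bound \<open>j\<close> on the variables is a separate argument so that products of
  powers can be handled by induction on it; the full monomial is the case
  \<open>j = N\<close>.\<close>

definition Mon :: "nat \<Rightarrow> (nat \<Rightarrow> nat) \<Rightarrow> 'k fam" where
  "Mon j m = fprod (concat (map (\<lambda>i. replicate (m i) (xs i)) [0..<j]))"

lemma xs_u: "i < N \<Longrightarrow> u * xs i = xs i" "i < N \<Longrightarrow> xs i * u = xs i"
  by (simp_all add: emb_u x_act_Hom)

lemma xs_xs: "i < N \<Longrightarrow> j < N \<Longrightarrow> xs i * xs j = xs j * xs i"
  by (simp add: embed_mult [symmetric] x_act_Hom x_x)

lemma Mon_0 [simp]: "Mon 0 m = u"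
  by (simp add: Mon_def)

lemma Mon_Suc: "j < N \<Longrightarrow> Mon (Suc j) m = Mon j m * xpow j (m j)"
  unfolding Mon_def xpow_def by (subst fprod_append [symmetric]) (auto simp: xs_u)

lemma xpow_add: "i < N \<Longrightarrow> xpow i (k + l) = xpow i k * xpow i l"
  unfolding xpow_def by (subst fprod_append [symmetric]) (auto simp: xs_u replicate_add)

lemma xpow_u: "i < N \<Longrightarrow> u * xpow i k = xpow i k" "i < N \<Longrightarrow> xpow i k * u = xpow i k"
proof -
  show 1: "i < N \<Longrightarrow> u * xpow i k = xpow i k" unfolding xpow_def by (rule u_fprod) (auto simp: xs_u)
  show "i < N \<Longrightarrow> xpow i k * u = xpow i k"
    using fprod_commute [of u "replicate k (xs i)"] 1 by (auto simp: xpow_def u_u xs_u)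
qed

lemma Mon_commute:
  assumes "i < N" "j \<le> N"
  shows "xpow i k * Mon j m = Mon j m * xpow i k"
proof -
  have "xpow i k * xs l = xs l * xpow i k" if "l < N" for l
    unfolding xpow_def
    by (rule fprod_commute [symmetric]) (use assms that in \<open>auto simp: xs_u intro: xs_xs\<close>)
  then show ?thesis
    unfolding Mon_def by (intro fprod_commute) (use assms in \<open>auto simp: xpow_u\<close>)
qed

lemma Mon_add: "j \<le> N \<Longrightarrow> Mon j (\<lambda>i. m i + m' i) = Mon j m * Mon j m'"
proof (induction j)
  case (Suc j)
  then have "Mon (Suc j) (\<lambda>i. m i + m' i) = Mon j m * (Mon j m' * xpow j (m j)) * xpow j (m' j)"
    by (simp add: Mon_Suc xpow_add mult.assoc)
  also have "Mon j m' * xpow j (m j) = xpow j (m j) * Mon j m'"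
    using Suc.prems by (simp add: Mon_commute)
  finally show ?case using Suc.prems by (simp add: Mon_Suc mult.assoc)
qed (simp add: u_u)

lemma emb_monom_act: "emb (monom_act n N m) = Mon N m"
  unfolding monom_act_def Mon_def
  by (subst emb_hprod) (auto simp: x_act_Hom map_concat comp_def)

definition mono_term :: "(nat \<Rightarrow>\<^sub>0 nat) \<Rightarrow> int \<Rightarrow> 'k fam" where
  "mono_term m c = emb (hscale (int_scalar c) (monom_act n N (lookup m)))"

lemma mono_term_add: "mono_term m (c + d) = mono_term m c + mono_term m d"
  unfolding mono_term_def int_scalar_add hscale_plus [OF monom_act_Hom]
  by (rule embed_add) (simp_all add: hscale_Hom monom_act_Hom)

lemma mono_term_0: "mono_term m 0 = 0"
  using mono_term_add [of m 0 0] by simp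

text \<open>A fold over a set is controlled only for steps that commute, and \<open>hadd\<close>
  commutes on well-typed arguments. The last clause gives closure properties of the folded value;
  the degree of \<open>poly_act\<close> is obtained from it.\<close>

lemma poly_act_fold:
  fixes c :: "(nat \<Rightarrow>\<^sub>0 nat) \<Rightarrow> int"
  defines "t \<equiv> \<lambda>m. hscale (int_scalar (c m)) (monom_act n N (lookup m)) :: 'k hmor"
    and "z \<equiv> hzero n (Ew N) (Ew N)"
  assumes "finite K"
  shows "Finite_Set.fold (\<lambda>m. hadd (t m)) z K \<in> EndE n N
    \<and> emb (Finite_Set.fold (\<lambda>m. hadd (t m)) z K) = (\<Sum>m\<in>K. mono_term m (c m))
    \<and> (\<forall>B. z \<in> B \<longrightarrow> (\<forall>m\<in>K. \<forall>y\<in>B. hadd (t m) y \<in> B) \<longrightarrow> Finite_Set.fold (\<lambda>m. hadd (t m)) z K \<in> B)"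
proof -
  \<comment> \<open>Off \<open>EndE n N\<close> the step is made trivial, so that it commutes
    everywhere. The fold never leaves \<open>EndE n N\<close>, hence its value does not
    change.\<close>
  define g where "g m y = (if y \<in> EndE n N then hadd (t m) y else y)" for m y
  have t: "t m \<in> EndE n N" for m by (simp add: t_def hscale_Hom monom_act_Hom)
  have mono_term: "mono_term m (c m) = emb (t m)" for m by (simp add: t_def mono_term_def)
  have z: "z \<in> EndE n N" by (simp add: z_def hzero_Hom)
  have g: "g m y = hadd (t m) y" if "y \<in> EndE n N" for m y using that by (simp add: g_def)
  interpret g: comp_fun_commute g
  proof
    show "g m \<circ> g m' = g m' \<circ> g m" for m m'
    proof
      fix y :: "'k hmor"
      have "hadd (t m) (hadd (t m') y) = hadd (t m') (hadd (t m) y)" if "y \<in> EndE n N"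
        using hadd_assoc [OF t t that, of m m'] hadd_assoc [OF t t that, of m' m] hadd_commute [OF t t, of m m']
        by simp
      then show "(g m \<circ> g m') y = (g m' \<circ> g m) y" by (simp add: g_def hadd_Hom [OF t])
    qed
  qed
  have "Finite_Set.fold (\<lambda>m. hadd (t m)) z K = Finite_Set.fold g z K"
    by (rule fold_closed_eq [where B = "EndE n N"]) (auto simp: g z hadd_Hom [OF t])
  moreover have "Finite_Set.fold g z K \<in> EndE n N \<and> emb (Finite_Set.fold g z K) = (\<Sum>m\<in>K. mono_term m (c m))
    \<and> (\<forall>B. z \<in> B \<longrightarrow> (\<forall>m\<in>K. \<forall>y\<in>B. hadd (t m) y \<in> B) \<longrightarrow> Finite_Set.fold g z K \<in> B)"
    using assms(3)
  proof induction
    case (insert m K)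
    then show ?case
      by (simp add: g.fold_insert g hadd_Hom [OF t] embed_add [OF t] mono_term)
  qed (simp add: z embed_0, simp add: z_def embed_0)
  ultimately show ?thesis by simp
qed

lemma poly_act_Hom: "(poly_act n N p :: 'k hmor) \<in> EndE n N"
  and emb_poly_act: "emb (poly_act n N p) = (\<Sum>m\<in>keys p. mono_term m (lookup p m))"
  unfolding poly_act_def using poly_act_fold [OF finite_keys, of "lookup p" p] by blast+

lemma poly_act_closed:
  assumes "hzero n (Ew N) (Ew N) \<in> B"
    and "\<And>m y. m \<in> keys p \<Longrightarrow> y \<in> B \<Longrightarrow>
      hadd (hscale (int_scalar (lookup p m)) (monom_act n N (lookup m))) y \<in> B"
  shows "(poly_act n N p :: 'k hmor) \<in> B"
  unfolding poly_act_def
  using poly_act_fold [OF finite_keys, of "lookup p" p] assms by blast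

definition Pf :: "mpoly \<Rightarrow> 'k fam" where "Pf p = emb (poly_act n N p)"

lemma Pf_add: "Pf (p + q) = Pf p + Pf q"
  unfolding Pf_def emb_poly_act by (rule setsum_keys_plus_distrib) (simp_all add: mono_term_0 mono_term_add)

lemma Pf_single: "Pf (mono m) = Mon N (lookup m)"
  unfolding Pf_def emb_poly_act
  by (simp add: mono_term_def int_scalar_1 hscale_1 [OF monom_act_Hom] emb_monom_act)

lemma Pf_mult: "Pf (p * q) = Pf p * Pf q"
proof (rule additive_multI [OF Pf_add])
  fix m m' :: "nat \<Rightarrow>\<^sub>0 nat"
  show "Pf (mono (m + m')) = Pf (mono m) * Pf (mono m')"
    unfolding Pf_single using Mon_add [of N "lookup m" "lookup m'"]
    by (simp add: lookup_add [abs_def])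
qed

lemma Mon_trivial: "j \<le> N \<Longrightarrow> (\<And>i. i < j \<Longrightarrow> m i = 0) \<Longrightarrow> Mon j m = u"
  by (induction j) (simp_all add: Mon_Suc xpow_def u_u)

lemma Pf_1: "Pf 1 = u"
  using Pf_single [of 0] by (simp add: Mon_trivial)

lemma Pf_X: "Pf (X i) = (if i < N then xs i else u)"
proof -
  let ?m = "lookup (Poly_Mapping.single i (1 :: nat))"
  have "Mon j ?m = (if i < j then xs i else u)" if "j \<le> N" for j
    using that
  proof (induction j)
    case (Suc j)
    then have "Mon (Suc j) ?m = (if i < j then xs i else u) * xpow j (?m j)" by (simp add: Mon_Suc)
    also have "xpow j (?m j) = (if i = j then xs i else u)"
      using Suc.prems by (auto simp: xpow_def lookup_single when_def xs_u)
    finally show ?case using Suc.prems by (auto simp: xs_u u_u)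
  qed simp
  then show ?thesis using Pf_single [of "Poly_Mapping.single i 1"] by (simp add: Xvar_def)
qed

lemma Pf_mon: "Pf (mon 0 e N) = Mon N e"
proof -
  have xpow: "Pf (X i ^ k) = xpow i k" if "i < N" for i k
    using that by (induction k) (simp_all add: Pf_1 xpow_def Pf_mult Pf_X)
  have "Pf (mon 0 e j) = Mon j e" if "j \<le> N" for j
    using that by (induction j) (simp_all add: mon_def Pf_1 Pf_mult xpow Mon_Suc)
  then show ?thesis by simp
qed

lemma delta_act_eq: "(delta_act n N :: 'k hmor) = poly_act n N (delta 0 N)"
  using Pf_mon [of "\<lambda>i. N - 1 - i"]
  by (intro embed_inj [of _ n "Ew N"])
    (simp_all add: delta_act_def monom_act_Hom poly_act_Hom Pf_def emb_monom_act delta_mon)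

sublocale nilhecke N u Pf "\<lambda>i. emb (d_act n N i)"
proof
  show "Pf (p + q) = Pf p + Pf q" for p q by (rule Pf_add)
  show "Pf (p * q) = Pf p * Pf q" for p q by (rule Pf_mult)
  show "Pf 1 = u" by (rule Pf_1)
  fix i j
  show "emb (d_act n N i) * u = emb (d_act n N i)" "u * emb (d_act n N i) = emb (d_act n N i)" if "Suc i < N"
    using emb_u [OF d_act_Hom [OF that]] by blast+
  show "emb (d_act n N i) * emb (d_act n N i) = 0" if "Suc i < N"
    using that by (simp add: embed_mult [symmetric] d_act_Hom d_d embed_0)
  show "emb (d_act n N i) * emb (d_act n N j) = emb (d_act n N j) * emb (d_act n N i)" if "Suc i < j" "Suc j < N"
    using that d_d_far [OF that, of n, where 'a = 'k] by (simp add: embed_mult [symmetric] d_act_Hom)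
  show "emb (d_act n N i) * (emb (d_act n N (Suc i)) * emb (d_act n N i))
      = emb (d_act n N (Suc i)) * (emb (d_act n N i) * emb (d_act n N (Suc i)))" if "Suc (Suc i) < N"
    using that d_braid [OF that, of n, where 'a = 'k]
    by (simp add: embed_mult [symmetric] d_act_Hom vc_Hom [OF d_act_Hom d_act_Hom])
  show "emb (d_act n N i) * Pf (X i) = Pf (X (Suc i)) * emb (d_act n N i) + u" if "Suc i < N"
  proof -
    note h = d_act_Hom [OF that] x_act_Hom [OF that] x_act_Hom [OF Suc_lessD [OF that]]
    show ?thesis using that arg_cong [OF d_x [OF that, of n, where 'a = 'k], of emb]
      by (simp add: Pf_X embed_mult embed_add embed_minus h hscale_Hom vc_Hom [OF h(1) h(2)] vc_Hom [OF h(1) h(3)]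
         vc_Hom [OF h(2) h(1)] vc_Hom [OF h(3) h(1)])
  qed
  show "emb (d_act n N i) * Pf (X (Suc i)) = Pf (X i) * emb (d_act n N i) - u" if "Suc i < N"
  proof -
    note h = d_act_Hom [OF that] x_act_Hom [OF that] x_act_Hom [OF Suc_lessD [OF that]]
    show ?thesis using that arg_cong [OF d_x' [OF that, of n, where 'a = 'k], of emb]
      by (simp add: Pf_X embed_mult embed_add embed_minus h hscale_Hom vc_Hom [OF h(1) h(2)] vc_Hom [OF h(1) h(3)]
         vc_Hom [OF h(2) h(1)] vc_Hom [OF h(3) h(1)])
  qed
  show "emb (d_act n N i) * Pf (X j) = Pf (X j) * emb (d_act n N i)" if "Suc i < N" "j \<noteq> i" "j \<noteq> Suc i"
    using that emb_u [OF d_act_Hom [OF that(1)]]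
    by (simp add: Pf_X embed_mult [symmetric] d_act_Hom x_act_Hom d_x_other)
qed

definition Rep :: "'k hmor \<Rightarrow> (mpoly \<Rightarrow> mpoly) \<Rightarrow> bool" where
  "Rep z \<phi> \<longleftrightarrow> z \<in> EndE n N \<and> rep (emb z) \<phi>"

lemma Rep_unique: "Rep z \<phi> \<Longrightarrow> Rep z' \<phi> \<Longrightarrow> z = z'"
  unfolding Rep_def using rep_unique embed_inj by blast

lemma Rep_vc: "Rep z \<phi> \<Longrightarrow> Rep z' \<psi> \<Longrightarrow> Rep (z \<bullet> z') (\<lambda>f. \<phi> (\<psi> f))"
  unfolding Rep_def by (auto simp: embed_mult intro: vc_Hom rep_mult)

lemma Rep_hadd: "Rep z \<phi> \<Longrightarrow> Rep z' \<psi> \<Longrightarrow> Rep (hadd z z') (\<lambda>f. \<phi> f + \<psi> f)"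
  unfolding Rep_def by (auto simp: embed_add intro: hadd_Hom rep_add)

lemma Rep_hzero: "Rep (hzero n (Ew N) (Ew N)) (\<lambda>f. 0)"
  unfolding Rep_def by (simp add: embed_0 hzero_Hom rep_0)

lemma Rep_poly: "Rep (poly_act n N p) (\<lambda>f. p * f)"
  unfolding Rep_def using rep_P [of p] by (simp add: poly_act_Hom Pf_def)

text \<open>The scalar \<open>- 1\<close> of the ground ring is realized as the action of the
  polynomial -1, and so has a counterpart on integer polynomials.\<close>

lemma Rep_sign:
  assumes "Rep z \<phi>"
  shows "Rep (hscale ((- 1) ^ k) z) (\<lambda>f. of_int ((- 1) ^ k) * \<phi> f)"
proof (induction k)
  case 0
  have "z \<in> EndE n N" using assms by (simp add: Rep_def)
  then show ?case using assms by (simp add: hscale_1)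
next
  case (Suc k)
  have z: "z \<in> EndE n N" using assms by (simp add: Rep_def)
  have "rep (Pf (- 1) * emb (hscale ((- 1) ^ k) z)) (\<lambda>f. - 1 * (of_int ((- 1) ^ k) * \<phi> f))"
    by (rule rep_mult [OF rep_P]) (use Suc in \<open>simp add: Rep_def\<close>)
  moreover have "Pf (- 1) * emb (hscale ((- 1) ^ k) z) = emb (hscale ((- 1) ^ Suc k) z)"
    using emb_u [OF hscale_Hom [OF z]]
    by (simp only: P_minus Pf_1 power_Suc hscale_mult [OF z] embed_minus [OF hscale_Hom [OF z]]) simp
  ultimately show ?case using hscale_Hom [OF z] by (simp add: Rep_def)
qed

lemma Rep_hprod_d:
  assumes "k + M \<le> N"
  shows "Rep (hprod n N (map (\<lambda>i. d_act n N (k + i)) (w0 M))) (Dp k M)"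
proof -
  have sub: "set (map (\<lambda>i. d_act n N (k + i)) (w0 M)) \<subseteq> EndE n N"
    using assms by (auto dest!: w0_bound intro!: d_act_Hom)
  have "emb (hprod n N (map (\<lambda>i. d_act n N (k + i)) (w0 M))) = dprod (map ((+) k) (w0 M))"
    unfolding emb_hprod [OF sub] fprod_def dprod_def by (simp add: foldr_map comp_def)
  then show ?thesis unfolding Rep_def using rep_Dp [OF assms] hprod_Hom [OF sub] by simp
qed

end

section \<open>Horizontal composition\<close>

lemma place_hc_right:
  assumes z: "z \<in> EndE (n + 2 * int (r + b)) L"
  shows "place (n + 2 * int b) i L r z \<diamondop> hid n (Ew b) = place n i L (r + b) z"
proof -
  let ?A = "hid (n + 2 * int b + 2 * int (L + r)) (Ew i)" and ?C = "hid (n + 2 * int b) (Ew r)"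
  have "(?A \<diamondop> z \<diamondop> ?C) \<diamondop> hid n (Ew b) = ?A \<diamondop> (z \<diamondop> ?C) \<diamondop> hid n (Ew b)"
    by (rule hc_assoc_E [where b = "L + r"]) (use z in \<open>auto intro!: hid_Hom EndE_hc simp: algebra_simps\<close>)
  also have "(z \<diamondop> ?C) \<diamondop> hid n (Ew b) = z \<diamondop> ?C \<diamondop> hid n (Ew b)"
    by (rule hc_assoc_E) (use z in \<open>auto intro!: hid_Hom\<close>)
  finally show ?thesis by (simp add: place_def hid_Ew algebra_simps)
qed

lemma place_hc_left:
  assumes z: "z \<in> EndE (n + 2 * int r) L" and m: "m = n + 2 * int (i + L + r)"
  shows "hid m (Ew a) \<diamondop> place n i L r z = place n (a + i) L r z"
proof -
  have "hid m (Ew a) \<diamondop> place n i L r z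
      = (hid m (Ew a) \<diamondop> hid (n + 2 * int (L + r)) (Ew i)) \<diamondop> z \<diamondop> hid n (Ew r)"
    unfolding place_def
    by (rule hc_assoc_E [symmetric, where c = "L + r"])
      (use z m in \<open>auto intro!: hid_Hom EndE_hc simp: algebra_simps\<close>)
  then show ?thesis using m by (simp add: place_def hid_Ew algebra_simps)
qed

lemma x_act_right:
  assumes "i < a"
  shows "x_act (n + 2 * int b) a i \<diamondop> hid n (Ew b) = x_act n (a + b) i"
proof -
  have r: "a + b - 1 - i = a - 1 - i + b" and i: "i < a + b"
    and m: "n + 2 * int b + 2 * int (a - 1 - i) = n + 2 * int (a - 1 - i + b)" using assms by simp_all
  show ?thesis
    unfolding x_act_place [OF assms] x_act_place [OF i] r m by (rule place_hc_right [OF hdot_EndE])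
qed

lemma x_act_left:
  assumes "i < b"
  shows "hid (n + 2 * int b) (Ew a) \<diamondop> x_act n b i = x_act n (a + b) (a + i)"
proof -
  have r: "a + b - 1 - (a + i) = b - 1 - i" and i: "a + i < a + b"
    and m: "n + 2 * int b = n + 2 * int (i + 1 + (b - 1 - i))" using assms by simp_all
  show ?thesis
    unfolding x_act_place [OF assms] x_act_place [OF i] r by (rule place_hc_left [OF hdot_EndE m])
qed

lemma d_act_right:
  assumes "Suc i < a"
  shows "d_act (n + 2 * int b) a i \<diamondop> hid n (Ew b) = d_act n (a + b) i"
proof -
  have r: "a + b - 2 - i = a - 2 - i + b" and i: "Suc i < a + b"
    and m: "n + 2 * int b + 2 * int (a - 2 - i) = n + 2 * int (a - 2 - i + b)" using assms by simp_all
  show ?thesis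
    unfolding d_act_place [OF assms] d_act_place [OF i] r m by (rule place_hc_right [OF hcross_EndE])
qed

lemma d_act_left:
  assumes "Suc i < b"
  shows "hid (n + 2 * int b) (Ew a) \<diamondop> d_act n b i = d_act n (a + b) (a + i)"
proof -
  have r: "a + b - 2 - (a + i) = b - 2 - i" and i: "Suc (a + i) < a + b"
    and m: "n + 2 * int b = n + 2 * int (i + 2 + (b - 2 - i))" using assms by simp_all
  show ?thesis
    unfolding d_act_place [OF assms] d_act_place [OF i] r by (rule place_hc_left [OF hcross_EndE m])
qed

lemma hc_right_mult:
  assumes "f \<in> EndE (n + 2 * int b) a" "g \<in> EndE (n + 2 * int b) a"
  shows "(f \<bullet> g) \<diamondop> hid n (Ew b) = (f \<diamondop> hid n (Ew b)) \<bullet> (g \<diamondop> hid n (Ew b))"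
  using interchange [of f n "Ew b" "Ew a" "Ew a" g "Ew a" "hid n (Ew b)" "Ew b" "Ew b" "hid n (Ew b)"] assms
  by (simp add: hid_Hom vc_id_left [OF hid_Hom])

lemma hc_left_mult:
  assumes "f \<in> EndE n b" "g \<in> EndE n b"
  shows "hid (n + 2 * int b) (Ew a) \<diamondop> (f \<bullet> g)
    = (hid (n + 2 * int b) (Ew a) \<diamondop> f) \<bullet> (hid (n + 2 * int b) (Ew a) \<diamondop> g)"
  using interchange [of "hid (n + 2 * int b) (Ew a)" n "Ew b" "Ew a" "Ew a" "hid (n + 2 * int b) (Ew a)" "Ew a"
      f "Ew b" "Ew b" g] assms
  by (simp add: hid_Hom vc_id_left [OF hid_Hom])

lemma hc_right_add:
  assumes "f \<in> EndE (n + 2 * int b) a" "g \<in> EndE (n + 2 * int b) a"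
  shows "hadd f g \<diamondop> hid n (Ew b) = hadd (f \<diamondop> hid n (Ew b)) (g \<diamondop> hid n (Ew b))"
  by (rule hc_add_left) (use assms in \<open>auto intro: hid_Hom\<close>)

lemma hc_left_add:
  assumes "f \<in> EndE n b" "g \<in> EndE n b"
  shows "hid (n + 2 * int b) (Ew a) \<diamondop> hadd f g
    = hadd (hid (n + 2 * int b) (Ew a) \<diamondop> f) (hid (n + 2 * int b) (Ew a) \<diamondop> g)"
  by (rule hc_add_right) (use assms in \<open>auto intro: hid_Hom\<close>)

lemma hprod_right:
  assumes "set zs \<subseteq> EndE (n + 2 * int b) a"
  shows "hprod (n + 2 * int b) a zs \<diamondop> hid n (Ew b) = hprod n (a + b) (map (\<lambda>z. z \<diamondop> hid n (Ew b)) zs)"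
  using assms
proof (induction zs)
  case (Cons z zs)
  then show ?case using hc_right_mult [of z n b a "hprod (n + 2 * int b) a zs"] hprod_Hom [of zs "n + 2 * int b" a]
    by (simp add: hprod_def)
qed (simp add: hprod_def hid_Ew)

lemma hprod_left:
  assumes "set zs \<subseteq> EndE n b"
  shows "hid (n + 2 * int b) (Ew a) \<diamondop> hprod n b zs
    = hprod n (a + b) (map (\<lambda>z. hid (n + 2 * int b) (Ew a) \<diamondop> z) zs)"
  using assms
proof (induction zs)
  case (Cons z zs)
  then show ?case using hc_left_mult [of z n b "hprod n b zs" a] hprod_Hom [of zs n b]
    by (simp add: hprod_def)
qed (simp add: hprod_def hid_Ew)

lemma D_act_w0: "D_act n a = hprod n a (map (d_act n a) (w0 a))"
  by (simp add: D_act_def w0_def)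

lemma d_acts_Hom: "set (map (d_act n a) (w0 a)) \<subseteq> EndE n a"
  by (auto dest!: w0_bound intro: d_act_Hom)

lemma D_act_Hom: "D_act n a \<in> EndE n a"
  unfolding D_act_w0 by (rule hprod_Hom [OF d_acts_Hom])

lemma D_act_right: "D_act (n + 2 * int b) a \<diamondop> hid n (Ew b) = hprod n (a + b) (map (\<lambda>i. d_act n (a + b) (0 + i)) (w0 a))"
  unfolding D_act_w0 hprod_right [OF d_acts_Hom] map_map
  by (rule arg_cong [of _ _ "hprod n (a + b)"], rule map_cong [OF HOL.refl]) (auto dest!: w0_bound simp: d_act_right)

lemma D_act_left: "hid (n + 2 * int b) (Ew a) \<diamondop> D_act n b = hprod n (a + b) (map (\<lambda>i. d_act n (a + b) (a + i)) (w0 b))"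
  unfolding D_act_w0 hprod_left [OF d_acts_Hom] map_map
  by (rule arg_cong [of _ _ "hprod n (a + b)"], rule map_cong [OF HOL.refl]) (auto dest!: w0_bound simp: d_act_left)

lemma ring_hom_subst:
  fixes F G :: "mpoly \<Rightarrow> 'r::ring"
  assumes F: "\<And>p q. F (p + q) = F p + F q" "\<And>p q. F (p * q) = F p * F q"
    and G: "\<And>p q. G (p + q) = G p + G q" "\<And>p q. G (p * q) = G p * G q"
    and "F 1 = G 1" "\<And>i. F (X i) = G (g i)"
  shows "F p = G (subst g p)"
proof -
  have [simp]: "F 0 = 0" "G 0 = 0" using F(1) [of 0 0] G(1) [of 0 0] by simp_all
  have diff: "F (p - q) = F p - F q" "G (p - q) = G p - G q" for p q
    using F(1) [of "p - q" q] G(1) [of "p - q" q] by simp_all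
  show ?thesis by (induction p rule: mpoly_induct) (simp_all add: diff F(2) G(2) assms(5,6))
qed

context E_power
begin

lemma poly_act_add: "poly_act n N (p + q) = hadd (poly_act n N p) (poly_act n N q :: 'k hmor)"
  using Pf_add [of p q] by (intro embed_inj [OF poly_act_Hom]) (simp_all add: hadd_Hom poly_act_Hom embed_add Pf_def)

lemma poly_act_mult: "poly_act n N (p * q) = poly_act n N p \<bullet> (poly_act n N q :: 'k hmor)"
  using Pf_mult [of p q]
  by (intro embed_inj [OF poly_act_Hom]) (simp_all add: vc_Hom [OF poly_act_Hom poly_act_Hom] poly_act_Hom embed_mult Pf_def)

lemma poly_act_1: "poly_act n N 1 = (hid n (Ew N) :: 'k hmor)"
  using Pf_1 by (intro embed_inj [OF poly_act_Hom hid_Hom]) (simp add: Pf_def)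

lemma poly_act_X: "poly_act n N (X i) = (if i < N then x_act n N i else hid n (Ew N) :: 'k hmor)"
  using Pf_X [of i] by (intro embed_inj [OF poly_act_Hom]) (auto simp: Pf_def x_act_Hom hid_Hom split: if_splits)

end

text \<open>As functions of \<open>p\<close>, both sides are ring homomorphisms and can be compared
  on variables. There they differ for indices from \<open>a\<close> to \<open>a + b - 1\<close>,
  which act as the identity on the left and as dots on the right; \<open>trunc a p = p\<close> rules
  such variables out.\<close>

lemma poly_act_right:
  assumes "trunc a p = p"
  shows "poly_act (n + 2 * int b) a p \<diamondop> hid n (Ew b) = (poly_act n (a + b) p :: 'k::{comm_ring,monoid_mult} hmor)"
proof -
  interpret E: E_power n "a + b" "TYPE('k)" .
  interpret L: E_power "n + 2 * int b" a "TYPE('k)" .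
  let ?F = "\<lambda>p. E.emb (poly_act (n + 2 * int b) a p \<diamondop> hid n (Ew b))"
  note h = L.poly_act_Hom EndE_hc [OF L.poly_act_Hom hid_Hom]
  have "?F p = E.Pf (trunc a p)"
  proof (rule ring_hom_subst [where F = ?F])
    show "?F (p + q) = ?F p + ?F q" for p q
      by (simp add: h L.poly_act_add hc_right_add [OF h(1) h(1)] embed_add)
    show "?F (p * q) = ?F p * ?F q" for p q
      by (simp add: h L.poly_act_mult hc_right_mult [OF h(1) h(1)] embed_mult)
    show "?F 1 = E.Pf 1" by (simp add: L.poly_act_1 E.Pf_1 hid_Ew)
    show "?F (X i) = E.Pf (if i < a then X i else 1)" for i
      by (auto simp: L.poly_act_X E.Pf_X E.Pf_1 x_act_right hid_Ew)
  qed (rule E.Pf_add E.Pf_mult)+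
  then show ?thesis
    using embed_inj [OF h(2) E.poly_act_Hom] by (simp add: assms E.Pf_def)
qed

lemma poly_act_left:
  assumes "trunc b p = p"
  shows "hid (n + 2 * int b) (Ew a) \<diamondop> poly_act n b p = (poly_act n (a + b) (shift a p) :: 'k::{comm_ring,monoid_mult} hmor)"
proof -
  interpret E: E_power n "a + b" "TYPE('k)" .
  interpret L: E_power n b "TYPE('k)" .
  let ?F = "\<lambda>p. E.emb (hid (n + 2 * int b) (Ew a) \<diamondop> poly_act n b p)"
  note h = L.poly_act_Hom EndE_hc [OF hid_Hom L.poly_act_Hom]
  have "?F p = E.Pf (subst (\<lambda>i. shift a (if i < b then X i else 1)) p)"
  proof (rule ring_hom_subst [where F = ?F])
    show "?F (p + q) = ?F p + ?F q" for p q
      by (simp add: h L.poly_act_add hc_left_add [OF h(1) h(1)] embed_add)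
    show "?F (p * q) = ?F p * ?F q" for p q
      by (simp add: h L.poly_act_mult hc_left_mult [OF h(1) h(1)] embed_mult)
    show "?F 1 = E.Pf 1" by (simp add: L.poly_act_1 E.Pf_1 hid_Ew)
    show "?F (X i) = E.Pf (shift a (if i < b then X i else 1))" for i
      by (auto simp: L.poly_act_X E.Pf_X E.Pf_1 x_act_left hid_Ew)
  qed (rule E.Pf_add E.Pf_mult)+
  also have "subst (\<lambda>i. shift a (if i < b then X i else 1)) p = shift a (trunc b p)"
    by (simp only: subst_subst)
  finally show ?thesis
    using embed_inj [OF h(2) E.poly_act_Hom] by (simp add: assms E.Pf_def)
qed

lemma delta_act_Hom: "(delta_act n a :: 'k::{comm_ring,monoid_mult} hmor) \<in> EndE n a"
  unfolding delta_act_def by (rule monom_act_Hom)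

lemma e_act_Hom: "(e_act n a :: 'k::{comm_ring,monoid_mult} hmor) \<in> EndE n a"
  unfolding e_act_def by (rule vc_Hom [OF delta_act_Hom D_act_Hom])

lemma trunc_delta: "trunc a (delta 0 a) = delta 0 a"
  by (simp add: delta_def)

lemma shift_delta: "shift a (delta 0 b) = delta a b"
  by (simp add: delta_def)

definition sigma_hmor :: "int \<Rightarrow> nat \<Rightarrow> nat \<Rightarrow> nat list \<Rightarrow> 'k::{comm_ring,monoid_mult} hmor" where
  "sigma_hmor n a b \<alpha> =
    ((poly_act (n + 2 * int b) a (schur \<alpha>) \<bullet> e_act (n + 2 * int b) a) \<diamondop> e_act n b) \<bullet> splitter n a b"

definition lambda_hmor :: "int \<Rightarrow> nat \<Rightarrow> nat \<Rightarrow> nat list \<Rightarrow> 'k::{comm_ring,monoid_mult} hmor" where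
  "lambda_hmor n a b \<alpha> = hscale ((- 1) ^ sum_list (hat_part b \<alpha>))
    (merger n a b \<bullet> (e_act (n + 2 * int b) a \<diamondop> (poly_act n b (schur (hat_part b \<alpha>)) \<bullet> e_act n b)))"

locale E_split = E_power n "a + b" k_type for n :: int and a b :: nat and k_type :: "'k::{comm_ring,monoid_mult} itself"
begin

abbreviation "rid z \<equiv> z \<diamondop> (hid n (Ew b) :: 'k hmor)"
abbreviation "lid z \<equiv> (hid (n + 2 * int b) (Ew a) :: 'k hmor) \<diamondop> z"

interpretation L: E_power "n + 2 * int b" a "TYPE('k)" .
interpretation R: E_power n b "TYPE('k)" .

lemma Rep_D_right: "Rep (rid (D_act (n + 2 * int b) a)) (Dp 0 a)"
  unfolding D_act_right by (rule Rep_hprod_d) simp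

lemma Rep_D_left: "Rep (lid (D_act n b)) (Dp a b)"
  unfolding D_act_left by (rule Rep_hprod_d) simp

lemma Rep_D: "Rep (D_act n (a + b)) (Dp 0 (a + b))"
  unfolding D_act_w0 using Rep_hprod_d [of 0 "a + b"] by simp

lemma Rep_delta_right: "Rep (rid (delta_act (n + 2 * int b) a)) (\<lambda>f. delta 0 a * f)"
  unfolding L.delta_act_eq poly_act_right [OF trunc_delta] by (rule Rep_poly)

lemma Rep_delta_left: "Rep (lid (delta_act n b)) (\<lambda>f. delta a b * f)"
  unfolding R.delta_act_eq poly_act_left [OF trunc_delta] shift_delta by (rule Rep_poly)

lemma Rep_e_right: "Rep (rid (e_act (n + 2 * int b) a)) (Eop 0 a)"
  unfolding e_act_def hc_right_mult [OF delta_act_Hom D_act_Hom] Eop_def [abs_def]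
  by (rule Rep_vc [OF Rep_delta_right Rep_D_right])

lemma Rep_e_left: "Rep (lid (e_act n b)) (Eop a b)"
  unfolding e_act_def hc_left_mult [OF delta_act_Hom D_act_Hom] Eop_def [abs_def]
  by (rule Rep_vc [OF Rep_delta_left Rep_D_left])

lemma Rep_e: "Rep (e_act n (a + b)) (Eop 0 (a + b))"
  unfolding e_act_def delta_act_eq Eop_def [abs_def] by (rule Rep_vc [OF Rep_poly Rep_D])

lemma Rep_ee: "Rep (e_act (n + 2 * int b) a \<diamondop> e_act n b) (\<lambda>f. Eop 0 a (Eop a b f))"
  unfolding hc_commute(1) [OF e_act_Hom e_act_Hom, symmetric] by (rule Rep_vc [OF Rep_e_right Rep_e_left])

lemma Rep_sigma:
  assumes "\<alpha> \<in> Parts a b"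
  shows "Rep (sigma_hmor n a b \<alpha>)
    (\<lambda>f. schur \<alpha> * Eop 0 a (Eop a b (delta 0 a * (delta a b * Dp 0 (a + b) f))))"
proof -
  note t = poly_act_right [OF trunc_schur [OF Parts_nth(1) [OF assms]], where 'k = 'k]
  have 1: "Rep (rid (poly_act (n + 2 * int b) a (schur \<alpha>) \<bullet> e_act (n + 2 * int b) a)) (\<lambda>f. schur \<alpha> * Eop 0 a f)"
    unfolding hc_right_mult [OF L.poly_act_Hom e_act_Hom] t by (rule Rep_vc [OF Rep_poly Rep_e_right])
  have 2: "Rep (delta_act (n + 2 * int b) a \<diamondop> delta_act n b) (\<lambda>f. delta 0 a * (delta a b * f))"
    unfolding hc_commute(1) [OF delta_act_Hom delta_act_Hom, symmetric]
    by (rule Rep_vc [OF Rep_delta_right Rep_delta_left])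
  show ?thesis
    unfolding sigma_hmor_def splitter_def hc_commute(1) [OF vc_Hom [OF L.poly_act_Hom e_act_Hom] e_act_Hom, symmetric]
    by (rule Rep_vc [OF Rep_vc [OF 1 Rep_e_left] Rep_vc [OF 2 Rep_D]])
qed

lemma Rep_lambda:
  assumes "\<alpha> \<in> Parts a b"
  shows "Rep (lambda_hmor n a b \<alpha>)
    (\<lambda>f. of_int (sgn_hat b \<alpha>) * Eop 0 (a + b) (Eop 0 a (schur_hat a b \<alpha> * Eop a b f)))"
proof -
  note t = poly_act_left [OF trunc_schur [OF Parts_nth(1) [OF hat_part_Parts [OF assms]]], where 'k = 'k]
  have 1: "Rep (lid (poly_act n b (schur (hat_part b \<alpha>)) \<bullet> e_act n b)) (\<lambda>f. schur_hat a b \<alpha> * Eop a b f)"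
    unfolding hc_left_mult [OF R.poly_act_Hom e_act_Hom] t by (rule Rep_vc [OF Rep_poly Rep_e_left])
  show ?thesis
    unfolding lambda_hmor_def merger_def
      hc_commute(1) [OF e_act_Hom vc_Hom [OF R.poly_act_Hom e_act_Hom], symmetric]
    by (rule Rep_sign [OF Rep_vc [OF Rep_e Rep_vc [OF Rep_e_right 1]]])
qed

end

section \<open>Degrees\<close>

lemma hhomI: "wf_tm t \<Longrightarrow> homog t d \<Longrightarrow> abs_hmor t \<in> hhom (wt t) (src t) (tgt t) d"
  by (auto simp: hhom_def)

lemma hhom_hzero: "wsh V = wsh W \<Longrightarrow> hzero n V W \<in> hhom n V W d"
  using hhomI [of "Zero n V W" d] by (simp add: hzero.abs_eq homog.intros)

lemma hhom_hid: "hid n W \<in> hhom n W W 0"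
  using hhomI [of "Id n W" 0] by (simp add: hid.abs_eq homog.intros)

lemma hhom_hdot: "hdot n \<in> hhom n (Ew 1) (Ew 1) 2"
  using hhomI [of "Dot n" 2] by (simp add: hdot.abs_eq homog.intros)

lemma hhom_hcross: "hcross n \<in> hhom n (Ew 2) (Ew 2) (- 2)"
  using hhomI [of "Cross n" "- 2"] by (simp add: hcross.abs_eq homog.intros numeral_2_eq_2)

lemma hhom_hadd: "f \<in> hhom n V W d \<Longrightarrow> g \<in> hhom n V W d \<Longrightarrow> hadd f g \<in> hhom n V W d"
  unfolding hhom_def
  by (auto simp: hadd.abs_eq intro!: image_eqI [OF HOL.refl] homog.intros)

lemma hhom_hscale: "f \<in> hhom n V W d \<Longrightarrow> hscale c f \<in> hhom n V W d"
  unfolding hhom_def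
  by (auto simp: hscale.abs_eq intro!: image_eqI [OF HOL.refl] homog.intros)

lemma hhom_vc: "f \<in> hhom n V' W d \<Longrightarrow> g \<in> hhom n V V' d' \<Longrightarrow> f \<bullet> g \<in> hhom n V W (d + d')"
  unfolding hhom_def
  by (auto simp: vc.abs_eq intro!: image_eqI [OF HOL.refl] homog.intros)

lemma hhom_hc: "f \<in> hhom (n + wsh V') V W d \<Longrightarrow> g \<in> hhom n V' W' d' \<Longrightarrow>
    f \<diamondop> g \<in> hhom n (V @ V') (W @ W') (d + d')"
  unfolding hhom_def
  by (auto simp: hc.abs_eq intro!: image_eqI [OF HOL.refl] homog.intros)

abbreviation EndD :: "int \<Rightarrow> nat \<Rightarrow> int \<Rightarrow> 'k::{comm_ring,monoid_mult} hmor set" where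
  "EndD n N d \<equiv> hhom n (Ew N) (Ew N) d"

lemma EndD_hc: "z \<in> EndD (n + 2 * int b) a d \<Longrightarrow> z' \<in> EndD n b d' \<Longrightarrow> z \<diamondop> z' \<in> EndD n (a + b) (d + d')"
  using hhom_hc [of z n "Ew b" "Ew a" "Ew a" d z' "Ew b" d'] by (simp add: replicate_add)

lemma EndD_place: "z \<in> EndD (n + 2 * int r) L d \<Longrightarrow> place n i L r z \<in> EndD n (i + L + r) d"
  unfolding place_def using EndD_hc [OF hhom_hid EndD_hc [OF _ hhom_hid], of z n r L d i] by (simp add: add.assoc)

lemma EndD_x:
  assumes "i < N"
  shows "x_act n N i \<in> EndD n N 2"
proof -
  have "i + 1 + (N - 1 - i) = N" using assms by simp
  then show ?thesis
    using EndD_place [where i = i and r = "N - 1 - i", OF hhom_hdot] by (simp only: x_act_place [OF assms])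
qed

lemma EndD_d:
  assumes "Suc i < N"
  shows "d_act n N i \<in> EndD n N (- 2)"
proof -
  have "i + 2 + (N - 2 - i) = N" using assms by simp
  then show ?thesis
    using EndD_place [where i = i and r = "N - 2 - i", OF hhom_hcross] by (simp only: d_act_place [OF assms])
qed

lemma EndD_hprod: "(\<And>z. z \<in> set zs \<Longrightarrow> z \<in> EndD n N d) \<Longrightarrow> hprod n N zs \<in> EndD n N (d * int (length zs))"
proof (induction zs)
  case (Cons z zs)
  then have "z \<bullet> hprod n N zs \<in> EndD n N (d + d * int (length zs))" by (intro hhom_vc) auto
  then show ?case by (simp add: hprod_def algebra_simps)
qed (simp add: hprod_def hhom_hid)

lemma EndD_monom: "(monom_act n N m :: 'k::{comm_ring,monoid_mult} hmor) \<in> EndD n N (2 * int (\<Sum>i<N. m i))"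
proof -
  let ?zs = "concat (map (\<lambda>i. replicate (m i) (x_act n N i :: 'k hmor)) [0..<N])"
  have "length ?zs = (\<Sum>i<N. m i)"
    by (induction N) (simp_all add: length_concat interv_sum_list_conv_sum_set_nat atLeast0LessThan comp_def)
  moreover have "hprod n N ?zs \<in> EndD n N (2 * int (length ?zs))"
    by (rule EndD_hprod) (auto simp: EndD_x split: if_splits)
  ultimately show ?thesis unfolding monom_act_def by simp
qed

text \<open>Only variables with index below \<open>N\<close> are counted, in line with
  \<open>poly_act\<close>, where the others act as the identity. The degree is an integer so that
  divided differences can lower it without restriction; a negative degree forces the polynomial to
  be zero.\<close>

definition hom_deg :: "nat \<Rightarrow> int \<Rightarrow> mpoly \<Rightarrow> bool" where
  "hom_deg N d p \<longleftrightarrow> (\<forall>m\<in>keys p. int (\<Sum>i<N. lookup m i) = d)"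

lemma EndD_poly:
  assumes "hom_deg N d p"
  shows "(poly_act n N p :: 'k::{comm_ring,monoid_mult} hmor) \<in> EndD n N (2 * d)"
proof -
  interpret E_power n N "TYPE('k)" .
  show ?thesis
  proof (rule poly_act_closed)
    fix m and y :: "'k hmor" assume "m \<in> keys p" "y \<in> EndD n N (2 * d)"
    then show "hadd (hscale (int_scalar (lookup p m)) (monom_act n N (lookup m))) y
        \<in> EndD n N (2 * d)"
      using assms EndD_monom [of n N "lookup m", where 'k = 'k]
      by (auto simp: hom_deg_def intro!: hhom_hadd hhom_hscale)
  qed (simp add: hhom_hzero)
qed

lemma hom_deg_add: "hom_deg N d p \<Longrightarrow> hom_deg N d q \<Longrightarrow> hom_deg N d (p + q)"
  using keys_add [of p q] by (auto simp: hom_deg_def)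

lemma hom_deg_0: "hom_deg N d 0"
  by (simp add: hom_deg_def)

lemma hom_deg_sum: "(\<And>x. x \<in> A \<Longrightarrow> hom_deg N d (f x)) \<Longrightarrow> hom_deg N d (\<Sum>x\<in>A. f x)"
  by (induction A rule: infinite_finite_induct) (simp_all add: hom_deg_add hom_deg_0)

lemma hom_deg_mult: "hom_deg N d p \<Longrightarrow> hom_deg N e q \<Longrightarrow> hom_deg N (d + e) (p * q)"
  using keys_mult [of p q] by (fastforce simp: hom_deg_def lookup_add sum.distrib)

lemma hom_deg_of_int: "hom_deg N 0 (of_int c)"
proof -
  have "Poly_Mapping.single 0 (of_int c :: int) = (of_int c :: mpoly)" by (rule single_of_int)
  then have "(of_int c :: mpoly) = Poly_Mapping.single 0 c" by simp
  then show ?thesis by (simp add: hom_deg_def)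
qed

lemma hom_deg_1: "hom_deg N 0 1"
  using hom_deg_of_int [of N 1] by simp

lemma hom_deg_int_mult: "hom_deg N d p \<Longrightarrow> hom_deg N d (of_int c * p)"
  using hom_deg_mult [OF hom_deg_of_int] by force

lemma hom_deg_X: "hom_deg N (if i < N then 1 else 0) (X i)"
  by (auto simp: hom_deg_def Xvar_def lookup_single when_def)

lemma mpoly_expand: "(p :: mpoly) = (\<Sum>m\<in>keys p. of_int (lookup p m) * Poly_Mapping.single m 1)"
  using subst_id [of p] unfolding subst_def mono_prod [symmetric] by simp

lemma dd_int_mult: "dd i (of_int c * f) = of_int c * dd i f"
  by (simp add: dd_mult)

lemma dd_sum: "dd i (\<Sum>x\<in>A. f x) = (\<Sum>x\<in>A. dd i (f x))"
  by (induction A rule: infinite_finite_induct) (simp_all add: dd_add)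

text \<open>The twisted Leibniz rule mixes \<open>p\<close>, \<open>act (st i) p\<close> and
  \<open>dd i p\<close>, so the degrees of all three are carried along in \<open>Q\<close>. This
  joint property is multiplicative and holds for variables, hence for monomials.\<close>

lemma hom_deg_dd:
  assumes "Suc i < N" and p: "hom_deg N d p"
  shows "hom_deg N (d - 1) (dd i p)"
proof -
  define Q where "Q d p \<longleftrightarrow> hom_deg N (d - 1) (dd i p) \<and> hom_deg N d (act (st i) p) \<and> hom_deg N d p" for d p
  have mult: "Q (d + e) (p * q)" if "Q d p" "Q e q" for d e p q
    using that hom_deg_mult [of N "d - 1" "dd i p" e q] hom_deg_mult [of N d "act (st i) p" "e - 1" "dd i q"]
    by (auto simp: Q_def dd_mult hom_deg_mult algebra_simps intro!: hom_deg_add)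
  have one: "Q 0 1" by (simp add: Q_def hom_deg_0 hom_deg_1)
  have X: "Q (if j < N then 1 else 0) (X j)" for j
  proof -
    have "hom_deg N (if j < N then 1 else 0) (X (st i j))"
      using hom_deg_X [of N "st i j"] assms by (auto simp: Transposition.transpose_def split: if_splits)
    moreover have "hom_deg N ((if j < N then 1 else 0) - 1) (dd i (X j))"
    proof (cases "j = i \<or> j = Suc i")
      case True
      then show ?thesis using assms hom_deg_1 hom_deg_of_int [of N "- 1"] by auto
    qed (auto simp: hom_deg_0)
    ultimately show ?thesis using hom_deg_X [of N j] by (simp add: Q_def)
  qed
  have pw: "Q (if j < N then int k else 0) (X j ^ k)" for j k
  proof (induction k)
    case (Suc k)
    from mult [OF X [of j] this] show ?case by (auto split: if_splits simp: add.commute)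
  qed (use one in auto)
  have mono: "Q (int (\<Sum>i<N. lookup m i)) (mono m)" for m
  proof -
    have "Q (\<Sum>j\<in>A. if j < N then int (lookup m j) else 0) (\<Prod>j\<in>A. X j ^ lookup m j)"
      if "finite A" for A
      using that by (induction A) (simp_all add: one mult pw)
    moreover have "(\<Sum>j\<in>keys m. if j < N then int (lookup m j) else 0)
        = int (\<Sum>i<N. lookup m i)"
    proof -
      have "(\<Sum>j\<in>keys m. if j < N then int (lookup m j) else 0)
          = (\<Sum>j\<in>keys m \<inter> {..<N}. int (lookup m j))"
        by (simp add: sum.inter_restrict)
      also have "\<dots> = (\<Sum>j<N. int (lookup m j))"
        by (rule sum.mono_neutral_left) (auto simp: in_keys_iff)
      finally show ?thesis by simp
    qed
    ultimately show ?thesis using mono_prod [of m] by (metis finite_keys)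
  qed
  have "dd i p = (\<Sum>m\<in>keys p. of_int (lookup p m) * dd i (mono m))"
    by (subst mpoly_expand) (simp add: dd_sum dd_int_mult)
  moreover have "hom_deg N (d - 1) (dd i (mono m))" if "m \<in> keys p" for m
    using mono [of m] p that by (auto simp: hom_deg_def [of _ _ p] Q_def)
  ultimately show ?thesis by (simp add: hom_deg_sum hom_deg_int_mult)
qed

lemma length_w0: "length (w0 N) = (\<Sum>i<N. i)"
  by (induction N) (simp_all add: w0_Suc)

lemma hom_deg_Dp:
  assumes "hom_deg N d p"
  shows "hom_deg N (d - int (\<Sum>i<N. i)) (Dp 0 N p)"
proof -
  have "hom_deg N (d - int (length js)) (foldr (\<lambda>i. dd (0 + i)) js p)" if "\<And>i. i \<in> set js \<Longrightarrow> Suc i < N" for js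
    using that
  proof (induction js)
    case (Cons j js)
    then have "hom_deg N (d - int (length js) - 1) (dd j (foldr (\<lambda>i. dd (0 + i)) js p))"
      by (intro hom_deg_dd) auto
    then show ?case by (simp add: algebra_simps)
  qed (simp add: assms)
  from this [of "w0 N"] show ?thesis by (simp add: Dp_def length_w0 w0_bound)
qed

text \<open>The monomial with exponents \<alpha> + \<delta> exceeds the size of \<alpha> by the sum
  of the staircase, which equals the number of divided differences in \<open>Dp\<close>.\<close>

lemma hom_deg_schur:
  assumes "length \<alpha> = N"
  shows "hom_deg N (int (sum_list \<alpha>)) (schur \<alpha>)"
proof -
  have pw: "hom_deg N (int k) (X i ^ k)" if "i < N" for i k
  proof (induction k)
    case (Suc k)
    with hom_deg_mult [OF hom_deg_X [of N i]] show ?case using that by (fastforce simp: add.commute)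
  qed (simp add: hom_deg_1)
  have "hom_deg N (int (\<Sum>i<j. e i)) (mon 0 e j)" if "j \<le> N" for j e
    using that
  proof (induction j)
    case (Suc j)
    then have "hom_deg N (int (\<Sum>i<j. e i) + int (e j)) (mon 0 e j * X j ^ e j)"
      by (intro hom_deg_mult pw) auto
    then show ?case by (simp add: mon_def)
  qed (simp add: mon_def hom_deg_1)
  from hom_deg_Dp [OF this [OF order_refl, of "expo \<alpha>"]]
  have "hom_deg N (int (\<Sum>i<N. expo \<alpha> i) - int (\<Sum>i<N. i)) (schur \<alpha>)"
    by (simp only: schur_eq_Dp [OF assms])
  moreover have "(\<Sum>i<N. expo \<alpha> i) = sum_list \<alpha> + (\<Sum>i<N. i)"
  proof -
    have "(\<Sum>i<N. expo \<alpha> i) = (\<Sum>i<N. \<alpha> ! i) + (\<Sum>i<N. N - Suc i)"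
      unfolding expo_def assms by (subst sum.distrib [symmetric]) simp
    then show ?thesis
      using sum.nat_diff_reindex [of "\<lambda>i. i" N] by (simp add: sum_list_sum_nth assms atLeast0LessThan)
  qed
  ultimately show ?thesis by simp
qed

lemma EndD_delta: "delta_act n N \<in> EndD n N (2 * int (\<Sum>i<N. i))"
  using EndD_monom [of n N "\<lambda>i. N - 1 - i"] sum.nat_diff_reindex [of "\<lambda>i. i" N]
  by (simp add: delta_act_def)

lemma EndD_D: "(D_act n N :: 'k::{comm_ring,monoid_mult} hmor) \<in> EndD n N (- 2 * int (\<Sum>i<N. i))"
proof -
  have "hprod n N (map (d_act n N :: nat \<Rightarrow> 'k hmor) (w0 N))
      \<in> EndD n N (- 2 * int (length (map (d_act n N :: nat \<Rightarrow> 'k hmor) (w0 N))))"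
    by (rule EndD_hprod) (auto simp: EndD_d dest: w0_bound)
  then show ?thesis by (simp add: D_act_w0 length_w0)
qed

lemma EndD_e: "e_act n N \<in> EndD n N 0"
  using hhom_vc [OF EndD_delta EndD_D, of n N] by (simp add: e_act_def)

text \<open>The term \<open>a * b\<close> explains the grading: the splitter has degree -2ab, of
  which one half is the explicit shift and the other half comes from the shifts built into the
  divided powers.\<close>

lemma tri_add: "(\<Sum>i<a + b. i) = (\<Sum>i<a. i) + (\<Sum>i<b. i) + a * (b :: nat)"
  by (induction b) simp_all

lemma tri: "(N :: nat) * (N - 1) div 2 = (\<Sum>i<N. i)"
proof -
  have "2 * (\<Sum>i<N. i) = N * (N - 1)"
  proof (induction N)
    case (Suc N) then show ?case by (cases N) simp_all
  qed simp
  then show ?thesis by (metis nonzero_mult_div_cancel_left zero_neq_numeral)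
qed

text \<open>Double counting of the pairs \<open>i\<close>, \<open>j\<close> with
  \<open>\<alpha> ! i + j < b\<close>: by columns they give the hatted partition, by rows the cells
  of the box outside \<alpha>.\<close>

lemma sum_hat_part:
  assumes \<alpha>: "\<alpha> \<in> Parts a b"
  shows "sum_list \<alpha> + sum_list (hat_part b \<alpha>) = a * b"
proof -
  have count: "card {i. i < m \<and> Q i} = (\<Sum>i<m. if Q i then 1 else 0)" for m :: nat and Q
  proof -
    have "{i. i < m \<and> Q i} = {i \<in> {..<m}. Q i}" by auto
    then show ?thesis by (simp only: card_eq_sum sum.inter_filter [OF finite_lessThan])
  qed
  have "sum_list (hat_part b \<alpha>) = (\<Sum>j<b. card {i. i < a \<and> \<alpha> ! i + j < b})"
    using hat_part_nth [OF \<alpha>] Parts_nth(1) [OF hat_part_Parts [OF \<alpha>]]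
    by (simp add: sum_list_sum_nth atLeast0LessThan)
  also have "\<dots> = (\<Sum>j<b. \<Sum>i<a. if \<alpha> ! i + j < b then 1 else 0)"
    by (simp only: count)
  also have "\<dots> = (\<Sum>i<a. \<Sum>j<b. if \<alpha> ! i + j < b then 1 else 0)"
    by (rule sum.swap)
  also have "\<dots> = (\<Sum>i<a. b - \<alpha> ! i)"
  proof (rule sum.cong [OF HOL.refl])
    fix i
    have "{j. j < b \<and> \<alpha> ! i + j < b} = {..<b - \<alpha> ! i}" by auto
    then show "(\<Sum>j<b. if \<alpha> ! i + j < b then 1 else 0) = b - \<alpha> ! i"
      unfolding count [symmetric] by simp
  qed
  finally have "sum_list \<alpha> + sum_list (hat_part b \<alpha>) = (\<Sum>i<a. \<alpha> ! i + (b - \<alpha> ! i))"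
    using Parts_nth(1) [OF \<alpha>] by (simp add: sum_list_sum_nth atLeast0LessThan sum.distrib)
  also have "\<dots> = (\<Sum>i<a. b)"
    using Parts_nth(2) [OF \<alpha>] by (intro sum.cong) auto
  finally show ?thesis by simp
qed

lemma EndD_sigma:
  assumes "\<alpha> \<in> Parts a b"
  shows "(sigma_hmor n a b \<alpha> :: 'k::{comm_ring,monoid_mult} hmor)
    \<in> EndD n (a + b) (2 * int (sum_list \<alpha>) - 2 * int (a * b))"
proof -
  note s = EndD_poly [OF hom_deg_schur [OF Parts_nth(1) [OF assms]], of "n + 2 * int b", where 'k = 'k]
  have "(sigma_hmor n a b \<alpha> :: 'k hmor) \<in> EndD n (a + b) ((2 * int (sum_list \<alpha>) + 0 + 0)
      + (2 * int (\<Sum>i<a. i) + 2 * int (\<Sum>i<b. i) + - 2 * int (\<Sum>i<a + b. i)))"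
    unfolding sigma_hmor_def splitter_def
    by (intro hhom_vc [OF EndD_hc [OF hhom_vc [OF s]] hhom_vc [OF EndD_hc]] EndD_e EndD_delta EndD_D)
  then show ?thesis by (simp add: tri_add algebra_simps)
qed

lemma EndD_lambda:
  assumes "\<alpha> \<in> Parts a b"
  shows "(lambda_hmor n a b \<alpha> :: 'k::{comm_ring,monoid_mult} hmor)
    \<in> EndD n (a + b) (2 * int (a * b) - 2 * int (sum_list \<alpha>))"
proof -
  note s = EndD_poly [OF hom_deg_schur [OF Parts_nth(1) [OF hat_part_Parts [OF assms]]], of n, where 'k = 'k]
  have "(lambda_hmor n a b \<alpha> :: 'k hmor) \<in> EndD n (a + b) (0 + (0 + (2 * int (sum_list (hat_part b \<alpha>)) + 0)))"
    unfolding lambda_hmor_def merger_def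
    by (intro hhom_hscale hhom_vc [OF _ EndD_hc [OF _ hhom_vc [OF s]]] EndD_e)
  moreover have "int (a * b) = int (sum_list \<alpha>) + int (sum_list (hat_part b \<alpha>))"
    using arg_cong [OF sum_hat_part [OF assms], of int] by simp
  ultimately show ?thesis by simp
qed

section \<open>The decomposition in the Karoubi envelope\<close>

definition mat :: "nat \<Rightarrow> nat \<Rightarrow> (nat \<Rightarrow> nat \<Rightarrow> 'x) \<Rightarrow> 'x list list" where
  "mat p q f = map (\<lambda>i. map (f i) [0..<q]) [0..<p]"

lemma mat_nth [simp]: "i < p \<Longrightarrow> j < q \<Longrightarrow> mat p q f ! i ! j = f i j"
  by (simp add: mat_def)

lemma mat_length [simp]: "length (mat p q f) = p" "i < p \<Longrightarrow> length (mat p q f ! i) = q"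
  by (simp_all add: mat_def)

lemma Dp_zero [simp]: "Dp k N 0 = 0"
  using Dp_sym_mult [of N k 0 0] by simp

lemma Dp_int_mult: "Dp k N (of_int c * f) = of_int c * Dp k N f"
  by (rule Dp_sym_mult) simp

lemma Eop_zero [simp]: "Eop k N 0 = 0"
  by (simp add: Eop_def)

lemma Eop_int_mult: "Eop k N (of_int c * f) = of_int c * Eop k N f"
  by (simp add: Eop_def Dp_int_mult mult.left_commute)

context E_split
begin

text \<open>All 1-morphisms in the statement are sums of shifts of the single word \<E>^(a+b), so
  every 2-morphism between them is a matrix over one endomorphism algebra.\<close>

abbreviation obj :: "int list \<Rightarrow> one_mor" where
  "obj ts \<equiv> OneMor n (n + 2 * int (a + b)) (map (Pair (Ew (a + b))) ts)"

abbreviation mor :: "int list \<Rightarrow> int list \<Rightarrow> (nat \<Rightarrow> nat \<Rightarrow> 'k hmor) \<Rightarrow> 'k two_mor" where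
  "mor ts ts' f \<equiv> TwoMor (obj ts) (obj ts') (mat (length ts') (length ts) f)"

lemma khomI: "is_kob A \<Longrightarrow> is_kob B \<Longrightarrow> f \<bullet>\<^sub>2 snd A = f \<Longrightarrow> snd B \<bullet>\<^sub>2 f = f \<Longrightarrow>
    f \<in> uhom (fst A) (fst B) \<Longrightarrow> f \<in> khom A B"
  by (simp add: khom_def)

abbreviation zero :: "'k hmor" where "zero \<equiv> hzero n (Ew (a + b)) (Ew (a + b))"

lemma Rep_cong: "Rep z \<phi> \<Longrightarrow> (\<And>f. \<phi> f = \<psi> f) \<Longrightarrow> Rep z \<psi>"
  using ext [of \<phi> \<psi>] by auto

lemma Rep_foldr:
  "(\<And>j. j \<in> set js \<Longrightarrow> Rep (z j) (\<phi> j)) \<Longrightarrow> Rep (foldr hadd (map z js) zero) (\<lambda>f. \<Sum>j\<leftarrow>js. \<phi> j f)"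
proof (induction js)
  case (Cons j js)
  then have "Rep (hadd (z j) (foldr hadd (map z js) zero)) (\<lambda>f. \<phi> j f + (\<Sum>j\<leftarrow>js. \<phi> j f))"
    by (intro Rep_hadd) auto
  then show ?case by simp
qed (simp add: Rep_hzero)

text \<open>Each entry of the composite is determined by its operator, by \<open>Rep_unique\<close>,
  so an equation between matrices of 2-morphisms reduces to one between matrices of operators on
  integer polynomials.\<close>

lemma ucomp_mor:
  assumes g: "\<And>i j. i < length rs \<Longrightarrow> j < length qs \<Longrightarrow> Rep (g i j) (\<gamma> i j)"
    and f: "\<And>j k. j < length qs \<Longrightarrow> k < length ps \<Longrightarrow> Rep (f j k) (\<phi> j k)"
    and h: "\<And>i k. i < length rs \<Longrightarrow> k < length ps \<Longrightarrow> Rep (h i k) (\<lambda>x. \<Sum>j<length qs. \<gamma> i j (\<phi> j k x))"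
  shows "mor qs rs g \<bullet>\<^sub>2 mor ps qs f = mor ps rs h"
proof -
  let ?c = "\<lambda>i k. foldr hadd (map (\<lambda>j. mat (length rs) (length qs) g ! i ! j \<bullet> mat (length qs) (length ps) f ! j ! k) [0..<length qs]) zero"
  have "?c i k = h i k" if ik: "i < length rs" "k < length ps" for i k
  proof (rule Rep_unique [OF _ h [OF ik]])
    have "Rep (?c i k)
      (\<lambda>x. \<Sum>j\<leftarrow>[0..<length qs]. \<gamma> i j (\<phi> j k x))"
    proof (rule Rep_foldr)
      fix j assume "j \<in> set [0..<length qs]"
      then show "Rep (mat (length rs) (length qs) g ! i ! j \<bullet> mat (length qs) (length ps) f ! j ! k)
          (\<lambda>x. \<gamma> i j (\<phi> j k x))"
        using Rep_vc [OF g [of i j] f [of j k]] ik by simp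
    qed
    then show "Rep (?c i k)
      (\<lambda>x. \<Sum>j<length qs. \<gamma> i j (\<phi> j k x))"
      by (simp add: interv_sum_list_conv_sum_set_nat atLeast0LessThan)
  qed
  then show ?thesis
    unfolding ucomp_def by (auto simp: mat_def [of _ _ h] intro!: map_cong)
qed

lemma mor_uhom:
  assumes "\<And>i j. i < length qs \<Longrightarrow> j < length ps \<Longrightarrow> f i j \<in> EndD n (a + b) (ps ! j - qs ! i)"
  shows "mor ps qs f \<in> uhom (obj ps) (obj qs)"
  using assms by (auto simp: uhom_def is_one_mor_def)

text \<open>The total shift of the summand for \<alpha>, including the one built into the divided
  power; \<open>shift_B\<close> is its counterpart for the product of two divided powers.\<close>

definition shift_N :: "nat list \<Rightarrow> int" where
  "shift_N \<alpha> = 2 * int (sum_list \<alpha>) - int (a * b) - int (\<Sum>i<a + b. i)"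

definition shift_B :: int where
  "shift_B = - int (\<Sum>i<a. i) - int (\<Sum>i<b. i)"

abbreviation eN :: "'k hmor" where "eN \<equiv> e_act n (a + b)"
abbreviation ee :: "'k hmor" where "ee \<equiv> e_act (n + 2 * int b) a \<diamondop> e_act n b"

abbreviation KB :: "'k kob" where "KB \<equiv> Ediv a (n + 2 * int b) \<diamondop>\<^sub>K Ediv b n"
abbreviation KN :: "nat list \<Rightarrow> 'k kob" where
  "KN \<alpha> \<equiv> kshift (2 * int (sum_list \<alpha>) - int (a * b)) (Ediv (a + b) n)"

lemma mat_1: "mat (Suc 0) (Suc 0) f = [[f 0 0]]"
  by (simp add: mat_def)

lemma KB_eq: "KB = (obj [shift_B], mor [shift_B] [shift_B] (\<lambda>_ _. ee))"
  unfolding kcomp_def Ediv_def Ediv1_def hcomp1_def hcomp2_def tri shift_B_def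
  by (simp add: replicate_add mat_1)

lemma KN_eq: "KN \<alpha> = (obj [shift_N \<alpha>], mor [shift_N \<alpha>] [shift_N \<alpha>] (\<lambda>_ _. eN))"
  unfolding kshift_def Ediv_def Ediv1_def shift1_def shift2_def tri shift_N_def
  by (simp add: mat_1)

lemma sigma_map_eq: "sigma_map n a b \<alpha> = mor [shift_N \<alpha>] [shift_B] (\<lambda>_ _. sigma_hmor n a b \<alpha>)"
proof -
  have "shift1 (2 * int (sum_list \<alpha>) - int (a * b)) (Ediv1 (a + b) n) = obj [shift_N \<alpha>]"
    using KN_eq [of \<alpha>] by (simp add: kshift_def Ediv_def)
  moreover have "Ediv1 a (n + 2 * int b) \<diamondop>\<^sub>1 Ediv1 b n = obj [shift_B]"
    using KB_eq by (simp add: kcomp_def Ediv_def)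
  ultimately show ?thesis by (simp add: sigma_map_def sigma_hmor_def mat_1)
qed

lemma lambda_map_eq: "lambda_map n a b \<alpha> = mor [shift_B] [shift_N \<alpha>] (\<lambda>_ _. lambda_hmor n a b \<alpha>)"
proof -
  have "shift1 (2 * int (sum_list \<alpha>) - int (a * b)) (Ediv1 (a + b) n) = obj [shift_N \<alpha>]"
    using KN_eq [of \<alpha>] by (simp add: kshift_def Ediv_def)
  moreover have "Ediv1 a (n + 2 * int b) \<diamondop>\<^sub>1 Ediv1 b n = obj [shift_B]"
    using KB_eq by (simp add: kcomp_def Ediv_def)
  ultimately show ?thesis by (simp add: lambda_map_def lambda_hmor_def mat_1)
qed

lemma KA_eq:
  "kdsum n (n + 2 * int (a + b)) (map KN \<alpha>s)
    = (obj (map shift_N \<alpha>s), mor (map shift_N \<alpha>s) (map shift_N \<alpha>s) (\<lambda>i j. if i = j then eN else zero))"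
proof -
  let ?m = "n + 2 * int (a + b)"
  let ?fs = "map (\<lambda>\<alpha>. mor [shift_N \<alpha>] [shift_N \<alpha>] (\<lambda>_ _. eN)) \<alpha>s"
  have d: "dsum1 n ?m (map (\<lambda>\<alpha>. obj [shift_N \<alpha>]) \<alpha>s) = obj (map shift_N \<alpha>s)"
    by (simp add: dsum1_def comp_def)
  let ?row = "\<lambda>i. map (\<lambda>k. concat (map (\<lambda>j. if i = j then entries (?fs ! i) ! k
              else [hzero n V (fst (summands (cod2 (?fs ! i)) ! k)). (V, s) \<leftarrow> summands (dom2 (?fs ! j))])
          [0..<length ?fs])) [0..<length (summands (cod2 (?fs ! i)))]"
  have "map ?row [0..<length ?fs]
    = map (\<lambda>i. [map (\<lambda>j. if i = j then eN else zero) [0..<length ?fs]]) [0..<length ?fs]"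
  proof (rule map_cong [OF HOL.refl])
    fix i assume i: "i \<in> set [0..<length ?fs]"
    have one: "[0..<1] = [0]" by simp
    have len: "length (summands (cod2 (?fs ! i))) = 1" using i by simp
    have "map (\<lambda>j. if i = j then entries (?fs ! i) ! 0
              else [hzero n V (fst (summands (cod2 (?fs ! i)) ! 0)). (V, s) \<leftarrow> summands (dom2 (?fs ! j))])
          [0..<length ?fs] = map (\<lambda>j. [if i = j then eN else zero]) [0..<length ?fs]"
      by (rule map_cong [OF HOL.refl]) (use i in \<open>auto simp: mat_1\<close>)
    then show "?row i
      = [map (\<lambda>j. if i = j then eN else zero) [0..<length ?fs]]"
      unfolding len one by (simp only: list.map concat_map_singleton)
  qed
  note block = this
  have "entries (dsum2 n ?m ?fs) = concat (map (\<lambda>i. [map (\<lambda>j. if i = j then eN else zero) [0..<length ?fs]]) [0..<length ?fs])"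
    unfolding dsum2_def two_mor.sel block ..
  also have "\<dots> = mat (length \<alpha>s) (length \<alpha>s) (\<lambda>i j. if i = j then eN else zero)"
    unfolding concat_map_singleton by (simp add: mat_def)
  finally have "entries (dsum2 n ?m ?fs) = mat (length \<alpha>s) (length \<alpha>s) (\<lambda>i j. if i = j then eN else zero)" .
  moreover have "dom2 (dsum2 n ?m ?fs) = obj (map shift_N \<alpha>s)" "cod2 (dsum2 n ?m ?fs) = obj (map shift_N \<alpha>s)"
    using d by (simp_all add: dsum2_def comp_def)
  ultimately have "dsum2 n ?m ?fs = mor (map shift_N \<alpha>s) (map shift_N \<alpha>s) (\<lambda>i j. if i = j then eN else zero)"
    by (simp add: two_mor.expand)
  then show ?thesis
    unfolding kdsum_def KN_eq map_map comp_def fst_conv snd_conv d by simp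
qed

lemma out_eq:
  "out_of_dsum n (n + 2 * int (a + b)) (fst KB) (map (sigma_map n a b) \<alpha>s)
    = mor (map shift_N \<alpha>s) [shift_B] (\<lambda>_ j. sigma_hmor n a b (\<alpha>s ! j))"
proof -
  have "map (\<lambda>\<alpha>. sigma_hmor n a b \<alpha> :: 'k hmor) \<alpha>s = map (\<lambda>j. sigma_hmor n a b (\<alpha>s ! j)) [0..<length \<alpha>s]"
    by (rule nth_equalityI) simp_all
  then show ?thesis
    by (simp add: out_of_dsum_def dsum1_def KB_eq sigma_map_eq comp_def mat_def)
qed

lemma into_eq:
  "into_dsum n (n + 2 * int (a + b)) (fst KB) (map (lambda_map n a b) \<alpha>s)
    = mor [shift_B] (map shift_N \<alpha>s) (\<lambda>i _. lambda_hmor n a b (\<alpha>s ! i))"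
proof -
  have "map (\<lambda>\<alpha>. [lambda_hmor n a b \<alpha> :: 'k hmor]) \<alpha>s = map (\<lambda>j. [lambda_hmor n a b (\<alpha>s ! j)]) [0..<length \<alpha>s]"
    by (rule nth_equalityI) simp_all
  then show ?thesis
    by (simp add: into_dsum_def dsum1_def KB_eq lambda_map_eq comp_def mat_def)
qed

definition sigma_op :: "nat list \<Rightarrow> mpoly \<Rightarrow> mpoly" where
  "sigma_op \<alpha> f = schur \<alpha> * Eop 0 a (Eop a b (delta 0 a * (delta a b * Dp 0 (a + b) f)))"

definition lambda_op :: "nat list \<Rightarrow> mpoly \<Rightarrow> mpoly" where
  "lambda_op \<alpha> f = of_int (sgn_hat b \<alpha>) * Eop 0 (a + b) (Eop 0 a (schur_hat a b \<alpha> * Eop a b f))"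

lemma Rep_sigma_op: "\<alpha> \<in> Parts a b \<Longrightarrow> Rep (sigma_hmor n a b \<alpha>) (sigma_op \<alpha>)"
  using Rep_sigma unfolding sigma_op_def [abs_def] .

lemma Rep_lambda_op: "\<alpha> \<in> Parts a b \<Longrightarrow> Rep (lambda_hmor n a b \<alpha>) (lambda_op \<alpha>)"
  using Rep_lambda unfolding lambda_op_def [abs_def] .

lemma sigma_op_0 [simp]: "sigma_op \<alpha> 0 = 0"
  by (simp add: sigma_op_def)

lemma sigma_op_int_mult: "sigma_op \<alpha> (of_int c * f) = of_int c * sigma_op \<alpha> f"
proof -
  have "delta 0 a * (delta a b * (of_int c * g)) = of_int c * (delta 0 a * (delta a b * g))" for g
    by (simp add: mult_ac)
  then show ?thesis by (simp only: sigma_op_def Dp_int_mult Eop_int_mult mult.left_commute)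
qed

text \<open>On the diagonal, the sign in \<open>lambda_op\<close> cancels the sign of the permuted
  staircase.\<close>

lemma lambda_op_sigma_op: "\<alpha> \<in> Parts a b \<Longrightarrow> \<beta> \<in> Parts a b \<Longrightarrow>
    lambda_op \<beta> (sigma_op \<alpha> f) = (if \<beta> = \<alpha> then Eop 0 (a + b) f else 0)"
  unfolding lambda_op_def sigma_op_def lambda_sigma_op by (simp flip: power_mult_distrib mult.assoc of_int_mult)

lemma sum_sigma_op_lambda_op: "(\<Sum>\<alpha>\<in>Parts a b. sigma_op \<alpha> (lambda_op \<alpha> f)) = Eop 0 a (Eop a b f)"
  unfolding lambda_op_def sigma_op_int_mult unfolding sigma_op_def by (rule sigma_lambda_op)

lemma sigma_op_Eop: "sigma_op \<alpha> (Eop 0 (a + b) f) = sigma_op \<alpha> f"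
  by (simp add: sigma_op_def Dp_Eop_top)

lemma ee_sigma_op: "\<alpha> \<in> Parts a b \<Longrightarrow> Eop 0 a (Eop a b (sigma_op \<alpha> f)) = sigma_op \<alpha> f"
  unfolding sigma_op_def by (rule E1E2_sigma_op)

lemma lambda_op_ee: "\<alpha> \<in> Parts a b \<Longrightarrow> lambda_op \<alpha> (Eop 0 a (Eop a b f)) = lambda_op \<alpha> f"
  unfolding lambda_op_def by (simp only: lambda_op_E1E2)

lemma Eop_lambda_op: "Eop 0 (a + b) (lambda_op \<alpha> f) = lambda_op \<alpha> f"
  by (simp add: lambda_op_def Eop_int_mult Eop_Eop del: of_int_power of_int_minus of_int_1)

lemma sigma_degree:
  "\<alpha> \<in> Parts a b \<Longrightarrow> (sigma_hmor n a b \<alpha> :: 'k hmor) \<in> EndD n (a + b) (shift_N \<alpha> - shift_B)"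
  using EndD_sigma [of \<alpha> a b n, where 'k = 'k] by (simp add: shift_N_def shift_B_def tri_add algebra_simps)

lemma lambda_degree:
  "\<alpha> \<in> Parts a b \<Longrightarrow> (lambda_hmor n a b \<alpha> :: 'k hmor) \<in> EndD n (a + b) (shift_B - shift_N \<alpha>)"
  using EndD_lambda [of \<alpha> a b n, where 'k = 'k] by (simp add: shift_N_def shift_B_def tri_add algebra_simps)

lemma ee_degree: "ee \<in> EndD n (a + b) 0"
  using EndD_hc [OF EndD_e EndD_e, of n b a] by simp

lemma KB_kob: "is_kob KB"
  unfolding is_kob_def KB_eq fst_conv snd_conv
  by (intro conjI mor_uhom ucomp_mor [OF Rep_ee Rep_ee Rep_cong [OF Rep_ee]])
    (simp_all add: ee_degree E1E2_idem)

context
  fixes \<alpha>s :: "nat list list"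
  \<comment> \<open>Inclusion leaves room for one-element lists, through which the statements about
    a single \<alpha> are obtained in \<open>sigma_map_khom\<close> and
    \<open>lambda_map_khom\<close>.\<close>
  assumes \<alpha>s: "set \<alpha>s \<subseteq> Parts a b"
begin

abbreviation KA :: "'k kob" where "KA \<equiv> kdsum n (n + 2 * int (a + b)) (map KN \<alpha>s)"

abbreviation "Smor \<equiv> mor (map shift_N \<alpha>s) [shift_B] (\<lambda>_ j. sigma_hmor n a b (\<alpha>s ! j))"
abbreviation "Lmor \<equiv> mor [shift_B] (map shift_N \<alpha>s) (\<lambda>i _. lambda_hmor n a b (\<alpha>s ! i))"

lemma nth_Parts: "i < length \<alpha>s \<Longrightarrow> \<alpha>s ! i \<in> Parts a b"
  using \<alpha>s by auto

lemma Rep_diag: "Rep (if i = j then eN else zero) (\<lambda>f. if i = j then Eop 0 (a + b) f else 0)"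
  using Rep_e Rep_hzero by simp

lemma KA_kob: "is_kob KA"
  unfolding is_kob_def KA_eq fst_conv snd_conv
proof (intro conjI mor_uhom ucomp_mor [OF Rep_diag Rep_diag Rep_cong [OF Rep_diag]])
  fix i j assume ij: "i < length (map shift_N \<alpha>s)" "j < length (map shift_N \<alpha>s)"
  show "(if i = j then eN else zero) \<in> EndD n (a + b) (map shift_N \<alpha>s ! j - map shift_N \<alpha>s ! i)"
    by (simp add: EndD_e hhom_hzero)
  show "(if i = j then Eop 0 (a + b) f else 0) =
      (\<Sum>l<length (map shift_N \<alpha>s). if i = l then Eop 0 (a + b) (if l = j then Eop 0 (a + b) f else 0) else 0)" for f
    using ij by (simp add: sum.delta Eop_Eop)
qed

lemma Smor_khom: "Smor \<in> khom KA KB"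
proof -
  have "Smor \<bullet>\<^sub>2 snd KA = Smor"
    unfolding KA_eq snd_conv
  proof (rule ucomp_mor [OF Rep_sigma_op [OF nth_Parts] Rep_diag Rep_cong [OF Rep_sigma_op [OF nth_Parts]]])
    fix k f assume "k < length (map shift_N \<alpha>s)"
    moreover have "sigma_op \<alpha> (if j = k then Eop 0 (a + b) f else 0) = (if j = k then sigma_op \<alpha> f else 0)" for \<alpha> j
      by (simp add: sigma_op_Eop)
    ultimately show "sigma_op (\<alpha>s ! k) f = (\<Sum>j<length (map shift_N \<alpha>s). sigma_op (\<alpha>s ! j) (if j = k then Eop 0 (a + b) f else 0))"
      by simp
  qed simp_all
  moreover have "snd KB \<bullet>\<^sub>2 Smor = Smor"
    unfolding KB_eq snd_conv
    by (rule ucomp_mor [OF Rep_ee Rep_sigma_op [OF nth_Parts] Rep_cong [OF Rep_sigma_op [OF nth_Parts]]])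
      (simp_all add: ee_sigma_op nth_Parts)
  moreover have "Smor \<in> uhom (fst KA) (fst KB)"
    unfolding KA_eq KB_eq fst_conv by (rule mor_uhom) (simp add: sigma_degree nth_Parts)
  ultimately show ?thesis by (intro khomI KA_kob KB_kob)
qed

lemma Lmor_khom: "Lmor \<in> khom KB KA"
proof -
  have "snd KA \<bullet>\<^sub>2 Lmor = Lmor"
    unfolding KA_eq snd_conv
  proof (rule ucomp_mor [OF Rep_diag Rep_lambda_op [OF nth_Parts] Rep_cong [OF Rep_lambda_op [OF nth_Parts]]])
    fix i f assume "i < length (map shift_N \<alpha>s)"
    then show "lambda_op (\<alpha>s ! i) f = (\<Sum>j<length (map shift_N \<alpha>s). if i = j then Eop 0 (a + b) (lambda_op (\<alpha>s ! j) f) else 0)"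
      by (simp add: Eop_lambda_op)
  qed simp_all
  moreover have "Lmor \<bullet>\<^sub>2 snd KB = Lmor"
    unfolding KB_eq snd_conv
    by (rule ucomp_mor [OF Rep_lambda_op [OF nth_Parts] Rep_ee Rep_cong [OF Rep_lambda_op [OF nth_Parts]]])
      (simp_all add: lambda_op_ee nth_Parts)
  moreover have "Lmor \<in> uhom (fst KB) (fst KA)"
    unfolding KA_eq KB_eq fst_conv by (rule mor_uhom) (simp add: lambda_degree nth_Parts)
  ultimately show ?thesis by (intro khomI KA_kob KB_kob)
qed

lemma Lmor_Smor:
  assumes "distinct \<alpha>s"
  shows "Lmor \<bullet>\<^sub>2 Smor = snd KA"
  unfolding KA_eq snd_conv
  by (rule ucomp_mor [OF Rep_lambda_op [OF nth_Parts] Rep_sigma_op [OF nth_Parts] Rep_cong [OF Rep_diag]])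
    (use assms in \<open>auto simp: lambda_op_sigma_op nth_Parts nth_eq_iff_index_eq\<close>)

lemma Smor_Lmor:
  assumes "distinct \<alpha>s" "set \<alpha>s = Parts a b"
  shows "Smor \<bullet>\<^sub>2 Lmor = snd KB"
  unfolding KB_eq snd_conv
proof (rule ucomp_mor [OF Rep_sigma_op [OF nth_Parts] Rep_lambda_op [OF nth_Parts] Rep_cong [OF Rep_ee]])
  fix f
  have "Eop 0 a (Eop a b f) = (\<Sum>\<alpha>\<leftarrow>\<alpha>s. sigma_op \<alpha> (lambda_op \<alpha> f))"
    by (simp add: sum_list_distinct_conv_sum_set assms sum_sigma_op_lambda_op)
  then show "Eop 0 a (Eop a b f) = (\<Sum>j<length (map shift_N \<alpha>s). sigma_op (\<alpha>s ! j) (lambda_op (\<alpha>s ! j) f))"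
    by (simp add: sum_list_sum_nth atLeast0LessThan)
qed simp_all

end

lemma KA_singleton: "KA [\<alpha>] = KN \<alpha>"
  by (subst KA_eq, subst KN_eq) (simp add: mat_1)

lemma sigma_map_khom: "\<alpha> \<in> Parts a b \<Longrightarrow> sigma_map n a b \<alpha> \<in> khom (KN \<alpha>) KB"
  using Smor_khom [of "[\<alpha>]"] by (simp only: KA_singleton sigma_map_eq) (simp add: mat_1)

lemma lambda_map_khom: "\<alpha> \<in> Parts a b \<Longrightarrow> lambda_map n a b \<alpha> \<in> khom KB (KN \<alpha>)"
  using Lmor_khom [of "[\<alpha>]"] by (simp only: KA_singleton lambda_map_eq) (simp add: mat_1)

end

theorem theorem5p1:
  fixes a b :: nat and n :: int and \<alpha>s :: "nat list list"
  assumes "distinct \<alpha>s" and "set \<alpha>s = Parts a b"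
  shows "(\<forall>\<alpha> \<in> Parts a b.
        (sigma_map n a b \<alpha> :: 'k::{comm_ring,monoid_mult} two_mor)
          \<in> khom (kshift (2 * int (sum_list \<alpha>) - int (a * b)) (Ediv (a + b) n))
                 (Ediv a (n + 2 * int b) \<diamondop>\<^sub>K Ediv b n)
      \<and> (lambda_map n a b \<alpha> :: 'k two_mor)
          \<in> khom (Ediv a (n + 2 * int b) \<diamondop>\<^sub>K Ediv b n)
                 (kshift (2 * int (sum_list \<alpha>) - int (a * b)) (Ediv (a + b) n)))
    \<and> mutually_inverse
        (kdsum n (n + 2 * int (a + b))
          [kshift (2 * int (sum_list \<alpha>) - int (a * b)) (Ediv (a + b) n). \<alpha> \<leftarrow> \<alpha>s])
        (Ediv a (n + 2 * int b) \<diamondop>\<^sub>K Ediv b n)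
        (out_of_dsum n (n + 2 * int (a + b)) (fst (Ediv a (n + 2 * int b) \<diamondop>\<^sub>K Ediv b n :: 'k kob))
          [sigma_map n a b \<alpha>. \<alpha> \<leftarrow> \<alpha>s] :: 'k two_mor)
        (into_dsum n (n + 2 * int (a + b)) (fst (Ediv a (n + 2 * int b) \<diamondop>\<^sub>K Ediv b n :: 'k kob))
          [lambda_map n a b \<alpha>. \<alpha> \<leftarrow> \<alpha>s] :: 'k two_mor)
    \<and> (Ediv a (n + 2 * int b) \<diamondop>\<^sub>K Ediv b n :: 'k kob)
        \<cong>\<^sub>K kdsum n (n + 2 * int (a + b))
              [kshift (2 * int (sum_list \<alpha>) - int (a * b)) (Ediv (a + b) n). \<alpha> \<leftarrow> \<alpha>s]"
proof -
  interpret E_split n a b "TYPE('k)" .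
  have sub: "set \<alpha>s \<subseteq> Parts a b" using assms by simp
  note i = Smor_khom [OF sub] Lmor_khom [OF sub] Lmor_Smor [OF sub assms(1)] Smor_Lmor [OF sub assms]
  have "mutually_inverse (KA \<alpha>s) KB (Smor \<alpha>s) (Lmor \<alpha>s)" "KB \<cong>\<^sub>K KA \<alpha>s"
    using i unfolding mutually_inverse_def kiso_def by blast+
  then show ?thesis
    using sigma_map_khom lambda_map_khom by (simp only: out_eq into_eq) blast
qed

end
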